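(* Let $n\ge2$, $p>0$, and let $\mu$ be a measure on $\mathbb{R}^n$ with a continuous density $g$ that is $p$-concave and $\frac1p$-homogeneous. Let $K$ be an origin-symmetric convex body and $L$ a star body in $\mathbb{R}^n$, and let $\varepsilon\ge0$ be such that $$P_{\mu,K}(\theta)\le\mu_{n-1}(L\cap\theta^\perp)+\varepsilon\qquad\text{for all }\theta\in S^{n-1}.$$ Setting $q=\frac{1}{n+\frac1p}$, we have $$\mu(K)^{1-q}\le\left(\frac{1-\frac1n}{1-q}\right)\mu(L)^{1-q}+\frac{\omega_n}{\mu(B_2^n)^q\,\omega_{n-1}}\,\varepsilon.$$
   Context: A function $f\ge0$ is $p$-concave ($p\neq0$) if $f(\lambda x+(1-\lambda)y)\ge(\lambda f(x)^p+(1-\lambda)f(y)^p)^{1/p}$ for all $\lambda\in[0,1]$ and $x,y$ in the support of $f$; it is $s$-homogeneous if $f(ax)=a^sf(x)$ for all $a>0$, $x\in\mathbb{R}^n$. A star body is a compact set $L$ such that $x\in L$ implies $[0,x)\subseteq\operatorname{int}L$. $\omega_k$ is the volume of the $k$-dimensional Euclidean unit ball, $B_2^n$ the unit ball. Mixed $\mu$-measure: $\mu_1(A,B)=\liminf_{\varepsilon\to0}\frac{\mu(A+\varepsilon B)-\mu(A)}{\varepsilon}$. $\mu$-projection: $P_{\mu,K}(\theta)=\frac n2\int_0^1\mu_1(tK,[-\theta,\theta])\,dt$. For $A\subseteq\theta^\perp$, $\mu_{n-1}(A)=\int_A g\,d\lambda_{n-1}$ with $\lambda_{n-1}$ Lebesgue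 measure on $\theta^\perp$. *)

theory Defs
  imports "HOL-Analysis.Analysis"
begin

definition msum :: "'a::real_vector set \<Rightarrow> 'a set \<Rightarrow> 'a set" where
  "msum A B = {a + b | a b. a \<in> A \<and> b \<in> B}"

definition sdil :: "real \<Rightarrow> 'a::real_vector set \<Rightarrow> 'a set" where
  "sdil t A = (\<lambda>x. t *\<^sub>R x) ` A"

definition mu :: "('a::euclidean_space \<Rightarrow> real) \<Rightarrow> 'a set \<Rightarrow> real" where
  "mu g A = measure (density lborel (\<lambda>x. ennreal (g x))) A"

definition mixed_mu :: "('a::euclidean_space \<Rightarrow> real) \<Rightarrow> 'a set \<Rightarrow> 'a set \<Rightarrow> ennreal" where
  "mixed_mu g A B =
     Liminf (at_right 0) (\<lambda>e. ennreal ((mu g (msum A (sdil e B)) - mu g A) / e))"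

definition mu_proj :: "(real^'n \<Rightarrow> real) \<Rightarrow> (real^'n) set \<Rightarrow> real^'n \<Rightarrow> ennreal" where
  "mu_proj g K \<theta> =
     ennreal (real CARD('n) / 2) *
     set_nn_integral lborel {0..1} (\<lambda>t. mixed_mu g (sdil t K) (closed_segment (-\<theta>) \<theta>))"

text \<open>(n-1)-dimensional Lebesgue measure on the hyperplane orthogonal to theta, realised as the
  image of Lebesgue measure on an (n-1)-dimensional Euclidean space 'm under a linear isometry
  onto that hyperplane; mu_{n-1}(A) is the integral of g over A with respect to it.\<close>
definition hyp_iso :: "'m::euclidean_space itself \<Rightarrow> real^'n \<Rightarrow> ('m \<Rightarrow> real^'n)" where
  "hyp_iso _ \<theta> = (SOME f. linear f \<and> (\<forall>y. norm (f y) = norm y) \<and> range f = {x. x \<bullet> \<theta> = 0})"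

definition mu_hyp :: "'m::euclidean_space itself \<Rightarrow> (real^'n \<Rightarrow> real) \<Rightarrow> real^'n \<Rightarrow> (real^'n) set \<Rightarrow> ennreal" where
  "mu_hyp M g \<theta> A =
     (\<integral>\<^sup>+ y. ennreal (g (hyp_iso M \<theta> y)) * indicator A (hyp_iso M \<theta> y) \<partial>(lborel :: 'm measure))"

definition p_concave :: "real \<Rightarrow> ('a::real_vector \<Rightarrow> real) \<Rightarrow> bool" where
  "p_concave p f \<longleftrightarrow> (\<forall>x. 0 \<le> f x) \<and>
     (\<forall>x y l. 0 < f x \<longrightarrow> 0 < f y \<longrightarrow> 0 \<le> l \<longrightarrow> l \<le> 1 \<longrightarrow>
        f (l *\<^sub>R x + (1 - l) *\<^sub>R y) \<ge> (l * f x powr p + (1 - l) * f y powr p) powr (1 / p))"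

definition homogeneous :: "real \<Rightarrow> ('a::real_vector \<Rightarrow> real) \<Rightarrow> bool" where
  "homogeneous s f \<longleftrightarrow> (\<forall>a x. 0 < a \<longrightarrow> f (a *\<^sub>R x) = a powr s * f x)"

definition convex_body :: "'a::euclidean_space set \<Rightarrow> bool" where
  "convex_body K \<longleftrightarrow> compact K \<and> convex K \<and> interior K \<noteq> {}"

definition origin_symmetric :: "'a::real_vector set \<Rightarrow> bool" where
  "origin_symmetric K \<longleftrightarrow> (\<forall>x\<in>K. - x \<in> K)"

definition star_body :: "'a::euclidean_space set \<Rightarrow> bool" where
  "star_body L \<longleftrightarrow> compact L \<and> (\<forall>x\<in>L. closed_segment 0 x - {x} \<subseteq> interior L)"

end

theory Submission
  imports Defs
begin

text \<open>
  Let \<open>d = n + 1/p = 1/q\<close>, let \<open>\<phi>\<close> be the gauge of \<open>K\<close> and \<open>\<xi>\<close> its almost everywhere gradient. Homogeneity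
  of \<open>\<mu>\<close> gives \<open>\<mu>(A) = (d + 1) \<integral> g (1 - \<psi>)\<^sub>+\<close> for every convex body \<open>A\<close> with gauge \<open>\<psi>\<close>. Comparing
  \<open>\<phi>\<close> with the gauge of \<open>K + h [-\<theta>, \<theta>]\<close>, Fatou's lemma yields
  \<open>P(\<theta>) \<ge> (n/2) ((d + 1)/d) \<integral>\<^sub>K g \<phi> |\<xi> \<bullet> \<theta>|\<close>; comparing it with the gauge of \<open>K + \<eta> B\<close>, the
  Brunn--Minkowski inequality for \<open>\<mu>\<close> (Prekopa--Leindler plus homogeneity) yields
  \<open>\<integral>\<^sub>K g \<phi> |\<xi>| \<ge> (d/(d + 1)) \<mu>(K)\<^bsup>1-q\<^esup> \<mu>(B)\<^bsup>q\<^esup>\<close>.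
  Averaging the hypothesis over all directions with the weight \<open>1/|v|\<close> on the unit ball replaces
  \<open>|\<xi> \<bullet> \<theta>|\<close> by a multiple of \<open>|\<xi>|\<close>, and bounds the average of \<open>\<mu>\<^sub>n\<^sub>-\<^sub>1(L \<inter> \<theta>\<^sup>\<bottom>)\<close>, a limit of slab
  measures, by a multiple of \<open>\<integral>\<^sub>L g/|x|\<close>. Among sets of given \<open>\<mu>\<close>-measure the latter integral is
  largest for a centred ball, where it can be computed.
  Only one-sided estimates are needed throughout, so neither surface measures nor the measurability
  of \<open>P\<close> in \<open>\<theta>\<close> enters.
\<close>
section \<open>The Prekopa--Leindler inequality\<close>

text \<open>The difference of two indicator functions concentrates near a boundary, while
  \<open>(1 - \<psi>)\<close> changes pointwise with the gauge, so pointwise bounds and Fatou's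
  lemma apply under the integral. By the coarea formula, the integral of g \<phi> |\<xi>| over
  \<open>K\<close> is 1/(d + 1) times that of g over the boundary, which explains the factors d + 1.

  The weight 1/|v| is chosen for symmetry: with \<theta> = v/|v| the slab |x \<bullet> \<theta>| <
  s/|v| is |x \<bullet> v| < s, symmetric in x and v. After Fubini it is a slab in v orthogonal to
  x, whose volume in the unit ball is at most 2 s \<omega>_(n-1) / |x|; this produces the integral
  of g/|x|.

  Constants: the gradient side carries n/(n - 1) \<omega>_(n-1) \<mu>(B)^q, the rearranged ball
  contributes the radial factor d/(d - 1) = 1/(1 - q), and 1/|v| integrates over the unit ball to
  n/(n - 1) \<omega>_n. Division by the first coefficient leaves those of the theorem.\<close>

lemma emeasure_vimage_scale_real:
  fixes c :: real
  assumes "c > 0" "A \<in> sets borel"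
  shows "emeasure lborel ((\<lambda>x. x / c) -` A) = ennreal c * emeasure lborel A"
proof -
  have "emeasure lborel ((\<lambda>x. x / c) -` A) = emeasure (distr lborel borel ((*) (1/c))) A"
    using assms by (subst emeasure_distr) (auto simp: vimage_def)
  also have "\<dots> = emeasure (density lborel (\<lambda>_. ennreal (inverse \<bar>1/c\<bar>))) A"
    using assms by (subst lborel_distr_mult) auto
  also have "\<dots> = ennreal c * emeasure lborel A"
    using assms by (subst emeasure_density_const) auto
  finally show ?thesis .
qed

section \<open>Brunn--Minkowski on the real line\<close>

lemma compact_inner_approx:
  fixes A :: "'a::euclidean_space set"
  assumes "A \<in> sets borel" "bounded A" "A \<noteq> {}" "e > 0"
  obtains T where "compact T" "T \<subseteq> A" "T \<noteq> {}" "emeasure lborel A \<le> emeasure lborel T + ennreal e"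
proof -
  have "A \<in> sets lebesgue" using assms by auto
  then obtain S where S: "closed S" "S \<subseteq> A" "emeasure lebesgue (A - S) < ennreal e"
    using sets_lebesgue_inner_closed[of A e] \<open>e > 0\<close> by metis
  obtain a where a: "a \<in> A" using assms by auto
  have S': "S \<in> sets borel" using S by (simp add: borel_closed)
  show ?thesis
  \<comment> \<open>The extra point keeps the compact set nonempty when \<open>A\<close> is null,
    where \<open>S\<close> may be empty.\<close>
  proof (rule that[of "insert a S"])
    show "compact (insert a S)"
      using S assms by (meson bounded_subset compact_eq_bounded_closed compact_insert)
    have "emeasure lborel A = emeasure lborel S + emeasure lborel (A - S)"
      using S S' assms by (subst plus_emeasure) (auto intro!: arg_cong[where f="emeasure lborel"])
    also have "emeasure lborel (A - S) = emeasure lebesgue (A - S)"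
      using S' assms by auto
    also have "emeasure lborel S + \<dots> \<le> emeasure lborel (insert a S) + ennreal e"
      using S S' by (intro add_mono emeasure_mono) auto
    finally show "emeasure lborel A \<le> emeasure lborel (insert a S) + ennreal e" .
  qed (use S a in auto)
qed

text \<open>The translates \<open>k + A\<close> and \<open>m + B\<close>, with \<open>m\<close> the
  maximum of \<open>A\<close> and \<open>k\<close> the minimum of \<open>B\<close>, lie in the sum
  set and overlap only in the point \<open>k + m\<close>, so their lengths add up.\<close>

lemma brunn_minkowski_real_compact:
  fixes A B C :: "real set"
  assumes "compact A" "compact B" "A \<noteq> {}" "B \<noteq> {}" "C \<in> sets borel"
    and sub: "\<And>a b. a \<in> A \<Longrightarrow> b \<in> B \<Longrightarrow> a + b \<in> C"
  shows "emeasure lborel A + emeasure lborel B \<le> emeasure lborel C"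
proof -
  obtain m where m: "m \<in> A" "\<And>a. a \<in> A \<Longrightarrow> a \<le> m"
    using compact_attains_sup[of A] assms by auto
  obtain k where k: "k \<in> B" "\<And>b. b \<in> B \<Longrightarrow> k \<le> b"
    using compact_attains_inf[of B] assms by auto
  let ?A = "(\<lambda>x. k + x) ` A" and ?B = "(\<lambda>x. m + x) ` B"
  have cA: "compact ?A" and cB: "compact ?B"
    using assms by (auto intro!: compact_continuous_image continuous_intros)
  have tr: "emeasure lborel ((\<lambda>x. c + x) ` S) = emeasure lborel S" if "compact S" for c and S :: "real set"
  proof -
    have cc: "compact ((\<lambda>x. c + x) ` S)"
      using that by (auto intro!: compact_continuous_image continuous_intros)
    have "emeasure lborel ((\<lambda>x. c + x) ` S) = emeasure (distr lborel borel ((+) c)) ((\<lambda>x. c + x) ` S)"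
      by (simp add: lborel_distr_plus)
    also have "\<dots> = emeasure lborel S"
      using cc by (subst emeasure_distr) (auto simp: borel_compact intro!: arg_cong[where f="emeasure lborel"])
    finally show ?thesis .
  qed
  have "?A \<inter> ?B \<subseteq> {k + m}"
  proof
    fix x assume "x \<in> ?A \<inter> ?B"
    then obtain a b where "x = k + a" "x = m + b" "a \<in> A" "b \<in> B" by blast
    with m(2)[of a] k(2)[of b] show "x \<in> {k + m}" by simp
  qed
  then have int0: "emeasure lborel (?A \<inter> ?B) = 0"
    using emeasure_mono[of "?A \<inter> ?B" "{k+m}" lborel] by auto
  have "emeasure lborel A + emeasure lborel B = emeasure lborel ?A + emeasure lborel ?B"
    using tr assms by simp
  also have "\<dots> = emeasure lborel (?A \<union> ?B) + emeasure lborel (?A \<inter> ?B)"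
    using cA cB by (subst emeasure_Un_Int) (auto simp: borel_compact)
  also have "\<dots> = emeasure lborel (?A \<union> ?B)" using int0 by simp
  also have "\<dots> \<le> emeasure lborel C"
    using m(1) k(1) assms(5) by (intro emeasure_mono) (auto simp: add.commute[of k] intro!: sub)
  finally show ?thesis .
qed

text \<open>The sum of two Borel sets need not be Borel, so a Borel superset \<open>C\<close> stands
  in for it; inner compact approximation reduces the claim to the compact case.\<close>

lemma brunn_minkowski_real:
  fixes A B C :: "real set"
  assumes A: "A \<in> sets borel" "bounded A" "A \<noteq> {}" and B: "B \<in> sets borel" "bounded B" "B \<noteq> {}"
    and C: "C \<in> sets borel" and sub: "\<And>a b. a \<in> A \<Longrightarrow> b \<in> B \<Longrightarrow> a + b \<in> C"
  shows "emeasure lborel A + emeasure lborel B \<le> emeasure lborel C"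
proof (rule ennreal_le_epsilon)
  fix e :: real assume e: "e > 0"
  obtain S where S: "compact S" "S \<subseteq> A" "S \<noteq> {}" "emeasure lborel A \<le> emeasure lborel S + ennreal (e/2)"
    using compact_inner_approx[OF A, of "e/2"] e by auto
  obtain T where T: "compact T" "T \<subseteq> B" "T \<noteq> {}" "emeasure lborel B \<le> emeasure lborel T + ennreal (e/2)"
    using compact_inner_approx[OF B, of "e/2"] e by auto
  have "emeasure lborel A + emeasure lborel B
      \<le> (emeasure lborel S + ennreal (e/2)) + (emeasure lborel T + ennreal (e/2))"
    by (intro add_mono S T)
  also have "\<dots> = (emeasure lborel S + emeasure lborel T) + (ennreal (e/2) + ennreal (e/2))"
    by (simp only: ac_simps)
  also have "ennreal (e/2) + ennreal (e/2) = ennreal e"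
    using e by (subst ennreal_plus[symmetric]) auto
  also have "emeasure lborel S + emeasure lborel T \<le> emeasure lborel C"
    using S T sub C by (intro brunn_minkowski_real_compact) auto
  finally show "emeasure lborel A + emeasure lborel B \<le> emeasure lborel C + ennreal e"
    by (simp add: add_right_mono)
qed

lemma brunn_minkowski_real_combination:
  fixes A B C :: "real set"
  assumes A: "A \<in> sets borel" "bounded A" "A \<noteq> {}" and B: "B \<in> sets borel" "bounded B" "B \<noteq> {}"
    and C: "C \<in> sets borel" and l: "0 < l" "l < 1"
    and sub: "\<And>a b. a \<in> A \<Longrightarrow> b \<in> B \<Longrightarrow> (1 - l) * a + l * b \<in> C"
  shows "ennreal (1 - l) * emeasure lborel A + ennreal l * emeasure lborel B \<le> emeasure lborel C"
proof -
  have eq: "(\<lambda>x. x / c) -` S = (*) c ` S" if "c > 0" for c :: real and S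
    using that by (auto simp: image_iff intro!: bexI[where x="_ / c"])
  have "emeasure lborel ((\<lambda>x. x / (1-l)) -` A) + emeasure lborel ((\<lambda>x. x / l) -` B) \<le> emeasure lborel C"
  proof (rule brunn_minkowski_real)
    show "bounded ((\<lambda>x. x / (1-l)) -` A)" "bounded ((\<lambda>x. x / l) -` B)"
      using bounded_scaling[OF A(2), of "1-l"] bounded_scaling[OF B(2), of l] l
      by (auto simp: eq)
    show "(\<lambda>x. x / (1-l)) -` A \<in> sets borel" "(\<lambda>x. x / l) -` B \<in> sets borel"
      using A B l by (auto intro!: measurable_sets_borel[where M=borel] borel_measurable_divide)
    show "(\<lambda>x. x / (1-l)) -` A \<noteq> {}" "(\<lambda>x. x / l) -` B \<noteq> {}"
      using A B l by (auto simp: eq)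
    show "a + b \<in> C" if "a \<in> (\<lambda>x. x / (1-l)) -` A" "b \<in> (\<lambda>x. x / l) -` B" for a b
      using sub[of "a/(1-l)" "b/l"] that l by simp
  qed fact
  then show ?thesis using A B l by (simp add: emeasure_vimage_scale_real)
qed

text \<open>The layer-cake formula for \<open>u / m\<close> with heights restricted to (0, 1), hence
  the truncation at 1. For a possibly unbounded \<open>h\<close> in Prekopa--Leindler the truncation
  errs in the harmless direction.\<close>

lemma nn_integral_level_sets:
  fixes u :: "'a \<Rightarrow> ennreal"
  assumes [measurable]: "u \<in> borel_measurable M" and sf: "sigma_finite_measure M" and m: "m > 0"
  shows "(\<integral>\<^sup>+t. emeasure M {x\<in>space M. ennreal (t * m) < u x} * indicator {0<..<1} t \<partial>lborel)
       = (\<integral>\<^sup>+x. min 1 (u x / ennreal m) \<partial>M)"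
proof -
  let ?I = "\<lambda>t x. if ennreal (t * m) < u x \<and> 0 < t \<and> t < 1 then 1 else (0::ennreal)"
  interpret sigma_finite_measure M by fact
  interpret pair_sigma_finite lborel M ..
  have "(\<integral>\<^sup>+t. emeasure M {x\<in>space M. ennreal (t * m) < u x} * indicator {0<..<1} t \<partial>lborel)
     = (\<integral>\<^sup>+t. \<integral>\<^sup>+x. indicator {x\<in>space M. ennreal (t * m) < u x} x * indicator {0<..<1} t \<partial>M \<partial>lborel)"
    by (intro nn_integral_cong) (simp add: nn_integral_multc)
  also have "\<dots> = (\<integral>\<^sup>+t. \<integral>\<^sup>+x. ?I t x \<partial>M \<partial>lborel)"
    by (intro nn_integral_cong) (auto simp: indicator_def)
  also have "\<dots> = (\<integral>\<^sup>+x. \<integral>\<^sup>+t. ?I t x \<partial>lborel \<partial>M)"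
    by (rule Fubini'[symmetric]) measurable
  also have "\<dots> = (\<integral>\<^sup>+x. min 1 (u x / ennreal m) \<partial>M)"
  proof (rule nn_integral_cong)
    fix x
    have "(\<integral>\<^sup>+t. ?I t x \<partial>lborel)
       = (\<integral>\<^sup>+t. indicator {0<..<(if u x = top then 1 else min 1 (enn2real (u x) / m))} t \<partial>lborel)"
    proof (intro nn_integral_cong)
      fix t :: real
      show "?I t x
        = (indicator {0<..<(if u x = top then 1 else min 1 (enn2real (u x) / m))} t :: ennreal)"
      proof (cases "u x")
        case (real r)
        then show ?thesis using m by (auto simp: indicator_def field_simps ennreal_less_iff)
      next
        case top then show ?thesis by (auto simp: indicator_def)
      qed
    qed
    also have "\<dots> = min 1 (u x / ennreal m)"
    proof (cases "u x")
      case (real r)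
      then show ?thesis using m by (simp add: divide_ennreal min_def ennreal_le_1 flip: ennreal_1)
    next
      case top then show ?thesis using m by (simp add: ennreal_top_divide)
    qed
    finally show "(\<integral>\<^sup>+t. ?I t x \<partial>lborel) = min 1 (u x / ennreal m)" .
  qed
  finally show ?thesis .
qed

text \<open>Dividing \<open>f\<close> and \<open>g\<close> by their suprema makes both superlevel
  sets nonempty at every height in (0, 1), which the Brunn--Minkowski step needs. Integration over
  the heights bounds an arithmetic mean of the normalised integrals, and Young's inequality turns it
  into the geometric mean.\<close>

lemma prekopa_leindler_real:
  fixes f g :: "real \<Rightarrow> real" and h :: "real \<Rightarrow> ennreal"
  assumes [measurable]: "f \<in> borel_measurable borel" "g \<in> borel_measurable borel" "h \<in> borel_measurable borel"
    and f: "\<And>x. 0 \<le> f x" "\<And>x. f x \<le> C" "\<And>x. \<bar>x\<bar> > R \<Longrightarrow> f x = 0"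
    and g: "\<And>x. 0 \<le> g x" "\<And>x. g x \<le> C" "\<And>x. \<bar>x\<bar> > R \<Longrightarrow> g x = 0"
    and l: "0 < l" "l < 1"
    and h: "\<And>x y. ennreal (f x powr (1 - l) * g y powr l) \<le> h ((1 - l) * x + l * y)"
  shows "ennreal (enn2real (\<integral>\<^sup>+x. f x \<partial>lborel) powr (1 - l) * enn2real (\<integral>\<^sup>+x. g x \<partial>lborel) powr l)
          \<le> (\<integral>\<^sup>+x. h x \<partial>lborel)"
proof (cases "(\<forall>x. f x = 0) \<or> (\<forall>x. g x = 0)")
  case True
  then show ?thesis by auto
next
  case False
  have fin: "(\<integral>\<^sup>+x. ennreal (u x) \<partial>lborel) < \<infinity>" if "\<And>x. u x \<le> C" "\<And>x. \<bar>x\<bar> > R \<Longrightarrow> u x = 0" for u :: "real \<Rightarrow> real"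
  proof -
    have "(\<integral>\<^sup>+x. ennreal (u x) \<partial>lborel) \<le> (\<integral>\<^sup>+x. ennreal C * indicator {-R..R} x \<partial>lborel)"
      using that by (intro nn_integral_mono) (auto simp: indicator_def ennreal_leI abs_real_def split: if_splits)
    also have "\<dots> < \<infinity>" by (simp add: nn_integral_cmult emeasure_lborel_Icc_eq ennreal_mult_less_top)
    finally show ?thesis .
  qed
  define mf mg where "mf = Sup (range f)" and "mg = Sup (range g)"
  have bf: "bdd_above (range f)" and bg: "bdd_above (range g)" using f g by (auto intro!: bdd_aboveI)
  have lef: "f x \<le> mf" and leg: "g x \<le> mg" for x
    unfolding mf_def mg_def by (auto intro: cSup_upper bf bg)
  obtain x0 y0 where "f x0 > 0" "g y0 > 0" using False f(1) g(1) by (metis less_eq_real_def)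
  then have pos: "mf > 0" "mg > 0" using lef leg by (meson less_le_trans)+
  define m where "m = mf powr (1-l) * mg powr l"
  have m: "m > 0" unfolding m_def using pos by simp
  define a b where "a = enn2real (\<integral>\<^sup>+x. f x \<partial>lborel)" and "b = enn2real (\<integral>\<^sup>+x. g x \<partial>lborel)"
  have a: "(\<integral>\<^sup>+x. f x \<partial>lborel) = ennreal a" and b: "(\<integral>\<^sup>+x. g x \<partial>lborel) = ennreal b"
    unfolding a_def b_def using fin[of f] fin[of g] f g by auto
  have ab: "a \<ge> 0" "b \<ge> 0" by (auto simp: a_def b_def)
  have lev: "(\<integral>\<^sup>+t. emeasure lborel {x. ennreal (t * k) < ennreal (u x)} * indicator {0<..<1} t \<partial>lborel)
       = (\<integral>\<^sup>+x. u x \<partial>lborel) / ennreal k" if [measurable]: "u \<in> borel_measurable borel" and "k > 0" "\<And>x. u x \<le> k" "\<And>x. 0 \<le> u x" for u k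
  proof -
    have "(\<integral>\<^sup>+t. emeasure lborel {x. ennreal (t * k) < ennreal (u x)} * indicator {0<..<1} t \<partial>lborel)
       = (\<integral>\<^sup>+x. min 1 (ennreal (u x) / ennreal k) \<partial>lborel)"
      using nn_integral_level_sets[of "\<lambda>x. ennreal (u x)" lborel k] that sigma_finite_lborel by simp
    also have "\<dots> = (\<integral>\<^sup>+x. ennreal (u x) / ennreal k \<partial>lborel)"
      using that by (intro nn_integral_cong) (auto simp: divide_ennreal min_def ennreal_le_1 simp flip: ennreal_1 intro!: antisym)
    also have "\<dots> = (\<integral>\<^sup>+x. u x \<partial>lborel) / ennreal k" by (simp add: nn_integral_divide)
    finally show ?thesis .
  qed
  have meas: "(\<lambda>t. emeasure lborel {x. ennreal (t * k) < ennreal (u x)}) \<in> borel_measurable lborel"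
    if [measurable]: "u \<in> borel_measurable borel" for k and u :: "real \<Rightarrow> real"
    by (rule lborel.measurable_emeasure) (simp, measurable)
  note [measurable] = meas[of f mf, simplified] meas[of g mg, simplified]
  have "ennreal ((a / mf) powr (1-l) * (b / mg) powr l) \<le> ennreal ((1-l) * (a/mf) + l * (b/mg))"
  proof (rule ennreal_leI)
    show "(a / mf) powr (1-l) * (b / mg) powr l \<le> (1-l) * (a/mf) + l * (b/mg)"
    proof (cases "a = 0 \<or> b = 0")
      case True
      then show ?thesis using ab pos l by auto
    next
      case False
      then show ?thesis using ab pos l by (intro Youngs_inequality_0) auto
    qed
  qed
  also have "\<dots> = ennreal (1-l) * (ennreal a / ennreal mf) + ennreal l * (ennreal b / ennreal mg)"
    using pos ab l by (simp add: divide_ennreal flip: ennreal_mult')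
  also have "\<dots> = (\<integral>\<^sup>+t. (ennreal (1-l) * emeasure lborel {x. ennreal (t * mf) < ennreal (f x)}
        + ennreal l * emeasure lborel {x. ennreal (t * mg) < ennreal (g x)}) * indicator {0<..<1} t \<partial>lborel)"
    using lev[of f mf] lev[of g mg] pos lef leg f g a b
    by (simp add: distrib_right mult.assoc nn_integral_add nn_integral_cmult)
  also have "\<dots> \<le> (\<integral>\<^sup>+t. emeasure lborel {x. ennreal (t * m) < h x} * indicator {0<..<1} t \<partial>lborel)"
  proof (rule nn_integral_mono)
    fix t :: real
    show "(ennreal (1-l) * emeasure lborel {x. ennreal (t * mf) < ennreal (f x)}
        + ennreal l * emeasure lborel {x. ennreal (t * mg) < ennreal (g x)}) * indicator {0<..<1} t
       \<le> emeasure lborel {x. ennreal (t * m) < h x} * indicator {0<..<1} t"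
    proof (cases "0 < t \<and> t < 1")
      case True
      have "ennreal (1-l) * emeasure lborel {x. t * mf < f x} + ennreal l * emeasure lborel {x. t * mg < g x}
         \<le> emeasure lborel {x. ennreal (t * m) < h x}"
      proof (rule brunn_minkowski_real_combination)
        have "{x. t * mf < f x} \<subseteq> {-R..R}"
        proof
          fix x assume "x \<in> {x. t * mf < f x}"
          moreover have "t * mf > 0" using True pos by simp
          ultimately have "\<not> \<bar>x\<bar> > R" using f(3)[of x] by force
          then show "x \<in> {-R..R}" by auto
        qed
        then show "bounded {x. t * mf < f x}" by (rule bounded_subset[OF bounded_closed_interval])
        have "{x. t * mg < g x} \<subseteq> {-R..R}"
        proof
          fix x assume "x \<in> {x. t * mg < g x}"
          moreover have "t * mg > 0" using True pos by simp
          ultimately have "\<not> \<bar>x\<bar> > R" using g(3)[of x] by force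
          then show "x \<in> {-R..R}" by auto
        qed
        then show "bounded {x. t * mg < g x}" by (rule bounded_subset[OF bounded_closed_interval])
        have "t * mf < mf" "t * mg < mg" using True pos by auto
        then show "{x. t * mf < f x} \<noteq> {}" "{x. t * mg < g x} \<noteq> {}"
          unfolding mf_def mg_def using less_cSup_iff[OF _ bf] less_cSup_iff[OF _ bg] by auto
        fix x y assume "x \<in> {x. t * mf < f x}" "y \<in> {x. t * mg < g x}"
        then have xy: "t * mf < f x" "t * mg < g y" by auto
        have "t * m = (t powr (1-l) * t powr l) * (mf powr (1-l) * mg powr l)"
          using True by (simp add: m_def flip: powr_add)
        also have "\<dots> = (t * mf) powr (1-l) * (t * mg) powr l"
          using True pos by (simp add: powr_mult)
        also have "\<dots> < f x powr (1-l) * g y powr l"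
        proof (intro mult_strict_mono powr_less_mono2)
          have "0 < t * mf" using True pos by simp
          then show "0 < f x powr (1-l)" using xy(1) by simp
        qed (use xy True pos l in auto)
        finally have "ennreal (t * m) < ennreal (f x powr (1-l) * g y powr l)"
          using True m by (simp add: ennreal_less_iff)
        with h[of x y] show "(1 - l) * x + l * y \<in> {x. ennreal (t * m) < h x}" by auto
      qed (use l in auto)
      then show ?thesis using True f g pos by (simp add: ennreal_less_iff)
    qed auto
  qed
  also have "\<dots> = (\<integral>\<^sup>+x. min 1 (h x / ennreal m) \<partial>lborel)"
    using nn_integral_level_sets[of h lborel m] m sigma_finite_lborel by simp
  also have "\<dots> \<le> (\<integral>\<^sup>+x. h x / ennreal m \<partial>lborel)" by (intro nn_integral_mono) auto
  also have "\<dots> = (\<integral>\<^sup>+x. h x \<partial>lborel) / ennreal m" by (simp add: nn_integral_divide)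
  \<comment> \<open>Multiplication by \<open>m\<close>, the product of powers of the two suprema,
    undoes the normalisation.\<close>
  finally have "ennreal m * ennreal ((a / mf) powr (1-l) * (b / mg) powr l) \<le> ennreal m * ((\<integral>\<^sup>+x. h x \<partial>lborel) / ennreal m)"
    by (rule mult_left_mono) auto
  also have "\<dots> = (\<integral>\<^sup>+x. h x \<partial>lborel)"
    using m by (simp add: ennreal_times_divide mult.commute[of "ennreal m"] ennreal_mult_divide_eq)
  also have "ennreal m * ennreal ((a / mf) powr (1-l) * (b / mg) powr l) = ennreal (a powr (1-l) * b powr l)"
    using m pos ab by (simp add: m_def powr_divide flip: ennreal_mult')
  finally show ?thesis by (simp add: a_def b_def)
qed


text \<open>Tensorisation: for fixed values of the coordinate \<open>i\<close>, the induction
  hypothesis applied to the slices is exactly the one-dimensional assumption on the marginals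
  \<open>F\<close>, \<open>G\<close>, \<open>H\<close>. Points of the product space are extensional
  functions, so convex combinations are restricted back to \<open>I\<close>.\<close>

lemma prekopa_leindler_PiM:
  fixes f g :: "('i \<Rightarrow> real) \<Rightarrow> real" and h :: "('i \<Rightarrow> real) \<Rightarrow> ennreal"
  assumes "finite I" "0 < l" "l < 1" "0 \<le> C" "0 \<le> R"
    and "f \<in> borel_measurable (Pi\<^sub>M I (\<lambda>_. lborel))" "g \<in> borel_measurable (Pi\<^sub>M I (\<lambda>_. lborel))"
      "h \<in> borel_measurable (Pi\<^sub>M I (\<lambda>_. lborel))"
    and "\<And>x. 0 \<le> f x" "\<And>x. f x \<le> C" "\<And>x i. i \<in> I \<Longrightarrow> \<bar>x i\<bar> > R \<Longrightarrow> f x = 0"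
    and "\<And>x. 0 \<le> g x" "\<And>x. g x \<le> C" "\<And>x i. i \<in> I \<Longrightarrow> \<bar>x i\<bar> > R \<Longrightarrow> g x = 0"
    and "\<And>x y. x \<in> extensional I \<Longrightarrow> y \<in> extensional I \<Longrightarrow>
           ennreal (f x powr (1 - l) * g y powr l) \<le> h (\<lambda>i\<in>I. (1 - l) * x i + l * y i)"
  shows "ennreal (enn2real (\<integral>\<^sup>+x. f x \<partial>Pi\<^sub>M I (\<lambda>_. lborel)) powr (1 - l)
            * enn2real (\<integral>\<^sup>+x. g x \<partial>Pi\<^sub>M I (\<lambda>_. lborel)) powr l)
          \<le> (\<integral>\<^sup>+x. h x \<partial>Pi\<^sub>M I (\<lambda>_. lborel))"
  using assms
proof (induction I arbitrary: f g h C rule: finite_induct)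
  case empty
  have "ennreal (f (\<lambda>_. undefined) powr (1 - l) * g (\<lambda>_. undefined) powr l) \<le> h (\<lambda>_. undefined)"
    using empty.prems(14)[of "\<lambda>_. undefined" "\<lambda>_. undefined"] by simp
  then show ?case
    using empty.prems by (simp add: PiM_empty nn_integral_count_space_finite)
next
  case (insert i I)
  interpret product_sigma_finite "\<lambda>_::'i. lborel :: real measure" ..
  note [measurable] = insert.prems(5-7)
  interpret PI: sigma_finite_measure "Pi\<^sub>M I (\<lambda>_. lborel :: real measure)"
    using insert.hyps by (intro sigma_finite)
  let ?P = "Pi\<^sub>M I (\<lambda>_. lborel :: real measure)"
  have upd[measurable]: "(\<lambda>(t, x). x(i := t)) \<in> lborel \<Otimes>\<^sub>M ?P \<rightarrow>\<^sub>M Pi\<^sub>M (insert i I) (\<lambda>_. lborel)"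
    using measurable_compose[OF measurable_pair_swap' measurable_add_dim[of i I "\<lambda>_. lborel :: real measure"]]
    by (simp add: split_beta')
  have slice: "(\<lambda>(t, x). u (x(i := t))) \<in> lborel \<Otimes>\<^sub>M ?P \<rightarrow>\<^sub>M N"
    if "u \<in> Pi\<^sub>M (insert i I) (\<lambda>_. lborel) \<rightarrow>\<^sub>M N" for u and N :: "'c measure"
    using measurable_compose[OF upd that] by (simp add: split_beta')
  have slice1: "(\<lambda>x. u (x(i := t))) \<in> ?P \<rightarrow>\<^sub>M N"
    if "u \<in> Pi\<^sub>M (insert i I) (\<lambda>_. lborel) \<rightarrow>\<^sub>M N" for u t and N :: "'c measure"
    using measurable_compose[OF measurable_Pair1'[of t lborel] slice[OF that]] by simp
  \<comment> \<open>\<open>C\<close> times the volume of the cube of side \<open>2 * R\<close> in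
    the remaining coordinates; the one-dimensional case asks for bounded marginals.\<close>
  define D where "D = C * (2 * R) ^ card I"
  have bd: "(\<integral>\<^sup>+x. ennreal (u (x(i := t))) \<partial>?P) \<le> ennreal D"
    if "\<And>x. u x \<le> C" "\<And>x j. j \<in> insert i I \<Longrightarrow> \<bar>x j\<bar> > R \<Longrightarrow> u x = 0" for u :: "('i \<Rightarrow> real) \<Rightarrow> real" and t
  proof -
    have "(\<integral>\<^sup>+x. ennreal (u (x(i := t))) \<partial>?P) \<le> (\<integral>\<^sup>+x. ennreal C * (\<Prod>j\<in>I. indicator {-R..R} (x j)) \<partial>?P)"
    proof (rule nn_integral_mono)
      fix x
      show "ennreal (u (x(i := t))) \<le> ennreal C * (\<Prod>j\<in>I. indicator {-R..R} (x j))"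
      proof (cases "\<exists>j\<in>I. \<bar>x j\<bar> > R")
        case True
        then obtain j where j: "j \<in> I" "\<bar>x j\<bar> > R" by auto
        moreover have "j \<noteq> i" using j insert.hyps by auto
        ultimately have "u (x(i := t)) = 0" using that(2)[of j "x(i := t)"] by auto
        then show ?thesis by simp
      next
        case False
        then have "(\<Prod>j\<in>I. indicator {-R..R} (x j) :: ennreal) = 1"
          by (intro prod.neutral) (auto simp: indicator_def abs_le_iff not_less)
        then show ?thesis using that(1) by (simp add: ennreal_leI)
      qed
    qed
    also have "\<dots> = ennreal C * (\<Prod>j\<in>I. emeasure lborel {-R..R})"
      using insert.hyps product_nn_integral_prod[of I "\<lambda>_. indicator {-R..R}"] by (simp add: nn_integral_cmult)
    also have "\<dots> = ennreal C * ennreal (2 * R) ^ card I"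
      using insert.prems(4) by simp
    also have "\<dots> = ennreal D"
      using insert.prems(3,4) unfolding D_def by (subst ennreal_power) (auto simp only: ennreal_mult' mult_nonneg_nonneg)
    finally show ?thesis .
  qed
  have D: "D \<ge> 0" using insert.prems by (simp add: D_def)
  define F G H where "F t = enn2real (\<integral>\<^sup>+x. f (x(i := t)) \<partial>?P)" and "G t = enn2real (\<integral>\<^sup>+x. g (x(i := t)) \<partial>?P)"
    and "H t = (\<integral>\<^sup>+x. h (x(i := t)) \<partial>?P)" for t
  have bdf: "(\<integral>\<^sup>+x. ennreal (f (x(i := t))) \<partial>?P) \<le> ennreal D" for t
    by (rule bd) (fact insert.prems(9) insert.prems(10))+
  have bdg: "(\<integral>\<^sup>+x. ennreal (g (x(i := t))) \<partial>?P) \<le> ennreal D" for t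
    by (rule bd) (fact insert.prems(12) insert.prems(13))+
  have F: "ennreal (F t) = (\<integral>\<^sup>+x. f (x(i := t)) \<partial>?P)" for t
    unfolding F_def by (intro ennreal_enn2real le_less_trans[OF bdf ennreal_less_top])
  have G: "ennreal (G t) = (\<integral>\<^sup>+x. g (x(i := t)) \<partial>?P)" for t
    unfolding G_def by (intro ennreal_enn2real le_less_trans[OF bdg ennreal_less_top])
  have split: "(\<integral>\<^sup>+x. u x \<partial>Pi\<^sub>M (insert i I) (\<lambda>_. lborel)) = (\<integral>\<^sup>+t. \<integral>\<^sup>+x. u (x(i := t)) \<partial>?P \<partial>lborel)"
    if "u \<in> borel_measurable (Pi\<^sub>M (insert i I) (\<lambda>_. lborel))" for u
    using insert.hyps that by (intro product_nn_integral_insert_rev)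
  have "ennreal (enn2real (\<integral>\<^sup>+t. F t \<partial>lborel) powr (1 - l) * enn2real (\<integral>\<^sup>+t. G t \<partial>lborel) powr l)
       \<le> (\<integral>\<^sup>+t. H t \<partial>lborel)"
  proof (rule prekopa_leindler_real[where C=D and R=R])
    have "(\<lambda>t. \<integral>\<^sup>+x. f (x(i := t)) \<partial>?P) \<in> borel_measurable lborel"
      using slice[of "\<lambda>x. ennreal (f x)" borel] by (intro PI.borel_measurable_nn_integral) auto
    then show "F \<in> borel_measurable borel" unfolding F_def by simp
    have "(\<lambda>t. \<integral>\<^sup>+x. g (x(i := t)) \<partial>?P) \<in> borel_measurable lborel"
      using slice[of "\<lambda>x. ennreal (g x)" borel] by (intro PI.borel_measurable_nn_integral) auto
    then show "G \<in> borel_measurable borel" unfolding G_def by simp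
    have "(\<lambda>t. \<integral>\<^sup>+x. h (x(i := t)) \<partial>?P) \<in> borel_measurable lborel"
      using slice[of h borel] insert.prems(7) by (intro PI.borel_measurable_nn_integral) auto
    then show "H \<in> borel_measurable borel" unfolding H_def by simp
    show "0 \<le> F t" "0 \<le> G t" for t by (auto simp: F_def G_def)
    show "F t \<le> D" "G t \<le> D" for t
      using bdf[of t] bdg[of t] D unfolding F[symmetric] G[symmetric] by auto
    show "F t = 0" if "\<bar>t\<bar> > R" for t
    proof -
      have "f (x(i := t)) = 0" for x by (rule insert.prems(10)[of i]) (use that in auto)
      then show ?thesis by (simp add: F_def)
    qed
    show "G t = 0" if "\<bar>t\<bar> > R" for t
    proof -
      have "g (x(i := t)) = 0" for x by (rule insert.prems(13)[of i]) (use that in auto)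
      then show ?thesis by (simp add: G_def)
    qed
    show "ennreal (F s powr (1 - l) * G t powr l) \<le> H ((1 - l) * s + l * t)" for s t
      unfolding F_def G_def H_def
    proof (rule insert.IH)
      show "(\<lambda>x. f (x(i := s))) \<in> borel_measurable ?P" "(\<lambda>x. g (x(i := t))) \<in> borel_measurable ?P"
        "(\<lambda>x. h (x(i := (1 - l) * s + l * t))) \<in> borel_measurable ?P"
        using insert.prems(5-7) by (auto intro!: slice1)
      fix x y :: "'i \<Rightarrow> real" assume xy: "x \<in> extensional I" "y \<in> extensional I"
      have "(\<lambda>j\<in>insert i I. (1 - l) * (x(i := s)) j + l * (y(i := t)) j)
          = (\<lambda>j\<in>I. (1 - l) * x j + l * y j)(i := (1 - l) * s + l * t)"
        using insert.hyps by (auto simp: fun_eq_iff restrict_def)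
      moreover have "x(i := s) \<in> extensional (insert i I)" "y(i := t) \<in> extensional (insert i I)"
        using xy by (auto simp: extensional_def)
      ultimately show "ennreal (f (x(i := s)) powr (1 - l) * g (y(i := t)) powr l)
         \<le> h ((\<lambda>j\<in>I. (1 - l) * x j + l * y j)(i := (1 - l) * s + l * t))"
        using insert.prems(14)[of "x(i := s)" "y(i := t)"] by metis
    next
      show "f (x(i := s)) = 0" if "j \<in> I" "R < \<bar>x j\<bar>" for x j
        by (rule insert.prems(10)[of j]) (use insert.hyps that in auto)
      show "g (x(i := t)) = 0" if "j \<in> I" "R < \<bar>x j\<bar>" for x j
        by (rule insert.prems(13)[of j]) (use insert.hyps that in auto)
    qed (use insert.prems in auto)
  qed (use insert.prems in auto)
  then show ?case
    unfolding F G H_def by (subst (1 2 3) split) (use insert.prems in auto)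
qed

lemma prekopa_leindler_euclidean:
  fixes f g :: "'a::euclidean_space \<Rightarrow> real" and h :: "'a \<Rightarrow> ennreal"
  assumes l: "0 < l" "l < 1"
    and [measurable]: "f \<in> borel_measurable borel" "g \<in> borel_measurable borel" "h \<in> borel_measurable borel"
    and f: "\<And>x. 0 \<le> f x" "\<And>x. f x \<le> C" "\<And>x. norm x > R \<Longrightarrow> f x = 0"
    and g: "\<And>x. 0 \<le> g x" "\<And>x. g x \<le> C" "\<And>x. norm x > R \<Longrightarrow> g x = 0"
    and h: "\<And>x y. ennreal (f x powr (1 - l) * g y powr l) \<le> h ((1 - l) *\<^sub>R x + l *\<^sub>R y)"
  shows "ennreal (enn2real (\<integral>\<^sup>+x. f x \<partial>lborel) powr (1 - l) * enn2real (\<integral>\<^sup>+x. g x \<partial>lborel) powr l)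
          \<le> (\<integral>\<^sup>+x. h x \<partial>lborel)"
proof -
  let ?T = "\<lambda>v :: 'a \<Rightarrow> real. \<Sum>b\<in>Basis. v b *\<^sub>R b"
  have eq: "(\<integral>\<^sup>+x. u x \<partial>lborel) = (\<integral>\<^sup>+v. u (?T v) \<partial>Pi\<^sub>M Basis (\<lambda>_. lborel))"
    if [measurable]: "u \<in> borel_measurable borel" for u :: "'a \<Rightarrow> ennreal"
    by (subst lborel_eq) (simp add: nn_integral_distr)
  have C: "C \<ge> 0" using f(1)[of 0] f(2)[of 0] by linarith
  have big: "norm (?T v) > R" if "b \<in> Basis" "\<bar>v b\<bar> > max R 0" for v b
    using Basis_le_norm[OF that(1), of "?T v"] that by (simp add: inner_sum_left_Basis)
  have "ennreal (enn2real (\<integral>\<^sup>+v. f (?T v) \<partial>Pi\<^sub>M Basis (\<lambda>_. lborel)) powr (1 - l)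
        * enn2real (\<integral>\<^sup>+v. g (?T v) \<partial>Pi\<^sub>M Basis (\<lambda>_. lborel)) powr l)
      \<le> (\<integral>\<^sup>+v. h (?T v) \<partial>Pi\<^sub>M Basis (\<lambda>_. lborel))"
  proof (rule prekopa_leindler_PiM[where C=C and R="max R 0"])
    fix v w :: "'a \<Rightarrow> real"
    have "?T (\<lambda>i\<in>Basis. (1 - l) * v i + l * w i) = (1 - l) *\<^sub>R ?T v + l *\<^sub>R ?T w"
      by (simp add: scaleR_right.sum sum.distrib[symmetric] scaleR_add_left)
    then show "ennreal (f (?T v) powr (1 - l) * g (?T w) powr l) \<le> h (?T (\<lambda>i\<in>Basis. (1 - l) * v i + l * w i))"
      using h by simp
  qed (use l C f g big in auto)
  then show ?thesis by (subst (1 2 3) eq) auto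
qed

section \<open>Integrals of homogeneous functions\<close>

lemma ennreal_mult3: "0 \<le> a \<Longrightarrow> 0 \<le> b \<Longrightarrow> ennreal a * (ennreal b * ennreal c) = ennreal (a * (b * c))"
  by (simp add: ennreal_mult')

lemma nn_integral_lborel_scaleR:
  fixes f :: "'a::euclidean_space \<Rightarrow> ennreal"
  assumes [measurable]: "f \<in> borel_measurable borel" and c: "c > 0"
  shows "(\<integral>\<^sup>+x. f x \<partial>lborel) = ennreal (c ^ DIM('a)) * (\<integral>\<^sup>+x. f (c *\<^sub>R x) \<partial>lborel)"
proof -
  have "(\<integral>\<^sup>+x. f x \<partial>lborel) = (\<integral>\<^sup>+x. f x \<partial>density (distr lborel borel (\<lambda>x. 0 + c *\<^sub>R x)) (\<lambda>_. ennreal (\<bar>c\<bar> ^ DIM('a))))"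
    using c by (subst lborel_affine[of c 0]) auto
  also have "\<dots> = ennreal (c ^ DIM('a)) * (\<integral>\<^sup>+x. f (c *\<^sub>R x) \<partial>lborel)"
    using c by (simp add: nn_integral_density nn_integral_distr nn_integral_cmult)
  finally show ?thesis .
qed

lemma sdil_eq_vimage: "c \<noteq> 0 \<Longrightarrow> sdil c A = (\<lambda>x. (1 / c) *\<^sub>R x) -` A"
  by (auto simp: sdil_def image_iff intro!: bexI[where x="(1 / c) *\<^sub>R _"])

lemma mem_sdil_iff: "c \<noteq> 0 \<Longrightarrow> c *\<^sub>R x \<in> sdil c A \<longleftrightarrow> x \<in> A"
  by (simp add: sdil_eq_vimage)

lemma sets_sdil [measurable]:
  fixes A :: "'a::euclidean_space set"
  assumes "A \<in> sets borel" "c \<noteq> 0"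
  shows "sdil c A \<in> sets borel"
  using assms by (simp add: sdil_eq_vimage) (rule measurable_sets_borel[where M=borel], auto)

lemma nn_integral_sdil_homogeneous:
  fixes f :: "'a::euclidean_space \<Rightarrow> ennreal" and a :: real
  assumes [measurable]: "f \<in> borel_measurable borel" "A \<in> sets borel" and c: "c > 0"
    and hom: "\<And>x. f (c *\<^sub>R x) = ennreal (c powr a) * f x"
  shows "(\<integral>\<^sup>+x. f x * indicator (sdil c A) x \<partial>lborel)
       = ennreal (c powr (DIM('a) + a)) * (\<integral>\<^sup>+x. f x * indicator A x \<partial>lborel)"
proof -
  have [measurable]: "sdil c A \<in> sets borel" using c by (intro sets_sdil) auto
  have "(\<integral>\<^sup>+x. f x * indicator (sdil c A) x \<partial>lborel)
      = ennreal (c ^ DIM('a)) * (\<integral>\<^sup>+x. f (c *\<^sub>R x) * indicator (sdil c A) (c *\<^sub>R x) \<partial>lborel)"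
    using c by (intro nn_integral_lborel_scaleR) auto
  also have "(\<integral>\<^sup>+x. f (c *\<^sub>R x) * indicator (sdil c A) (c *\<^sub>R x) \<partial>lborel)
      = (\<integral>\<^sup>+x. ennreal (c powr a) * (f x * indicator A x) \<partial>lborel)"
    using c by (intro nn_integral_cong) (simp add: hom indicator_def mem_sdil_iff)
  also have "\<dots> = ennreal (c powr a) * (\<integral>\<^sup>+x. f x * indicator A x \<partial>lborel)"
    by (simp add: nn_integral_cmult)
  finally show ?thesis
    using c by (simp add: powr_add powr_realpow ennreal_mult' mult.assoc)
qed

text \<open>Layer-cake substitute for polar coordinates: the dilates of \<open>A\<close> are the sublevel sets of \<open>\<psi>\<close>.\<close>

lemma nn_integral_homogeneous_layers:
  fixes f :: "'a::euclidean_space \<Rightarrow> ennreal" and a :: real and \<psi> :: "'a \<Rightarrow> real" and w :: "real \<Rightarrow> ennreal"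
  assumes [measurable]: "f \<in> borel_measurable borel" "A \<in> sets borel" "\<psi> \<in> borel_measurable borel" "w \<in> borel_measurable borel"
    and hom: "\<And>c x. c > 0 \<Longrightarrow> f (c *\<^sub>R x) = ennreal (c powr a) * f x"
    and lev: "\<And>t. 0 < t \<Longrightarrow> t \<le> 1 \<Longrightarrow> sdil t A = {x. \<psi> x \<le> t}"
  shows "(\<integral>\<^sup>+x. f x * (\<integral>\<^sup>+t. w t * indicator {t. 0 < t \<and> t \<le> 1 \<and> \<psi> x \<le> t} t \<partial>lborel) \<partial>lborel)
       = (\<integral>\<^sup>+x. f x * indicator A x \<partial>lborel) * (\<integral>\<^sup>+t. w t * ennreal (t powr (DIM('a) + a)) * indicator {0<..1} t \<partial>lborel)"
proof -
  have "(\<integral>\<^sup>+x. f x * (\<integral>\<^sup>+t. w t * indicator {t. 0 < t \<and> t \<le> 1 \<and> \<psi> x \<le> t} t \<partial>lborel) \<partial>lborel)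
    = (\<integral>\<^sup>+x. (\<integral>\<^sup>+t. f x * (w t * (if 0 < t \<and> t \<le> 1 \<and> \<psi> x \<le> t then 1 else 0)) \<partial>lborel) \<partial>lborel)"
    by (simp add: nn_integral_cmult[symmetric] indicator_def of_bool_def)
  also have "\<dots> = (\<integral>\<^sup>+t. (\<integral>\<^sup>+x. f x * (w t * (if 0 < t \<and> t \<le> 1 \<and> \<psi> x \<le> t then 1 else 0)) \<partial>lborel) \<partial>lborel)"
    by (rule lborel_pair.Fubini') measurable
  also have "\<dots> = (\<integral>\<^sup>+t. (\<integral>\<^sup>+x. f x * indicator A x \<partial>lborel) * (w t * ennreal (t powr (DIM('a) + a)) * indicator {0<..1} t) \<partial>lborel)"
  proof (rule nn_integral_cong)
    fix t :: real
    show "(\<integral>\<^sup>+x. f x * (w t * (if 0 < t \<and> t \<le> 1 \<and> \<psi> x \<le> t then 1 else 0)) \<partial>lborel)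
       = (\<integral>\<^sup>+x. f x * indicator A x \<partial>lborel) * (w t * ennreal (t powr (DIM('a) + a)) * indicator {0<..1} t)"
    proof (cases "0 < t \<and> t \<le> 1")
      case True
      then have [measurable]: "sdil t A \<in> sets borel" by (intro sets_sdil) auto
      have "(\<integral>\<^sup>+x. f x * (w t * (if 0 < t \<and> t \<le> 1 \<and> \<psi> x \<le> t then 1 else 0)) \<partial>lborel)
         = (\<integral>\<^sup>+x. (f x * indicator (sdil t A) x) * w t \<partial>lborel)"
        using True lev by (intro nn_integral_cong) (auto simp: indicator_def)
      also have "\<dots> = (\<integral>\<^sup>+x. f x * indicator (sdil t A) x \<partial>lborel) * w t"
        by (rule nn_integral_multc) measurable
      also have "\<dots> = ennreal (t powr (DIM('a) + a)) * (\<integral>\<^sup>+x. f x * indicator A x \<partial>lborel) * w t"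
        using True by (subst nn_integral_sdil_homogeneous[where a=a]) (auto simp: hom)
      finally show ?thesis using True by (simp add: ac_simps)
    qed auto
  qed
  also have "\<dots> = (\<integral>\<^sup>+x. f x * indicator A x \<partial>lborel) * (\<integral>\<^sup>+t. w t * ennreal (t powr (DIM('a) + a)) * indicator {0<..1} t \<partial>lborel)"
    by (rule nn_integral_cmult) measurable
  finally show ?thesis .
qed

lemma nn_integral_powr_unit_interval:
  fixes s :: real
  assumes "s > -1"
  shows "(\<integral>\<^sup>+t. ennreal (t powr s) * indicator {0<..1} t \<partial>lborel) = ennreal (1 / (s + 1))"
proof -
  have "((\<lambda>x. x powr s) has_integral (1 powr (s + 1) / (s + 1))) {0..1}"
    using assms by (intro has_integral_powr_from_0) auto
  then have base: "((\<lambda>x. x powr s) has_integral (1 / (s + 1))) {0..1}" by simp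
  have hi: "((\<lambda>x. x powr s * indicator {0<..1} x) has_integral (1 / (s + 1))) UNIV"
  proof (rule has_integral_spike_eq[where S="{0}", THEN iffD1, rotated 2])
    show "((\<lambda>x. if x \<in> {0..1} then x powr s else 0) has_integral (1 / (s + 1))) UNIV"
      using base by (simp only: has_integral_restrict_UNIV)
  qed (auto simp: indicator_def)
  have "(\<integral>\<^sup>+t. ennreal (t powr s * indicator {0<..1} t) \<partial>lborel) = ennreal (1 / (s + 1))"
    using hi assms by (intro nn_integral_has_integral_lborel) auto
  then show ?thesis by (simp add: ennreal_mult'' ennreal_indicator)
qed

text \<open>The weight \<open>w = 1\<close> in the layer formula: the inner integral is the length
  of the interval from \<open>\<psi> x\<close> to 1, cut off at zero by \<open>ennreal\<close>, and
  the prefactor inverts the integral of \<open>t powr (DIM('a) + a)\<close> over the unit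
  interval.\<close>

lemma nn_integral_homogeneous_gauge:
  fixes f :: "'a::euclidean_space \<Rightarrow> ennreal" and a :: real and \<psi> :: "'a \<Rightarrow> real"
  assumes [measurable]: "f \<in> borel_measurable borel" "A \<in> sets borel" "\<psi> \<in> borel_measurable borel"
    and hom: "\<And>c x. c > 0 \<Longrightarrow> f (c *\<^sub>R x) = ennreal (c powr a) * f x"
    and lev: "\<And>t. 0 < t \<Longrightarrow> t \<le> 1 \<Longrightarrow> sdil t A = {x. \<psi> x \<le> t}"
    and \<psi>: "\<And>x. 0 \<le> \<psi> x" and a: "DIM('a) + a > 0"
  shows "(\<integral>\<^sup>+x. f x * indicator A x \<partial>lborel)
       = ennreal (DIM('a) + a + 1) * (\<integral>\<^sup>+x. f x * ennreal (1 - \<psi> x) \<partial>lborel)"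
proof -
  have in1: "(\<integral>\<^sup>+t. 1 * indicator {t. 0 < t \<and> t \<le> 1 \<and> \<psi> x \<le> t} t \<partial>lborel) = ennreal (1 - \<psi> x)" for x
  proof -
    have "(\<integral>\<^sup>+t. 1 * indicator {t. 0 < t \<and> t \<le> 1 \<and> \<psi> x \<le> t} t \<partial>lborel) = (\<integral>\<^sup>+t. indicator {\<psi> x..1} t \<partial>lborel)"
      using \<psi>[of x] AE_lborel_singleton[of "0::real"] by (intro nn_integral_cong_AE) (auto simp: indicator_def elim!: eventually_mono)
    also have "\<dots> = ennreal (1 - \<psi> x)"
      by (simp add: emeasure_lborel_Icc_eq ennreal_neg)
    finally show ?thesis .
  qed
  have "(\<integral>\<^sup>+x. f x * ennreal (1 - \<psi> x) \<partial>lborel) =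
     (\<integral>\<^sup>+x. f x * indicator A x \<partial>lborel) * (\<integral>\<^sup>+t. 1 * ennreal (t powr (DIM('a) + a)) * indicator {0<..1} t \<partial>lborel)"
    using nn_integral_homogeneous_layers[of f A \<psi> "\<lambda>_. 1" a] hom lev unfolding in1 by simp
  also have "\<dots> = (\<integral>\<^sup>+x. f x * indicator A x \<partial>lborel) * ennreal (1 / (DIM('a) + a + 1))"
    using nn_integral_powr_unit_interval[of "DIM('a) + a"] a by (simp add: add_ac)
  finally have *: "(\<integral>\<^sup>+x. f x * ennreal (1 - \<psi> x) \<partial>lborel) = \<dots>" .
  have "ennreal (DIM('a) + a + 1) * ennreal (1 / (DIM('a) + a + 1)) = 1"
    using a by (subst ennreal_mult''[symmetric]) auto
  then show ?thesis unfolding * by (metis mult.commute mult.left_commute mult_1_right)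
qed

lemma sdil_cball: 
  fixes r :: real
  assumes "t > 0" shows "sdil t (cball (0::'a::euclidean_space) r) = cball 0 (t * r)"
  using assms by (auto simp: sdil_eq_vimage field_simps)

text \<open>The weight \<open>t powr (-2)\<close> integrates over the interval from
  \<open>norm x\<close> to 1 to \<open>1 / norm x - 1\<close>. Adding back the integral of
  \<open>f\<close> turns the radial factor 1/(d - 1) into d/(d - 1), where d is
  \<open>DIM('a) + a\<close>. Repeated use replaces explicit moment computations on the
  ball.\<close>

lemma nn_integral_homogeneous_over_norm:
  fixes f :: "'a::euclidean_space \<Rightarrow> ennreal" and a :: real
  assumes [measurable]: "f \<in> borel_measurable borel"
    and hom: "\<And>c x. c > 0 \<Longrightarrow> f (c *\<^sub>R x) = ennreal (c powr a) * f x" and a: "DIM('a) + a > 1"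
  shows "(\<integral>\<^sup>+x. f x * ennreal (1 / norm x) * indicator (cball 0 1) x \<partial>lborel)
       = ennreal ((DIM('a) + a) / (DIM('a) + a - 1)) * (\<integral>\<^sup>+x. f x * indicator (cball 0 1) x \<partial>lborel)"
proof -
  let ?B = "cball 0 1 :: 'a set"
  let ?d = "DIM('a) + a"
  have [measurable]: "?B \<in> sets borel" by simp
  have in1: "(\<integral>\<^sup>+t. ennreal (t powr (-2)) * indicator {t. 0 < t \<and> t \<le> 1 \<and> norm x \<le> t} t \<partial>lborel)
      = ennreal (1 / norm x - 1) * indicator ?B x" if x: "x \<noteq> 0" for x :: 'a
  proof (cases "norm x \<le> 1")
    case True
    have "(\<integral>\<^sup>+t. ennreal (t powr (-2)) * indicator {t. 0 < t \<and> t \<le> 1 \<and> norm x \<le> t} t \<partial>lborel)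
        = (\<integral>\<^sup>+t. ennreal (t powr (-2)) * indicator {norm x..1} t \<partial>lborel)"
      using x by (intro nn_integral_cong) (auto simp: indicator_def intro: less_le_trans[of 0 "norm x"])
    also have "\<dots> = ennreal ((- (1 powr (-1))) - (- (norm x powr (-1))))"
    proof (rule nn_integral_FTC_Icc)
      fix t assume "t \<in> {norm x..1}"
      then have "t > 0" using x by (metis atLeastAtMost_iff less_le_trans zero_less_norm_iff)
      then show "((\<lambda>t. - (t powr (-1))) has_real_derivative t powr (-2)) (at t)"
        using DERIV_minus[OF has_real_derivative_powr[of t "-1"]] by simp
    qed (use True in auto)
    also have "\<dots> = ennreal (1 / norm x - 1)" using x by (simp add: powr_minus_divide)
    finally show ?thesis using True by simp
  next
    case False
    then have "{t. 0 < t \<and> t \<le> 1 \<and> norm x \<le> t} = {}" by auto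
    then show ?thesis using False by (simp only:) simp
  qed
  have "(\<integral>\<^sup>+x. f x * (ennreal (1 / norm x - 1) * indicator ?B x) \<partial>lborel)
      = (\<integral>\<^sup>+x. f x * (\<integral>\<^sup>+t. ennreal (t powr (-2)) * indicator {t. 0 < t \<and> t \<le> 1 \<and> norm x \<le> t} t \<partial>lborel) \<partial>lborel)"
    using AE_lborel_singleton[of "0::'a"] by (intro nn_integral_cong_AE) (auto simp: in1 elim!: eventually_mono)
  also have "\<dots> = (\<integral>\<^sup>+x. f x * indicator ?B x \<partial>lborel)
      * (\<integral>\<^sup>+t. ennreal (t powr (-2)) * ennreal (t powr ?d) * indicator {0<..1} t \<partial>lborel)"
    by (rule nn_integral_homogeneous_layers) (use hom in \<open>auto simp: sdil_cball\<close>)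
  also have "(\<integral>\<^sup>+t. ennreal (t powr (-2)) * ennreal (t powr ?d) * indicator {0<..1} t \<partial>lborel)
      = (\<integral>\<^sup>+t. ennreal (t powr (?d - 2)) * indicator {0<..1} t \<partial>lborel)"
    by (intro nn_integral_cong) (auto simp: indicator_def powr_add[symmetric] simp flip: ennreal_mult'')
  also have "\<dots> = ennreal (1 / (?d - 1))"
    using nn_integral_powr_unit_interval[of "?d - 2"] a by simp
  finally have 1: "(\<integral>\<^sup>+x. f x * (ennreal (1 / norm x - 1) * indicator ?B x) \<partial>lborel)
     = (\<integral>\<^sup>+x. f x * indicator ?B x \<partial>lborel) * ennreal (1 / (?d - 1))" .
  have "(\<integral>\<^sup>+x. f x * ennreal (1 / norm x) * indicator ?B x \<partial>lborel)
      = (\<integral>\<^sup>+x. f x * (ennreal (1 / norm x - 1) * indicator ?B x) + f x * indicator ?B x \<partial>lborel)"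
  proof (intro nn_integral_cong_AE, use AE_lborel_singleton[of "0::'a"] in eventually_elim)
    case (elim x)
    have "norm x \<le> 1 \<Longrightarrow> ennreal (1 / norm x) = ennreal (1 / norm x - 1) + 1"
      using elim by (subst ennreal_1[symmetric], subst ennreal_plus[symmetric]) (auto simp: field_simps)
    then show ?case by (auto simp: indicator_def distrib_left)
  qed
  also have "\<dots> = (\<integral>\<^sup>+x. f x * indicator ?B x \<partial>lborel) * ennreal (1 / (?d - 1)) + (\<integral>\<^sup>+x. f x * indicator ?B x \<partial>lborel)"
    by (subst nn_integral_add) (measurable, simp add: 1)
  also have "\<dots> = (\<integral>\<^sup>+x. f x * indicator ?B x \<partial>lborel) * (ennreal (1 / (?d - 1)) + ennreal 1)"
    by (simp add: distrib_left)
  also have "ennreal (1 / (?d - 1)) + ennreal 1 = ennreal (?d / (?d - 1))"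
    using a by (subst ennreal_plus[symmetric]) (auto simp: field_simps)
  finally show ?thesis by (simp add: mult.commute)
qed

section \<open>Brunn--Minkowski for measures with a homogeneous concave density\<close>

lemma compact_msum: "compact A \<Longrightarrow> compact B \<Longrightarrow> compact (msum A (B :: 'a::real_normed_vector set))"
  unfolding msum_def by (rule compact_sums)

lemma compact_sdil: "compact A \<Longrightarrow> compact (sdil c (A :: 'a::real_normed_vector set))"
  unfolding sdil_def by (rule compact_scaling)

lemma sdil_sdil: "sdil a (sdil b A) = sdil (a * b) A"
  by (auto simp: sdil_def image_image)

lemma sdil_msum: "sdil c (msum A B) = msum (sdil c A) (sdil c B)"
  unfolding sdil_def msum_def by (force simp: scaleR_add_right image_iff)

text \<open>Young's inequality for \<open>(1 + x) powr s\<close> and 1 with the weights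
  \<open>1 / s\<close> and \<open>1 - 1 / s\<close>.\<close>

lemma bernoulli_powr:
  fixes x s :: real
  assumes "x \<ge> 0" "s \<ge> 1"
  shows "1 + s * x \<le> (1 + x) powr s"
proof -
  have "((1 + x) powr s) powr (1 / s) * 1 powr (1 - 1 / s) \<le> 1 / s * (1 + x) powr s + (1 - 1 / s) * 1"
    using assms by (intro Youngs_inequality_0) auto
  then have "s * (1 + x) \<le> s * (1 / s * (1 + x) powr s + (1 - 1 / s))"
    using assms by (intro mult_left_mono) (auto simp: powr_powr)
  then show ?thesis using assms by (simp add: algebra_simps)
qed

locale homogeneous_density =
  fixes g :: "'a::euclidean_space \<Rightarrow> real" and p :: real
  assumes p: "p > 0" and cont: "continuous_on UNIV g" and conc: "p_concave p g" and hom: "homogeneous (1 / p) g"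
begin

definition d :: real where "d = real DIM('a) + 1 / p"

lemma d_gt_1: "d > 1"
proof -
  have "real DIM('a) \<ge> 1" using DIM_positive[where 'a='a] by linarith
  moreover have "1 / p > 0" using p by simp
  ultimately show ?thesis unfolding d_def by linarith
qed

lemma g_nonneg: "0 \<le> g x"
  using conc by (simp add: p_concave_def)

lemma g_measurable [measurable]: "g \<in> borel_measurable borel"
  using cont by (rule borel_measurable_continuous_onI)

lemma g_scaleR: "c > 0 \<Longrightarrow> g (c *\<^sub>R x) = c powr (1 / p) * g x"
  using hom by (simp add: homogeneous_def)

lemma ennreal_g_scaleR: "c > 0 \<Longrightarrow> ennreal (g (c *\<^sub>R x)) = ennreal (c powr (1 / p)) * ennreal (g x)"
  by (simp add: g_scaleR ennreal_mult' g_nonneg)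

lemma g_zero: "g 0 = 0"
  using g_scaleR[of 2 0] p by simp

section \<open>Finiteness, monotonicity and scaling of the measure with density
  \<open>g\<close>\<close>

lemma g_bounded_on_bounded:
  assumes "bounded A" obtains C where "C \<ge> 0" "\<And>x. x \<in> A \<Longrightarrow> g x \<le> C"
proof -
  have "compact (closure A)" using assms by (simp add: compact_closure)
  then have "bounded (g ` closure A)"
    by (intro compact_imp_bounded compact_continuous_image continuous_on_subset[OF cont]) auto
  then obtain C where "\<And>x. x \<in> closure A \<Longrightarrow> norm (g x) \<le> C" by (auto simp: bounded_iff)
  then show ?thesis using closure_subset[of A] by (intro that[of "max C 0"]) (force simp: le_max_iff_disj)+
qed

lemma mu_finite:
  assumes [measurable]: "A \<in> sets borel" and "bounded A"
  shows "(\<integral>\<^sup>+x. ennreal (g x) * indicator A x \<partial>lborel) < \<infinity>"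
proof -
  obtain C where C: "C \<ge> 0" "\<And>x. x \<in> A \<Longrightarrow> g x \<le> C" using g_bounded_on_bounded[OF assms(2)] by auto
  have "(\<integral>\<^sup>+x. ennreal (g x) * indicator A x \<partial>lborel) \<le> (\<integral>\<^sup>+x. ennreal C * indicator A x \<partial>lborel)"
    using C by (intro nn_integral_mono) (auto simp: indicator_def ennreal_leI)
  also have "\<dots> < \<infinity>"
    using emeasure_bounded_finite[OF assms(2)] by (simp add: nn_integral_cmult ennreal_mult_less_top)
  finally show ?thesis .
qed

lemma mu_conv_nn_integral: "A \<in> sets borel \<Longrightarrow> mu g A = enn2real (\<integral>\<^sup>+x. ennreal (g x) * indicator A x \<partial>lborel)"
  unfolding mu_def measure_def by (subst emeasure_density) auto

lemma ennreal_mu: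
  assumes "A \<in> sets borel" "bounded A"
  shows "ennreal (mu g A) = (\<integral>\<^sup>+x. ennreal (g x) * indicator A x \<partial>lborel)"
  using mu_finite[OF assms] assms by (simp add: mu_conv_nn_integral)

lemma mu_nonneg: "0 \<le> mu g A"
  by (simp add: mu_def)

lemma mu_mono:
  assumes "A \<in> sets borel" "B \<in> sets borel" "bounded B" "A \<subseteq> B"
  shows "mu g A \<le> mu g B"
proof -
  have "ennreal (mu g A) \<le> ennreal (mu g B)"
    unfolding ennreal_mu[OF assms(2,3)] ennreal_mu[OF assms(1) bounded_subset[OF assms(3,4)]]
    using assms by (intro nn_integral_mono) (auto simp: indicator_def)
  then show ?thesis by (simp add: mu_nonneg)
qed

lemma mu_sdil:
  assumes "A \<in> sets borel" "bounded A" "c > 0"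
  shows "mu g (sdil c A) = c powr d * mu g A"
proof -
  have "sdil c A \<in> sets borel" using assms by (intro sets_sdil) auto
  then have "mu g (sdil c A) = enn2real (\<integral>\<^sup>+x. ennreal (g x) * indicator (sdil c A) x \<partial>lborel)"
    by (rule mu_conv_nn_integral)
  also have "\<dots> = enn2real (ennreal (c powr d) * (\<integral>\<^sup>+x. ennreal (g x) * indicator A x \<partial>lborel))"
    unfolding d_def using assms by (subst nn_integral_sdil_homogeneous[where a="1/p"]) (auto simp: ennreal_g_scaleR)
  also have "\<dots> = c powr d * mu g A"
    using assms by (simp add: mu_conv_nn_integral enn2real_mult)
  finally show ?thesis .
qed

lemma p_concave_ineq:
  "0 < g x \<Longrightarrow> 0 < g y \<Longrightarrow> 0 \<le> l \<Longrightarrow> l \<le> 1 \<Longrightarrow>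
    (l * g x powr p + (1 - l) * g y powr p) powr (1 / p) \<le> g (l *\<^sub>R x + (1 - l) *\<^sub>R y)"
  using conc by (simp add: p_concave_def)

text \<open>The p-mean dominates the geometric mean. The power lost by this weakening is recovered
  from homogeneity in \<open>mu_brunn_minkowski\<close>.\<close>

lemma g_log_concave:
  assumes "0 < l" "l < 1"
  shows "g x powr (1 - l) * g y powr l \<le> g ((1 - l) *\<^sub>R x + l *\<^sub>R y)"
proof (cases "g x = 0 \<or> g y = 0")
  case True then show ?thesis using g_nonneg by auto
next
  case False
  then have pos: "g x > 0" "g y > 0" using g_nonneg by (simp_all add: less_le)
  have "g x powr (1 - l) * g y powr l = ((g x powr p) powr (1 - l) * (g y powr p) powr l) powr (1 / p)"
    using p pos by (simp add: powr_mult powr_powr)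
  also have "\<dots> \<le> ((1 - l) * g x powr p + l * g y powr p) powr (1 / p)"
    using p pos assms by (intro powr_mono2 Youngs_inequality_0) auto
  also have "\<dots> \<le> g ((1 - l) *\<^sub>R x + l *\<^sub>R y)"
    using pos assms p_concave_ineq[of x y "1 - l"] by simp
  finally show ?thesis .
qed

lemma mu_log_concave:
  assumes A: "compact A" and B: "compact B" and l: "0 < l" "l < 1"
  shows "mu g A powr (1 - l) * mu g B powr l \<le> mu g (msum (sdil (1 - l) A) (sdil l B))"
proof -
  let ?C = "msum (sdil (1 - l) A) (sdil l B)"
  have C: "compact ?C" using A B by (intro compact_msum compact_sdil)
  note bo[measurable] = borel_compact[OF A] borel_compact[OF B] borel_compact[OF C]
  have "bounded (A \<union> B)" using A B by (simp add: compact_imp_bounded)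
  then obtain k where k: "k \<ge> 0" "\<And>x. x \<in> A \<union> B \<Longrightarrow> g x \<le> k" using g_bounded_on_bounded by metis
  obtain R where R: "\<And>x. x \<in> A \<union> B \<Longrightarrow> norm x \<le> R" using \<open>bounded (A \<union> B)\<close> by (auto simp: bounded_iff)
  have "ennreal (enn2real (\<integral>\<^sup>+x. ennreal (g x * indicator A x) \<partial>lborel) powr (1 - l)
        * enn2real (\<integral>\<^sup>+x. ennreal (g x * indicator B x) \<partial>lborel) powr l)
      \<le> (\<integral>\<^sup>+x. ennreal (g x) * indicator ?C x \<partial>lborel)"
  proof (rule prekopa_leindler_euclidean[where C=k and R=R])
    fix x y
    show "ennreal ((g x * indicator A x) powr (1 - l) * (g y * indicator B y) powr l)
      \<le> ennreal (g ((1 - l) *\<^sub>R x + l *\<^sub>R y)) * indicator ?C ((1 - l) *\<^sub>R x + l *\<^sub>R y)"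
    proof (cases "x \<in> A \<and> y \<in> B")
      case True
      then have "(1 - l) *\<^sub>R x + l *\<^sub>R y \<in> ?C" by (auto simp: msum_def sdil_def)
      then show ?thesis using True g_log_concave[OF l, of x y] by (simp add: ennreal_leI)
    qed auto
    show "g x * indicator A x \<le> k" "g x * indicator B x \<le> k" using k by (auto simp: indicator_def)
    show "norm x > R \<Longrightarrow> g x * indicator A x = 0" "norm x > R \<Longrightarrow> g x * indicator B x = 0"
      using R[of x] by (auto simp: indicator_def)
  qed (use l g_nonneg in auto)
  then have "ennreal (mu g A powr (1 - l) * mu g B powr l) \<le> ennreal (mu g ?C)"
    using bo A B C
    by (simp add: mu_conv_nn_integral[of A] mu_conv_nn_integral[of B] ennreal_mu[of ?C] compact_imp_bounded
      ennreal_mult'' ennreal_indicator)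
  then show ?thesis by (simp add: mu_nonneg)
qed

text \<open>After scaling \<open>A\<close> and \<open>B\<close> to measure one, log-concavity gives
  measure at least one to every convex combination of them. The weight
  \<open>l = b / (a + b)\<close> is the one for which the combination is a dilate of
  \<open>msum A B\<close>.\<close>

lemma mu_brunn_minkowski:
  assumes A: "compact A" "mu g A > 0" and B: "compact B" "mu g B > 0"
  shows "(mu g A powr (1 / d) + mu g B powr (1 / d)) powr d \<le> mu g (msum A B)"
proof -
  define a b where "a = mu g A powr (1 / d)" and "b = mu g B powr (1 / d)"
  have ab: "a > 0" "b > 0" using A B by (auto simp: a_def b_def)
  have norm1: "mu g (sdil (1 / a) A) = 1" "mu g (sdil (1 / b) B) = 1"
    using A B ab d_gt_1 by (auto simp: mu_sdil borel_compact compact_imp_bounded powr_divide a_def b_def powr_powr)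
  define l where "l = b / (a + b)"
  have l: "0 < l" "l < 1" "1 - l = a / (a + b)" using ab by (auto simp: l_def field_simps)
  have eq: "msum (sdil (1 - l) (sdil (1 / a) A)) (sdil l (sdil (1 / b) B)) = sdil (1 / (a + b)) (msum A B)"
    using ab unfolding sdil_sdil sdil_msum l(3) by (simp add: l_def)
  have "1 \<le> mu g (sdil (1 / (a + b)) (msum A B))"
    using mu_log_concave[OF compact_sdil[OF A(1), of "1/a"] compact_sdil[OF B(1), of "1/b"] l(1,2)] norm1 unfolding eq by simp
  also have "\<dots> = (1 / (a + b)) powr d * mu g (msum A B)"
    using A B ab by (intro mu_sdil) (auto simp: borel_compact compact_imp_bounded compact_msum)
  finally show ?thesis
    using ab unfolding a_def[symmetric] b_def[symmetric] by (simp add: powr_divide le_divide_eq)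
qed

text \<open>Minkowski's first inequality in terms of increments: Bernoulli's inequality supplies the
  linear lower bound for every positive \<open>\<eta>\<close>, so no derivative at zero is
  taken.\<close>

lemma mu_minkowski_first:
  assumes K: "compact K" "mu g K > 0" and B: "mu g (cball 0 1) > 0" and \<eta>: "\<eta> > 0"
  shows "\<eta> * d * (mu g K powr (1 - 1 / d) * mu g (cball 0 1) powr (1 / d)) \<le> mu g (msum K (sdil \<eta> (cball 0 1))) - mu g K"
proof -
  define a b where "a = mu g K powr (1 / d)" and "b = mu g (cball 0 1) powr (1 / d)"
  have ab: "a > 0" "b > 0" using K B by (auto simp: a_def b_def)
  have Bs: "mu g (sdil \<eta> (cball 0 1)) = \<eta> powr d * mu g (cball 0 1)" using \<eta> by (intro mu_sdil) auto
  have bs: "mu g (sdil \<eta> (cball 0 1)) powr (1 / d) = \<eta> * b"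
    unfolding Bs using \<eta> d_gt_1 B by (simp add: powr_mult powr_powr b_def)
  have "(a + \<eta> * b) powr d \<le> mu g (msum K (sdil \<eta> (cball 0 1)))"
    using mu_brunn_minkowski[OF K compact_sdil[OF compact_cball, of \<eta> 0 1]] Bs B \<eta> unfolding bs a_def by simp
  moreover have "a powr d + d * a powr (d - 1) * (\<eta> * b) \<le> (a + \<eta> * b) powr d"
  proof -
    have "1 + d * (\<eta> * b / a) \<le> (1 + \<eta> * b / a) powr d"
      using ab \<eta> d_gt_1 by (intro bernoulli_powr) auto
    then have "a powr d * (1 + d * (\<eta> * b / a)) \<le> a powr d * (1 + \<eta> * b / a) powr d"
      by (intro mult_left_mono) auto
    also have "\<dots> = (a + \<eta> * b) powr d"
    proof -
      have "a * (1 + \<eta> * b / a) = a + \<eta> * b" using ab by (simp add: distrib_left)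
      then show ?thesis using ab \<eta> by (metis powr_mult)
    qed
    finally show ?thesis using ab by (simp add: powr_diff field_simps)
  qed
  moreover have "a powr d = mu g K" using d_gt_1 K by (simp add: a_def powr_powr)
  moreover have "a powr (d - 1) = mu g K powr (1 - 1 / d)"
    using d_gt_1 by (simp add: a_def powr_powr diff_divide_distrib)
  ultimately show ?thesis by (simp add: b_def algebra_simps)
qed

end

section \<open>Hyperplane coordinates and spherical averages\<close>

lemma cball_measurable [measurable]: "cball c r \<in> sets (borel :: 'a::metric_space measure)"
  by (simp add: borel_closed)

lemma nn_integral_lborel_shift:
  fixes F :: "'a::euclidean_space \<Rightarrow> ennreal"
  assumes [measurable]: "F \<in> borel_measurable borel"
  shows "(\<integral>\<^sup>+x. F x \<partial>lborel) = (\<integral>\<^sup>+x. F (c + x) \<partial>lborel)"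
  by (subst lborel_distr_plus[of c, symmetric]) (simp add: nn_integral_distr)

lemma emeasure_unit_cball: "emeasure lborel (cball (0::'a::euclidean_space) 1) = ennreal (unit_ball_vol (DIM('a)))"
  using emeasure_cball[of 1 "0::'a"] by simp

text \<open>Uniqueness of Haar measure: shifting twice in \<open>\<integral>\<integral> 1\<^sub>A(T x) 1\<^sub>E(y)\<close>, with \<open>E\<close> the unit ball, exchanges
  the roles of the image measure and of \<open>lborel\<close>.\<close>

lemma distr_lborel_linear_isometry:
  fixes T :: "'a::euclidean_space \<Rightarrow> 'b::euclidean_space"
  assumes lin: "linear T" and iso: "\<And>x. norm (T x) = norm x" and surj: "surj T" and dim: "DIM('a) = DIM('b)"
  shows "distr lborel borel T = (lborel :: 'b measure)"
proof (rule measure_eqI)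
  have T[measurable]: "T \<in> borel_measurable borel"
    using lin by (intro borel_measurable_continuous_onI linear_continuous_on linear_conv_bounded_linear[THEN iffD1])
  have Tp[measurable]: "(\<lambda>z. T (fst z) + snd z) \<in> borel_measurable (lborel \<Otimes>\<^sub>M lborel)" by measurable
  let ?E = "cball 0 1 :: 'b set"
  have E[measurable]: "?E \<in> sets borel" by simp
  fix A assume "A \<in> sets (distr lborel borel T)"
  then have A[measurable]: "A \<in> sets borel" by simp
  have trans: "(\<integral>\<^sup>+x. indicator A (T x) \<partial>lborel) = (\<integral>\<^sup>+x. indicator A (T x + y) \<partial>lborel)" for y
  proof -
    obtain z where z: "y = T z" using surj by (metis surjD)
    show ?thesis
      using nn_integral_lborel_shift[of "\<lambda>x. indicator A (T x)" z] by (simp add: z linear_add[OF lin] add.commute)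
  qed
  have ball: "(\<integral>\<^sup>+x. indicator ?E (y - T x) \<partial>lborel) = ennreal (unit_ball_vol (DIM('b)))" for y
  proof -
    obtain z where z: "y = T z" using surj by (metis surjD)
    have "indicator ?E (y - T x) = (indicator (cball 0 1) (-z + x) :: ennreal)" for x
      using iso[of "z - x"] by (auto simp: z indicator_def linear_diff[OF lin] norm_minus_commute)
    then have "(\<integral>\<^sup>+x. indicator ?E (y - T x) \<partial>lborel) = (\<integral>\<^sup>+x. indicator (cball 0 1) (-z + x) \<partial>lborel)"
      by simp
    also have "\<dots> = (\<integral>\<^sup>+x. indicator (cball (0::'a) 1) x \<partial>lborel)"
      using nn_integral_lborel_shift[of "indicator (cball 0 1)" "-z"] by simp
    finally show ?thesis using emeasure_unit_cball[where 'a='a] dim by simp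
  qed
  have "emeasure (distr lborel borel T) A * ennreal (unit_ball_vol (DIM('b)))
     = (\<integral>\<^sup>+y. (\<integral>\<^sup>+x. indicator A (T x) \<partial>lborel) * indicator ?E y \<partial>lborel)"
  proof -
    have "emeasure (distr lborel borel T) A = (\<integral>\<^sup>+x. indicator A (T x) \<partial>lborel)"
      using nn_integral_distr[of T lborel borel "indicator A"] by simp
    then show ?thesis by (simp add: nn_integral_cmult emeasure_unit_cball)
  qed
  also have "\<dots> = (\<integral>\<^sup>+y. \<integral>\<^sup>+x. indicator A (T x + y) * indicator ?E y \<partial>lborel \<partial>lborel)"
  proof (intro nn_integral_cong)
    fix y
    show "(\<integral>\<^sup>+x. indicator A (T x) \<partial>lborel) * indicator ?E y = (\<integral>\<^sup>+x. indicator A (T x + y) * indicator ?E y \<partial>lborel)"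
      using trans[of y] by (simp add: nn_integral_multc)
  qed
  also have "\<dots> = (\<integral>\<^sup>+x. \<integral>\<^sup>+y. indicator A (T x + y) * indicator ?E y \<partial>lborel \<partial>lborel)"
    by (rule lborel_pair.Fubini') measurable
  also have "\<dots> = (\<integral>\<^sup>+x. \<integral>\<^sup>+y. indicator A y * indicator ?E (y - T x) \<partial>lborel \<partial>lborel)"
  proof (rule nn_integral_cong)
    fix x
    show "(\<integral>\<^sup>+y. indicator A (T x + y) * indicator ?E y \<partial>lborel) = (\<integral>\<^sup>+y. indicator A y * indicator ?E (y - T x) \<partial>lborel)"
      by (subst (2) nn_integral_lborel_shift[of _ "T x"]) auto
  qed
  also have "\<dots> = (\<integral>\<^sup>+y. \<integral>\<^sup>+x. indicator A y * indicator ?E (y - T x) \<partial>lborel \<partial>lborel)"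
    by (rule lborel_pair.Fubini'[symmetric]) measurable
  also have "\<dots> = emeasure lborel A * ennreal (unit_ball_vol (DIM('b)))"
    by (simp add: nn_integral_cmult nn_integral_multc ball)
  finally have eq: "emeasure (distr lborel borel T) A * ennreal (unit_ball_vol (DIM('b))) = emeasure lborel A * ennreal (unit_ball_vol (DIM('b)))" .
  show "emeasure (distr lborel borel T) A = emeasure lborel A"
  proof -
    have "unit_ball_vol (real DIM('b)) > 0" by simp
    then have "unit_ball_vol (real DIM('b)) \<noteq> 0" by linarith
    then show ?thesis using eq by (simp add: mult.commute[of _ "ennreal _"] ennreal_mult_cancel_left)
  qed
qed simp

text \<open>\<open>hyp_iso\<close> is an unspecified isometry; these properties are what is known of
  it, and the results on hyperplanes rest on them alone.\<close>

locale hyperplane_frame =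
  fixes u :: "'a::euclidean_space" and f :: "'m::euclidean_space \<Rightarrow> 'a"
  assumes unit: "norm u = 1" and lin: "linear f" and iso: "\<And>y. norm (f y) = norm y"
    and range_f: "range f = {x. x \<bullet> u = 0}" and dim: "DIM('m) + 1 = DIM('a)"
begin

lemma f_measurable [measurable]: "f \<in> borel_measurable borel"
  using lin by (intro borel_measurable_continuous_onI linear_continuous_on linear_conv_bounded_linear[THEN iffD1])

lemma uu: "u \<bullet> u = 1" using unit by (simp add: norm_eq_1)

lemma f_orth: "f y \<bullet> u = 0" "u \<bullet> f y = 0"
  using range_f by (auto simp: inner_commute)

lemma norm_split: "(norm (s *\<^sub>R u + f y))\<^sup>2 = s\<^sup>2 + (norm y)\<^sup>2"
proof -
  have "f y \<bullet> f y = (norm y)\<^sup>2" by (simp add: iso flip: power2_norm_eq_inner)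
  then show ?thesis
    by (simp add: power2_norm_eq_inner[of "s *\<^sub>R u + f y"] inner_add_left inner_add_right uu f_orth power2_eq_square[of s])
qed

lemma distr_split: "distr lborel borel (\<lambda>(s, y). s *\<^sub>R u + f y) = (lborel :: 'a measure)"
proof (rule distr_lborel_linear_isometry)
  show "linear (\<lambda>(s, y). s *\<^sub>R u + f y)"
    by (rule linearI) (auto simp: linear_add[OF lin] linear_scale[OF lin] algebra_simps)
  show "norm (case z of (s, y) \<Rightarrow> s *\<^sub>R u + f y) = norm z" for z
    by (cases z) (simp add: norm_Pair flip: norm_split)
  show "surj (\<lambda>(s, y). s *\<^sub>R u + f y)"
    unfolding surj_def
  proof
    fix x
    have "x - (x \<bullet> u) *\<^sub>R u \<in> range f" unfolding range_f by (simp add: inner_simps uu)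
    then obtain y where "x - (x \<bullet> u) *\<^sub>R u = f y" by auto
    then show "\<exists>z. x = (case z of (s, y) \<Rightarrow> s *\<^sub>R u + f y)"
      by (intro exI[of _ "(x \<bullet> u, y)"]) (simp add: algebra_simps)
  qed
  show "DIM(real \<times> 'm) = DIM('a)" using dim by simp
qed

lemma nn_integral_split:
  assumes [measurable]: "F \<in> borel_measurable borel"
  shows "(\<integral>\<^sup>+x. F x \<partial>lborel) = (\<integral>\<^sup>+s. \<integral>\<^sup>+y. F (s *\<^sub>R u + f y) \<partial>lborel \<partial>lborel)"
proof -
  have "(\<lambda>(s, y). s *\<^sub>R u + f y) \<in> borel_measurable (borel \<Otimes>\<^sub>M borel)" by measurable
  then have [measurable]: "(\<lambda>(s, y). s *\<^sub>R u + f y) \<in> borel_measurable borel" by (simp add: borel_prod)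
  have "(\<integral>\<^sup>+x. F x \<partial>lborel) = (\<integral>\<^sup>+z. F (case z of (s, y) \<Rightarrow> s *\<^sub>R u + f y) \<partial>(lborel \<Otimes>\<^sub>M lborel))"
    by (subst distr_split[symmetric], subst nn_integral_distr) (auto simp: lborel_prod)
  also have "\<dots> = (\<integral>\<^sup>+s. \<integral>\<^sup>+y. F (s *\<^sub>R u + f y) \<partial>lborel \<partial>lborel)"
    by (subst lborel.nn_integral_fst[symmetric]) auto
  finally show ?thesis .
qed

text \<open>In the coordinates \<open>(s, y)\<close> the slab inside the unit ball lies in a
  cylinder over the unit ball of the hyperplane.\<close>

lemma emeasure_slab_le:
  assumes "s > 0"
  shows "(\<integral>\<^sup>+x. indicator {x. \<bar>x \<bullet> u\<bar> < s} x * indicator (cball 0 1) x \<partial>lborel)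
     \<le> ennreal (2 * s * unit_ball_vol (DIM('m)))"
proof -
  have [measurable]: "cball (0::'a) 1 \<in> sets borel" "{x. \<bar>x \<bullet> u\<bar> < s} \<in> sets borel" by auto
  have "(\<integral>\<^sup>+x. indicator {x. \<bar>x \<bullet> u\<bar> < s} x * indicator (cball 0 1) x \<partial>lborel)
    = (\<integral>\<^sup>+t. \<integral>\<^sup>+y. indicator {x. \<bar>x \<bullet> u\<bar> < s} (t *\<^sub>R u + f y) * indicator (cball 0 1) (t *\<^sub>R u + f y) \<partial>lborel \<partial>lborel)"
    by (rule nn_integral_split) measurable
  also have "\<dots> \<le> (\<integral>\<^sup>+t. \<integral>\<^sup>+y. indicator {-s<..<s} t * indicator (cball 0 1) (y::'m) \<partial>lborel \<partial>lborel)"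
  proof (intro nn_integral_mono)
    fix t y
    have "norm y \<le> 1" if "norm (t *\<^sub>R u + f y) \<le> 1"
    proof -
      have "(norm y)\<^sup>2 \<le> t\<^sup>2 + (norm y)\<^sup>2" by simp
      also have "\<dots> \<le> 1\<^sup>2" using norm_split[of t y] power_mono[OF that, of 2] by simp
      finally have "(norm y)\<^sup>2 \<le> 1\<^sup>2" .
      then show ?thesis by (rule power2_le_imp_le) simp
    qed
    then show "indicator {x. \<bar>x \<bullet> u\<bar> < s} (t *\<^sub>R u + f y) * indicator (cball 0 1) (t *\<^sub>R u + f y)
        \<le> (indicator {-s<..<s} t * indicator (cball 0 1) y :: ennreal)"
      by (auto simp: indicator_def inner_simps uu f_orth abs_less_iff)
  qed
  also have "\<dots> = ennreal (2 * s) * ennreal (unit_ball_vol (DIM('m)))"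
  proof -
    have "(\<integral>\<^sup>+y. indicator {-s<..<s} t * indicator (cball 0 1) (y::'m) \<partial>lborel)
       = indicator {-s<..<s} t * ennreal (unit_ball_vol (DIM('m)))" for t :: real
      by (subst nn_integral_cmult) (auto simp: emeasure_unit_cball)
    then show ?thesis using assms by (simp add: nn_integral_multc)
  qed
  also have "\<dots> = ennreal (2 * s * unit_ball_vol (DIM('m)))"
    using assms by (simp add: ennreal_mult')
  finally show ?thesis .
qed

end

text \<open>On [-1, 1] the radial formula, applied to the function |t| of degree 1 in dimension one,
  reads 2 = 2 I; scaling gives the general interval.\<close>

lemma nn_integral_abs_interval:
  fixes a :: real assumes "a > 0"
  shows "(\<integral>\<^sup>+t. ennreal \<bar>t\<bar> * indicator (cball 0 a) t \<partial>lborel) = ennreal (a\<^sup>2)"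
proof -
  let ?I = "\<integral>\<^sup>+t. ennreal \<bar>t\<bar> * indicator (cball (0::real) 1) t \<partial>lborel"
  have h: "ennreal \<bar>c *\<^sub>R t\<bar> = ennreal (c powr 1) * ennreal \<bar>t\<bar>" if "c > 0" for c t :: real
    using that by (simp add: abs_mult ennreal_mult')
  have "(\<integral>\<^sup>+t. ennreal \<bar>t\<bar> * ennreal (1 / norm t) * indicator (cball (0::real) 1) t \<partial>lborel) = ennreal 2 * ?I"
    using nn_integral_homogeneous_over_norm[of "\<lambda>t::real. ennreal \<bar>t\<bar>" 1] h by simp
  moreover have "(\<integral>\<^sup>+t. ennreal \<bar>t\<bar> * ennreal (1 / norm t) * indicator (cball (0::real) 1) t \<partial>lborel)
      = (\<integral>\<^sup>+t. indicator (cball (0::real) 1) t \<partial>lborel)"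
    using AE_lborel_singleton[of "0::real"]
    by (intro nn_integral_cong_AE) (auto elim!: eventually_mono simp flip: ennreal_mult')
  moreover have "\<dots> = ennreal 2"
    by (simp add: cball_eq_atLeastAtMost)
  ultimately have "ennreal 2 * ?I = ennreal 2 * 1" by simp
  then have I: "?I = 1" by (subst (asm) ennreal_mult_cancel_left) auto
  have "cball 0 a = sdil a (cball (0::real) 1)" using assms by (simp add: sdil_cball)
  then have "(\<integral>\<^sup>+t. ennreal \<bar>t\<bar> * indicator (cball 0 a) t \<partial>lborel) = ennreal (a powr (real DIM(real) + 1)) * ?I"
    using assms h by (simp only:) (rule nn_integral_sdil_homogeneous, auto)
  then show ?thesis using I assms by (simp add: powr_numeral)
qed

text \<open>Two uses of the radial formula lead from the second moment of the ball through the first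
  one to its volume, so in dimension m the second moment is m/(m + 2) times the volume.\<close>

lemma nn_integral_ball_one_minus_norm_square:
  "(\<integral>\<^sup>+y. ennreal (1 - (norm y)\<^sup>2) * indicator (cball (0::'m::euclidean_space) 1) y \<partial>lborel)
     = ennreal (2 / (DIM('m) + 2) * unit_ball_vol (DIM('m)))"
proof -
  let ?B = "cball (0::'m) 1" and ?m = "real DIM('m)" and ?w = "unit_ball_vol (DIM('m))"
  have m: "?m \<ge> 1" using DIM_positive[where 'a='m] by linarith
  have [measurable]: "?B \<in> sets borel" by simp
  define I where "I = (\<integral>\<^sup>+y. ennreal ((norm y)\<^sup>2) * indicator ?B y \<partial>lborel)"
  define J where "J = (\<integral>\<^sup>+y. ennreal (1 - (norm y)\<^sup>2) * indicator ?B y \<partial>lborel)"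
  have w: "(\<integral>\<^sup>+y. indicator ?B y \<partial>lborel) = ennreal ?w" using emeasure_unit_cball[where 'a='m] by simp
  have "(\<integral>\<^sup>+y. ennreal ((norm y)\<^sup>2) * ennreal (1 / norm y) * indicator ?B y \<partial>lborel) = ennreal ((?m + 2) / (?m + 2 - 1)) * I"
    unfolding I_def using m
    by (intro nn_integral_homogeneous_over_norm) (auto simp: power_mult_distrib ennreal_mult' powr_numeral)
  moreover have "(\<integral>\<^sup>+y. ennreal ((norm y)\<^sup>2) * ennreal (1 / norm y) * indicator ?B y \<partial>lborel)
     = (\<integral>\<^sup>+y. ennreal (norm y) * indicator ?B y \<partial>lborel)"
    by (intro nn_integral_cong) (auto simp: power2_eq_square simp flip: ennreal_mult')
  moreover have "(\<integral>\<^sup>+y. ennreal (norm y) * ennreal (1 / norm y) * indicator ?B y \<partial>lborel)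
     = ennreal ((?m + 1) / (?m + 1 - 1)) * (\<integral>\<^sup>+y. ennreal (norm y) * indicator ?B y \<partial>lborel)"
    using m by (intro nn_integral_homogeneous_over_norm) (auto simp: ennreal_mult')
  moreover have "(\<integral>\<^sup>+y. ennreal (norm y) * ennreal (1 / norm y) * indicator ?B y \<partial>lborel) = (\<integral>\<^sup>+y. indicator ?B y \<partial>lborel)"
    using AE_lborel_singleton[of "0::'m"]
    by (intro nn_integral_cong_AE) (auto elim!: eventually_mono simp flip: ennreal_mult')
  ultimately have wI: "ennreal ?w = ennreal ((?m + 1) / ?m) * (ennreal ((?m + 2) / (?m + 1)) * I)"
    using w by (simp add: add.commute)
  have "I < top"
  proof (rule le_less_trans)
    show "I \<le> (\<integral>\<^sup>+y. indicator ?B y \<partial>lborel)" unfolding I_def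
      by (intro nn_integral_mono) (auto simp: indicator_def power_le_one)
  qed (simp add: w)
  then obtain i where i: "I = ennreal i" "i \<ge> 0" by (cases I) auto
  have "ennreal ?w = ennreal ((?m + 1) / ?m * ((?m + 2) / (?m + 1) * i))"
    unfolding wI i(1) using m by (intro ennreal_mult3) auto
  then have "?w = (?m + 1) / ?m * ((?m + 2) / (?m + 1) * i)"
    using i m by (subst (asm) ennreal_inj) auto
  also have "\<dots> = (?m + 2) / ?m * i" using m by simp
  finally have iw: "i = ?m / (?m + 2) * ?w" using m by simp
  have "J + I = (\<integral>\<^sup>+y. indicator ?B y \<partial>lborel)"
  proof -
    have "J + I = (\<integral>\<^sup>+y. ennreal (1 - (norm y)\<^sup>2) * indicator ?B y + ennreal ((norm y)\<^sup>2) * indicator ?B y \<partial>lborel)"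
      unfolding I_def J_def by (subst nn_integral_add) auto
    also have "\<dots> = (\<integral>\<^sup>+y. indicator ?B y \<partial>lborel)"
      by (intro nn_integral_cong) (auto simp: indicator_def power_le_one simp flip: ennreal_plus)
    finally show ?thesis .
  qed
  then have JI: "J + ennreal i = ennreal ?w" using w i by simp
  then have "J < top" by (metis ennreal_add_eq_top ennreal_less_top less_top)
  then obtain j where j: "J = ennreal j" "j \<ge> 0" by (cases J) auto
  have "j + i = ?w" using JI j i by (simp flip: ennreal_plus)
  then have "j = 2 / (?m + 2) * ?w" using iw m by (simp add: field_simps)
  then show ?thesis using j unfolding J_def by simp
qed

context hyperplane_frame
begin

text \<open>For fixed \<open>y\<close> the variable \<open>s\<close> runs over a chord whose
  half-length has the square 1 - |y|^2, and |s| integrates over the chord to exactly that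
  square.\<close>

lemma nn_integral_ball_abs_inner:
  "(\<integral>\<^sup>+x. ennreal \<bar>x \<bullet> u\<bar> * indicator (cball 0 1) x \<partial>lborel) = ennreal (2 / (DIM('m) + 2) * unit_ball_vol (DIM('m)))"
proof -
  have [measurable]: "cball (0::'a) 1 \<in> sets borel" by simp
  have "(\<integral>\<^sup>+x. ennreal \<bar>x \<bullet> u\<bar> * indicator (cball 0 1) x \<partial>lborel)
    = (\<integral>\<^sup>+s. \<integral>\<^sup>+y. ennreal \<bar>(s *\<^sub>R u + f y) \<bullet> u\<bar> * indicator (cball 0 1) (s *\<^sub>R u + f y) \<partial>lborel \<partial>lborel)"
    by (rule nn_integral_split) measurable
  also have "\<dots> = (\<integral>\<^sup>+y. \<integral>\<^sup>+s. ennreal \<bar>(s *\<^sub>R u + f y) \<bullet> u\<bar> * indicator (cball 0 1) (s *\<^sub>R u + f y) \<partial>lborel \<partial>lborel)"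
    by (rule lborel_pair.Fubini') measurable
  also have "\<dots> = (\<integral>\<^sup>+y. ennreal (1 - (norm y)\<^sup>2) * indicator (cball (0::'m) 1) y \<partial>lborel)"
  proof (intro nn_integral_cong)
    fix y :: 'm
    have nrm: "norm (s *\<^sub>R u + f y) \<le> 1 \<longleftrightarrow> s\<^sup>2 \<le> 1 - (norm y)\<^sup>2" for s
      using norm_split[of s y] abs_le_square_iff[of "norm (s *\<^sub>R u + f y)" 1] by auto
    show "(\<integral>\<^sup>+s. ennreal \<bar>(s *\<^sub>R u + f y) \<bullet> u\<bar> * indicator (cball 0 1) (s *\<^sub>R u + f y) \<partial>lborel)
      = ennreal (1 - (norm y)\<^sup>2) * indicator (cball (0::'m) 1) y"
    proof (cases "norm y < 1")
      case True
      define a where "a = sqrt (1 - (norm y)\<^sup>2)"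
      have a: "a > 0" "a\<^sup>2 = 1 - (norm y)\<^sup>2"
        using True abs_square_less_1[of "norm y"] by (auto simp: a_def)
      have "s\<^sup>2 \<le> 1 - (norm y)\<^sup>2 \<longleftrightarrow> \<bar>s\<bar> \<le> a" for s
        unfolding a(2)[symmetric] using abs_le_square_iff[of s a] a by simp
      then have "(\<integral>\<^sup>+s. ennreal \<bar>(s *\<^sub>R u + f y) \<bullet> u\<bar> * indicator (cball 0 1) (s *\<^sub>R u + f y) \<partial>lborel)
         = (\<integral>\<^sup>+t. ennreal \<bar>t\<bar> * indicator (cball 0 a) t \<partial>lborel)"
        by (intro nn_integral_cong) (auto simp: indicator_def inner_simps uu f_orth nrm)
      then show ?thesis using nn_integral_abs_interval[OF a(1)] a(2) True by simp
    next
      case False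
      then have y1: "(norm y)\<^sup>2 \<ge> 1" by (simp add: one_le_power)
      have "(\<integral>\<^sup>+s. ennreal \<bar>(s *\<^sub>R u + f y) \<bullet> u\<bar> * indicator (cball 0 1) (s *\<^sub>R u + f y) \<partial>lborel) = (\<integral>\<^sup>+(s::real). 0 \<partial>lborel)"
      proof (intro nn_integral_cong)
        fix s
        show "ennreal \<bar>(s *\<^sub>R u + f y) \<bullet> u\<bar> * indicator (cball 0 1) (s *\<^sub>R u + f y) = 0"
        \<comment> \<open>If \<open>y\<close> has norm 1, the chord is the single point
          \<open>s = 0\<close>, where the integrand vanishes.\<close>
        proof (cases "s = 0")
          case False
          then have "s\<^sup>2 > 0" by simp
          then have "\<not> s\<^sup>2 \<le> 1 - (norm y)\<^sup>2" using y1 by linarith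
          then have "\<not> norm (s *\<^sub>R u + f y) \<le> 1" using nrm by simp
          then show ?thesis by simp
        qed (simp add: f_orth)
      qed
      then show ?thesis using y1 by (simp add: ennreal_neg)
    qed
  qed
  also have "\<dots> = ennreal (2 / (DIM('m) + 2) * unit_ball_vol (DIM('m)))"
    by (rule nn_integral_ball_one_minus_norm_square)
  finally show ?thesis .
qed

text \<open>The radial formula in degree 0 and then in degree 1 removes one factor 1/|x| each time;
  with n = m + 1 the product of n/(n - 1), (n + 1)/n and 2/(m + 2) telescopes to 2/m.\<close>

lemma nn_integral_ball_abs_inner_over_norm_square:
  "(\<integral>\<^sup>+x. ennreal (\<bar>x \<bullet> u\<bar> / (norm x)\<^sup>2) * indicator (cball 0 1) x \<partial>lborel)
     = ennreal (2 / DIM('m) * unit_ball_vol (DIM('m)))"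
proof -
  let ?B = "cball (0::'a) 1" and ?m = "real DIM('m)" and ?n = "real DIM('a)" and ?w = "unit_ball_vol (real DIM('m))"
  have n: "?n = ?m + 1" using dim by linarith
  have m: "?m \<ge> 1" using DIM_positive[where 'a='m] by linarith
  have "(\<integral>\<^sup>+x. ennreal (\<bar>x \<bullet> u\<bar> / (norm x)\<^sup>2) * indicator ?B x \<partial>lborel)
     = (\<integral>\<^sup>+x. ennreal (\<bar>x \<bullet> u\<bar> / norm x) * ennreal (1 / norm x) * indicator ?B x \<partial>lborel)"
    by (intro nn_integral_cong) (simp add: power2_eq_square flip: ennreal_mult')
  also have "\<dots> = ennreal ((?n + 0) / (?n + 0 - 1)) * (\<integral>\<^sup>+x. ennreal (\<bar>x \<bullet> u\<bar> / norm x) * indicator ?B x \<partial>lborel)"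
    using m n by (intro nn_integral_homogeneous_over_norm) (auto simp: abs_mult)
  also have "(\<integral>\<^sup>+x. ennreal (\<bar>x \<bullet> u\<bar> / norm x) * indicator ?B x \<partial>lborel)
     = (\<integral>\<^sup>+x. ennreal \<bar>x \<bullet> u\<bar> * ennreal (1 / norm x) * indicator ?B x \<partial>lborel)"
    by (intro nn_integral_cong) (simp flip: ennreal_mult')
  also have "\<dots> = ennreal ((?n + 1) / (?n + 1 - 1)) * (\<integral>\<^sup>+x. ennreal \<bar>x \<bullet> u\<bar> * indicator ?B x \<partial>lborel)"
    using m n by (intro nn_integral_homogeneous_over_norm) (auto simp: abs_mult ennreal_mult')
  also have "\<dots> = ennreal ((?n + 1) / (?n + 1 - 1)) * ennreal (2 / (DIM('m) + 2) * ?w)"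
    by (simp only: nn_integral_ball_abs_inner)
  also have "ennreal ((?n + 0) / (?n + 0 - 1)) * \<dots>
      = ennreal (((?n + 0) / (?n + 0 - 1)) * (((?n + 1) / (?n + 1 - 1)) * (2 / (DIM('m) + 2) * ?w)))"
    using m n by (intro ennreal_mult3) auto
  also have "((?n + 0) / (?n + 0 - 1)) * (((?n + 1) / (?n + 1 - 1)) * (2 / (DIM('m) + 2) * ?w))
      = 2 / DIM('m) * ?w"
  proof -
    have "(x + 1 + 0) / (x + 1 + 0 - 1) * ((x + 1 + 1) / (x + 1 + 1 - 1) * (2 / (x + 2) * w)) = 2 / x * w"
      if "x \<ge> 1" for x w :: real
    proof -
      have "(x + 1) / x * ((x + 2) / (x + 1) * (2 / (x + 2) * w)) = 2 / x * w" using that by simp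
      moreover have "x + 1 + 0 = x + 1" "x + 1 + 0 - 1 = x" "x + 1 + 1 = x + 2" "x + 1 + 1 - 1 = x + 1" by auto
      ultimately show ?thesis by metis
    qed
    then show ?thesis unfolding n of_nat_add of_nat_numeral using m by blast
  qed
  finally show ?thesis .
qed

text \<open>Rescaling the normal coordinate by \<open>h\<close> turns the slab average into an
  average of parallel section integrals over \<open>t\<close> in (-1, 1). Since \<open>U\<close> is
  open and \<open>g\<close> is continuous, the integrand converges at every point of the section,
  and Fatou's lemma is applied in \<open>y\<close> and then in \<open>t\<close>.\<close>

lemma hyperplane_integral_le_liminf_slab:
  assumes g: "continuous_on UNIV g" "\<And>x. 0 \<le> (g x :: real)" and U: "open U"
    and \<eta>: "\<And>k. \<eta> k > 0" "\<eta> \<longlonglongrightarrow> 0"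
  shows "(\<integral>\<^sup>+y. ennreal (g (f y)) * indicator U (f y) \<partial>lborel)
    \<le> liminf (\<lambda>k. ennreal (1 / (2 * \<eta> k)) * (\<integral>\<^sup>+x. ennreal (g x) * indicator U x * indicator {x. \<bar>x \<bullet> u\<bar> < \<eta> k} x \<partial>lborel))"
proof -
  let ?i = "\<lambda>t::real. indicator {-1<..<1} t / 2 :: real"
  have [measurable]: "g \<in> borel_measurable borel" using g(1) by (rule borel_measurable_continuous_onI)
  have [measurable]: "U \<in> sets borel" using U by simp
  \<comment> \<open>The factor \<open>?i t\<close> is the uniform probability density on (-1,
    1).\<close>
  define \<Phi> where "\<Phi> h t y = ennreal (?i t * (g ((h * t) *\<^sub>R u + f y) * indicator U ((h * t) *\<^sub>R u + f y)))"
    for h t :: real and y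
  have [measurable]: "(\<lambda>(t, y). \<Phi> h t y) \<in> borel_measurable (borel \<Otimes>\<^sub>M borel)" for h
    unfolding \<Phi>_def by measurable
  have slab: "ennreal (1 / (2 * h)) * (\<integral>\<^sup>+x. ennreal (g x) * indicator U x * indicator {x. \<bar>x \<bullet> u\<bar> < h} x \<partial>lborel)
      = (\<integral>\<^sup>+t. \<integral>\<^sup>+y. \<Phi> h t y \<partial>lborel \<partial>lborel)" if h: "h > 0" for h
  proof -
    have "(\<integral>\<^sup>+x. ennreal (g x) * indicator U x * indicator {x. \<bar>x \<bullet> u\<bar> < h} x \<partial>lborel)
      = (\<integral>\<^sup>+s. \<integral>\<^sup>+y. ennreal (g (s *\<^sub>R u + f y)) * indicator U (s *\<^sub>R u + f y) * indicator {x. \<bar>x \<bullet> u\<bar> < h} (s *\<^sub>R u + f y) \<partial>lborel \<partial>lborel)"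
      by (rule nn_integral_split) measurable
    also have "\<dots> = ennreal (h ^ DIM(real)) * (\<integral>\<^sup>+t. \<integral>\<^sup>+y. ennreal (g ((h *\<^sub>R t) *\<^sub>R u + f y)) * indicator U ((h *\<^sub>R t) *\<^sub>R u + f y) * indicator {x. \<bar>x \<bullet> u\<bar> < h} ((h *\<^sub>R t) *\<^sub>R u + f y) \<partial>lborel \<partial>lborel)"
      using h by (intro nn_integral_lborel_scaleR) measurable
    also have "\<dots> = ennreal h * (\<integral>\<^sup>+t. \<integral>\<^sup>+y. ennreal 2 * \<Phi> h t y \<partial>lborel \<partial>lborel)"
    proof -
      have "ennreal (g ((h *\<^sub>R t) *\<^sub>R u + f y)) * indicator U ((h *\<^sub>R t) *\<^sub>R u + f y) * indicator {x. \<bar>x \<bullet> u\<bar> < h} ((h *\<^sub>R t) *\<^sub>R u + f y)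
        = ennreal 2 * \<Phi> h t y" for t y
      proof -
        have "\<bar>h * t\<bar> < h \<longleftrightarrow> -1 < t \<and> t < 1" using h by (auto simp: abs_mult abs_less_iff)
        moreover have "ennreal 2 * \<Phi> h t y
          = ennreal (2 * (?i t * (g ((h * t) *\<^sub>R u + f y) * indicator U ((h * t) *\<^sub>R u + f y))))"
          unfolding \<Phi>_def by (rule ennreal_mult'[symmetric]) simp
        ultimately show ?thesis by (simp add: indicator_def inner_simps uu f_orth)
      qed
      then show ?thesis by simp
    qed
    also have "\<dots> = ennreal (2 * h) * (\<integral>\<^sup>+t. \<integral>\<^sup>+y. \<Phi> h t y \<partial>lborel \<partial>lborel)"
      using h by (simp add: nn_integral_cmult ennreal_mult' mult_ac)
    finally have "(\<integral>\<^sup>+x. ennreal (g x) * indicator U x * indicator {x. \<bar>x \<bullet> u\<bar> < h} x \<partial>lborel) = \<dots>" .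
    moreover have "ennreal (1 / (2 * h)) * ennreal (2 * h) = 1"
      using h by (subst ennreal_mult'[symmetric]) auto
    ultimately show ?thesis by (simp add: mult.assoc[symmetric])
  qed
  have "(\<integral>\<^sup>+y. ennreal (g (f y)) * indicator U (f y) \<partial>lborel)
      = (\<integral>\<^sup>+t. \<integral>\<^sup>+y. ennreal (?i t) * (ennreal (g (f y)) * indicator U (f y)) \<partial>lborel \<partial>lborel)"
  proof -
    have "(\<integral>\<^sup>+t. ennreal (?i t) \<partial>lborel) = (\<integral>\<^sup>+t. ennreal (1/2) * indicator {-1<..<1::real} t \<partial>lborel)"
      by (intro nn_integral_cong) (auto simp: indicator_def)
    also have "\<dots> = ennreal (1/2) * ennreal 2" by (subst nn_integral_cmult) auto
    also have "\<dots> = 1" by (subst ennreal_mult'[symmetric]) auto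
    finally show ?thesis by (simp add: nn_integral_cmult nn_integral_multc)
  qed
  also have "\<dots> \<le> (\<integral>\<^sup>+t. \<integral>\<^sup>+y. liminf (\<lambda>k. \<Phi> (\<eta> k) t y) \<partial>lborel \<partial>lborel)"
  proof (intro nn_integral_mono)
    fix t :: real and y
    show "ennreal (?i t) * (ennreal (g (f y)) * indicator U (f y)) \<le> liminf (\<lambda>k. \<Phi> (\<eta> k) t y)"
    proof (cases "f y \<in> U")
      case True
      have "(\<lambda>k. (\<eta> k * t) *\<^sub>R u + f y) \<longlonglongrightarrow> (0 * t) *\<^sub>R u + f y"
        by (intro tendsto_intros \<eta>)
      then have z: "(\<lambda>k. (\<eta> k * t) *\<^sub>R u + f y) \<longlonglongrightarrow> f y" by simp
      have ev: "eventually (\<lambda>k. (\<eta> k * t) *\<^sub>R u + f y \<in> U) sequentially"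
        using topological_tendstoD[OF z U True] .
      have "(\<lambda>k. g ((\<eta> k * t) *\<^sub>R u + f y)) \<longlonglongrightarrow> g (f y)"
        using continuous_on_tendsto_compose[OF g(1) z] by simp
      then have "(\<lambda>k. ennreal (?i t * g ((\<eta> k * t) *\<^sub>R u + f y))) \<longlonglongrightarrow> ennreal (?i t * g (f y))"
        by (intro tendsto_intros)
      moreover have "eventually (\<lambda>k. ennreal (?i t * g ((\<eta> k * t) *\<^sub>R u + f y)) = \<Phi> (\<eta> k) t y) sequentially"
        using ev by eventually_elim (simp add: \<Phi>_def)
      ultimately have "(\<lambda>k. \<Phi> (\<eta> k) t y) \<longlonglongrightarrow> ennreal (?i t * g (f y))"
        by (rule Lim_transform_eventually)
      then have "liminf (\<lambda>k. \<Phi> (\<eta> k) t y) = ennreal (?i t * g (f y))"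
        by (intro lim_imp_Liminf) auto
      then show ?thesis using True by (simp flip: ennreal_mult')
    qed auto
  qed
  also have "\<dots> \<le> (\<integral>\<^sup>+t. liminf (\<lambda>k. \<integral>\<^sup>+y. \<Phi> (\<eta> k) t y \<partial>lborel) \<partial>lborel)"
    by (intro nn_integral_mono nn_integral_liminf) measurable
  also have "\<dots> \<le> liminf (\<lambda>k. \<integral>\<^sup>+t. \<integral>\<^sup>+y. \<Phi> (\<eta> k) t y \<partial>lborel \<partial>lborel)"
    by (intro nn_integral_liminf) measurable
  finally show ?thesis using slab \<eta> by simp
qed

end

lemma hyp_iso_frame:
  fixes \<theta> :: "real^'n" and M :: "'m::euclidean_space itself"
  assumes "norm \<theta> = 1" "DIM('m) + 1 = CARD('n)"
  shows "hyperplane_frame \<theta> (hyp_iso M \<theta>)"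
proof -
  have "\<theta> \<noteq> 0" using assms by auto
  have "dim (UNIV :: 'm set) = dim {x. \<theta> \<bullet> x = 0}"
    using assms dim_hyperplane[OF \<open>\<theta> \<noteq> 0\<close>] by simp
  then obtain f :: "'m \<Rightarrow> real^'n" where "linear f" "f ` UNIV = {x. \<theta> \<bullet> x = 0}" "\<And>x. x \<in> UNIV \<Longrightarrow> norm (f x) = norm x"
    using isometry_subspaces[OF subspace_UNIV subspace_hyperplane] by metis
  then have "\<exists>f :: 'm \<Rightarrow> real^'n. linear f \<and> (\<forall>y. norm (f y) = norm y) \<and> range f = {x. x \<bullet> \<theta> = 0}"
    by (intro exI[of _ f]) (auto simp: inner_commute)
  then have "linear (hyp_iso M \<theta>) \<and> (\<forall>y. norm (hyp_iso M \<theta> y) = norm y) \<and> range (hyp_iso M \<theta>) = {x. x \<bullet> \<theta> = 0}"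
    unfolding hyp_iso_def by (rule someI_ex)
  then show ?thesis using assms unfolding hyperplane_frame_def by simp
qed

text \<open>The slab estimate concerns open sets, so \<open>L\<close> has to be replaced by its
  interior. What is lost, \<open>L - interior L\<close>, meets every ray from the origin in at most
  one point, and a closed set of this kind is negligible.\<close>

lemma AE_star_body_interior:
  fixes f :: "'m::euclidean_space \<Rightarrow> 'a::euclidean_space"
  assumes L: "star_body L" and f: "linear f" and inj: "\<And>y. f y = 0 \<Longrightarrow> y = 0"
  shows "AE y in lborel. f y \<in> L \<longrightarrow> f y \<in> interior L"
proof -
  have cl: "closed L" using L by (auto simp: star_body_def compact_imp_closed)
  let ?S = "f -` (L - interior L)"
  have cS: "closed ?S"
    using f cl by (intro continuous_closed_vimage closed_Diff open_interior linear_continuous_at linear_conv_bounded_linear[THEN iffD1])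
  have seg: "c *\<^sub>R x \<in> interior L" if "x \<in> L" "0 \<le> c" "c < 1" "x \<noteq> 0" for c and x :: 'a
  proof -
    have "c *\<^sub>R x \<noteq> x" using that by (metis less_irrefl scaleR_cancel_right scaleR_one)
    then have "c *\<^sub>R x \<in> closed_segment 0 x - {x}"
      using that by (auto simp: closed_segment_def intro!: exI[of _ c])
    then show ?thesis using L that by (auto simp: star_body_def)
  qed
  have "negligible ?S"
  \<comment> \<open>A nonzero point of \<open>L\<close> forces the origin into the interior.
    Otherwise \<open>L\<close> is empty or consists of the origin alone, which
    \<open>star_body\<close> admits.\<close>
  proof (cases "\<exists>x\<in>L. x \<noteq> 0")
    case True
    then have "0 \<in> interior L" using seg[of _ 0] by auto
    show ?thesis
    proof (rule starlike_negligible_strong[OF cS, of 0])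
      fix c :: real and x :: 'm assume "0 \<le> c" "c < 1" "0 + x \<in> ?S"
      moreover from this have "f x \<noteq> 0" using \<open>0 \<in> interior L\<close> by auto
      ultimately have "c *\<^sub>R f x \<in> interior L" using seg[of "f x" c] by auto
      then show "0 + c *\<^sub>R x \<notin> ?S" by (simp add: linear_scale[OF f])
    qed
  next
    case False
    then have "?S \<subseteq> {0}" using inj by auto
    then show ?thesis using negligible_subset negligible_sing by blast
  qed
  then have "emeasure lebesgue ?S = 0" by (simp add: negligible_iff_null_sets null_sets_def)
  then have "?S \<in> null_sets lborel" using cS by (auto simp: null_sets_def borel_closed)
  then show ?thesis by (rule AE_I') auto
qed

lemma mu_hyp_le_liminf_slab:
  fixes \<theta> :: "real^'n" and M :: "'m::euclidean_space itself"
  assumes \<theta>: "norm \<theta> = 1" and dim: "DIM('m) + 1 = CARD('n)"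
    and g: "continuous_on UNIV g" "\<And>x. 0 \<le> g x" and L: "star_body L"
    and \<eta>: "\<And>k. \<eta> k > 0" "\<eta> \<longlonglongrightarrow> 0"
  shows "mu_hyp M g \<theta> (L \<inter> {x. x \<bullet> \<theta> = 0})
    \<le> liminf (\<lambda>k. ennreal (1 / (2 * \<eta> k)) * (\<integral>\<^sup>+x. ennreal (g x) * indicator (interior L) x * indicator {x. \<bar>x \<bullet> \<theta>\<bar> < \<eta> k} x \<partial>lborel))"
proof -
  interpret hyperplane_frame \<theta> "hyp_iso M \<theta>" using \<theta> dim by (rule hyp_iso_frame)
  have AE_int: "AE y in lborel. hyp_iso M \<theta> y \<in> L \<longrightarrow> hyp_iso M \<theta> y \<in> interior L"
    by (rule AE_star_body_interior[OF L lin]) (use iso in \<open>metis norm_eq_zero\<close>)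
  have "mu_hyp M g \<theta> (L \<inter> {x. x \<bullet> \<theta> = 0})
      \<le> (\<integral>\<^sup>+y. ennreal (g (hyp_iso M \<theta> y)) * indicator (interior L) (hyp_iso M \<theta> y) \<partial>lborel)"
    unfolding mu_hyp_def
    by (intro nn_integral_mono_AE, use AE_int in eventually_elim) (auto simp: indicator_def)
  also note hyperplane_integral_le_liminf_slab[OF g open_interior \<eta>]
  finally show ?thesis .
qed

section \<open>Gauge functions of convex bodies\<close>

text \<open>The infimum \<open>R s\<close> of the slopes to the right of \<open>s\<close> is monotone and lies between the slopes on
  both sides, so \<open>c\<close> is differentiable wherever \<open>R\<close> is continuous.\<close>

lemma convex_real_differentiable_countable:
  fixes c :: "real \<Rightarrow> real"
  assumes conv: "convex_on UNIV c"
  shows "countable {s. \<not> (\<exists>D. (c has_real_derivative D) (at s))}"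
proof -
  have sl: "(c s - c r) / (s - r) \<le> (c t - c s) / (t - s)" if "r < s" "s < t" for r s t
  proof -
    define l where "l = (s - r) / (t - r)"
    have lt: "l * (t - r) = s - r" using that by (simp add: l_def)
    have "(1 - l) * r + l * t = r + l * (t - r)" by (simp add: algebra_simps)
    then have l: "0 \<le> l" "l \<le> 1" "(1 - l) * r + l * t = s" using that lt by (auto simp: l_def divide_le_eq_1)
    have "c s \<le> (1 - l) * c r + l * c t"
      using convex_onD[OF conv, of l r t] l by simp
    then have "(t - r) * c s \<le> (t - r) * ((1 - l) * c r + l * c t)"
      using that by (intro mult_left_mono) auto
    also have "\<dots> = (t - r - l * (t - r)) * c r + (l * (t - r)) * c t" by (simp add: algebra_simps)
    also have "\<dots> = (t - s) * c r + (s - r) * c t" unfolding lt by simp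
    finally have "(t - r) * c s \<le> (t - s) * c r + (s - r) * c t" .
    then have "(c s - c r) * (t - s) \<le> (c t - c s) * (s - r)" by (simp add: algebra_simps)
    then show ?thesis using that by (simp add: divide_le_eq le_divide_eq mult.commute mult.left_commute)
  qed
  define R where "R s = Inf ((\<lambda>t. (c t - c s) / (t - s)) ` {s<..})" for s
  have bdd: "bdd_below ((\<lambda>t. (c t - c s) / (t - s)) ` {s<..})" for s
    using sl[of "s - 1" s] by (intro bdd_belowI[of _ "(c s - c (s - 1)) / (s - (s - 1))"]) auto
  have up: "R s \<le> (c t - c s) / (t - s)" if "s < t" for s t
    unfolding R_def using that bdd[of s] by (intro cInf_lower) auto
  have lo: "(c s - c r) / (s - r) \<le> R s" if "r < s" for r s
    unfolding R_def using that sl[OF that] by (intro cInf_greatest) auto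
  have "mono R"
  proof (rule monoI)
    fix r s :: real assume "r \<le> s"
    then show "R r \<le> R s" using up[of r s] lo[of r s] by (cases "r = s") auto
  qed
  then have cnt: "countable {s. \<not> isCont R s}" by (rule mono_ctble_discont)
  have D: "(c has_real_derivative R s) (at s)" if "isCont R s" for s
    unfolding has_field_derivative_iff
  proof (rule Lim_null[THEN iffD2], rule tendsto_rabs_zero_cancel, rule tendsto_sandwich[where f="\<lambda>_. 0"])
    have "(R \<longlongrightarrow> R s) (at s)" using that by (simp add: isCont_def)
    then show "((\<lambda>t. \<bar>R t - R s\<bar>) \<longlongrightarrow> 0) (at s)"
      by (intro tendsto_rabs_zero) (simp add: LIM_zero)
    have "\<bar>(c t - c s) / (t - s) - R s\<bar> \<le> \<bar>R t - R s\<bar>" if "t \<noteq> s" for t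
    proof (cases "t < s")
      case True
      have "(c s - c t) / (s - t) = (c t - c s) / (t - s)" by (metis minus_diff_eq minus_divide_divide)
      then show ?thesis using lo[OF True] up[OF True] by simp
    next
      case False
      then show ?thesis using lo[of s t] up[of s t] that by simp
    qed
    then show "\<forall>\<^sub>F t in at s. \<bar>(c t - c s) / (t - s) - R s\<bar> \<le> \<bar>R t - R s\<bar>"
      by (simp add: eventually_at_filter)
  qed auto
  from D have "{s. \<not> (\<exists>D. (c has_real_derivative D) (at s))} \<subseteq> {s. \<not> isCont R s}" by blast
  then show ?thesis using cnt by (rule countable_subset)
qed

text \<open>The Minkowski functional. Its form through \<open>sdil\<close> matches the level-set
  hypothesis of \<open>nn_integral_homogeneous_layers\<close>.\<close>

definition mgauge :: "'a::real_vector set \<Rightarrow> 'a \<Rightarrow> real" where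
  "mgauge A x = Inf {t. 0 < t \<and> x \<in> sdil t A}"

locale convex_body_origin =
  fixes A :: "'a::euclidean_space set"
  assumes compact_A: "compact A" and convex_A: "convex A" and zero_interior: "0 \<in> interior A"
begin

lemma zero_in: "0 \<in> A" using zero_interior interior_subset by auto

lemma inner_ball: obtains r where "r > 0" "cball 0 r \<subseteq> A"
  using zero_interior mem_interior_cball by blast

lemma mem_sdil: "t > 0 \<Longrightarrow> x \<in> sdil t A \<longleftrightarrow> (1 / t) *\<^sub>R x \<in> A"
  by (simp add: sdil_eq_vimage)

lemma sdil_mono: assumes "0 < s" "s \<le> t" shows "sdil s A \<subseteq> sdil t A"
proof
  fix x assume "x \<in> sdil s A"
  then have "(1 / s) *\<^sub>R x \<in> A" using assms by (simp add: mem_sdil)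
  then have "(s / t) *\<^sub>R ((1 / s) *\<^sub>R x) \<in> A"
    using convexD_alt[OF convex_A zero_in, of "(1 / s) *\<^sub>R x" "s / t"] assms by simp
  then show "x \<in> sdil t A" using assms by (simp add: mem_sdil)
qed

lemma levels_nonempty: "{t. 0 < t \<and> x \<in> sdil t A} \<noteq> {}"
proof -
  obtain r where r: "r > 0" "cball 0 r \<subseteq> A" by (rule inner_ball)
  define t where "t = (norm x + 1) / r"
  have t: "t > 0" using r by (auto simp: t_def intro!: divide_pos_pos add_nonneg_pos)
  have "norm ((1 / t) *\<^sub>R x) = r * (norm x / (norm x + 1))" using r t by (simp add: t_def)
  also have "\<dots> \<le> r * 1" using r by (intro mult_left_mono) (auto simp: divide_le_eq add_nonneg_pos)
  finally have "(1 / t) *\<^sub>R x \<in> A" using r by auto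
  then show ?thesis using t by (auto simp: mem_sdil intro!: exI[of _ t])
qed

lemma levels_bdd: "bdd_below {t. 0 < t \<and> x \<in> sdil t A}"
  by (intro bdd_belowI[of _ 0]) auto

lemma gauge_nonneg: "0 \<le> mgauge A x"
  unfolding mgauge_def using levels_nonempty by (intro cInf_greatest) auto

text \<open>The level \<open>t\<close> itself is reached because \<open>A\<close> is closed:
  \<open>(1 / s) *\<^sub>R x\<close> lies in \<open>A\<close> for every \<open>s > t\<close>, and
  \<open>s\<close> tends to \<open>t\<close>.\<close>

lemma gauge_le_iff: assumes "t > 0" shows "mgauge A x \<le> t \<longleftrightarrow> x \<in> sdil t A"
proof
  assume "x \<in> sdil t A" then show "mgauge A x \<le> t"
    unfolding mgauge_def using assms levels_bdd by (intro cInf_lower) auto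
next
  assume le: "mgauge A x \<le> t"
  have ev: "(1 / s) *\<^sub>R x \<in> A" if "s > t" for s
  proof -
    have "mgauge A x < s" using le that by simp
    then obtain s' where "0 < s'" "x \<in> sdil s' A" "s' < s"
      unfolding mgauge_def using cInf_lessD[OF levels_nonempty] by blast
    then have "x \<in> sdil s A" using sdil_mono[of s' s] by auto
    then show ?thesis using that assms by (simp add: mem_sdil)
  qed
  have "(\<lambda>k. 1 / real (Suc k)) \<longlonglongrightarrow> 0"
    using LIMSEQ_inverse_real_of_nat by (simp add: inverse_eq_divide)
  then have "(\<lambda>k. (1 / (t + 1 / real (Suc k))) *\<^sub>R x) \<longlonglongrightarrow> (1 / (t + 0)) *\<^sub>R x"
    using assms by (intro tendsto_intros) auto
  moreover have "closed A" using compact_A by (rule compact_imp_closed)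
  moreover have "\<forall>k. (1 / (t + 1 / real (Suc k))) *\<^sub>R x \<in> A"
    by (intro allI ev) simp
  ultimately have "(1 / (t + 0)) *\<^sub>R x \<in> A"
    unfolding closed_sequential_limits by (metis (no_types, lifting))
  then have "(1 / t) *\<^sub>R x \<in> A" by simp
  then show "x \<in> sdil t A" using assms by (simp add: mem_sdil)
qed

lemma sdil_eq_gauge: "t > 0 \<Longrightarrow> sdil t A = {x. mgauge A x \<le> t}"
  using gauge_le_iff by auto

lemma mem_iff_gauge: "x \<in> A \<longleftrightarrow> mgauge A x \<le> 1"
  using gauge_le_iff[of 1 x] by (simp add: sdil_def)

lemma gauge_leI: assumes "b \<ge> 0" "\<And>t. t > 0 \<Longrightarrow> b \<le> t \<Longrightarrow> x \<in> sdil t A" shows "mgauge A x \<le> b"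
proof (rule field_le_epsilon)
  fix e :: real assume "e > 0"
  then have "b + e > 0" "b \<le> b + e" using assms(1) by auto
  then show "mgauge A x \<le> b + e" using assms(2) gauge_le_iff by blast
qed

lemma gauge_scaleR: assumes "c > 0" shows "mgauge A (c *\<^sub>R x) = c * mgauge A x"
proof (rule antisym)
  have le: "mgauge A (c *\<^sub>R x) \<le> c * mgauge A x" if "c > 0" for c x
  proof (rule gauge_leI)
    fix t :: real assume t: "t > 0" "c * mgauge A x \<le> t"
    then have "x \<in> sdil (t / c) A" using that by (simp add: gauge_le_iff[symmetric] field_simps)
    then show "c *\<^sub>R x \<in> sdil t A" using t that by (simp add: mem_sdil)
  qed (use that gauge_nonneg in auto)
  show "mgauge A (c *\<^sub>R x) \<le> c * mgauge A x" using le assms by auto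
  have "c * mgauge A ((1 / c) *\<^sub>R (c *\<^sub>R x)) \<le> c * ((1 / c) * mgauge A (c *\<^sub>R x))"
    using le[of "1 / c" "c *\<^sub>R x"] assms by (intro mult_left_mono) auto
  then show "c * mgauge A x \<le> mgauge A (c *\<^sub>R x)" using assms by simp
qed

lemma gauge_add: "mgauge A (x + y) \<le> mgauge A x + mgauge A y"
proof (rule field_le_epsilon)
  fix e :: real assume e: "e > 0"
  define s t where "s = mgauge A x + e / 2" and "t = mgauge A y + e / 2"
  have st: "s > 0" "t > 0" using e gauge_nonneg[of x] gauge_nonneg[of y] by (auto simp: s_def t_def)
  have "x \<in> sdil s A" "y \<in> sdil t A" using st e by (auto simp: gauge_le_iff[symmetric] s_def t_def)
  then have "(1 / s) *\<^sub>R x \<in> A" "(1 / t) *\<^sub>R y \<in> A" using st by (auto simp: mem_sdil)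
  then have "(s / (s + t)) *\<^sub>R ((1 / s) *\<^sub>R x) + (t / (s + t)) *\<^sub>R ((1 / t) *\<^sub>R y) \<in> A"
    using st by (intro convexD[OF convex_A]) (auto simp: add_divide_distrib[symmetric])
  then have "(1 / (s + t)) *\<^sub>R (x + y) \<in> A" using st by (simp add: scaleR_add_right)
  then have "mgauge A (x + y) \<le> s + t" using st by (simp add: gauge_le_iff mem_sdil)
  then show "mgauge A (x + y) \<le> mgauge A x + mgauge A y + e" by (simp add: s_def t_def)
qed

lemma gauge_zero: "mgauge A 0 = 0"
  using gauge_scaleR[of 2 0] by simp

lemma gauge_pos: assumes "x \<noteq> 0" shows "mgauge A x > 0"
proof (rule ccontr)
  assume "\<not> mgauge A x > 0"
  then have 0: "mgauge A x \<le> t" if "t > 0" for t using that by simp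
  obtain R where R: "R > 0" "\<And>y. y \<in> A \<Longrightarrow> norm y \<le> R"
    using compact_imp_bounded[OF compact_A] by (auto simp: bounded_pos)
  have "(2 * R / norm x) *\<^sub>R x \<in> A"
    using 0[of "norm x / (2 * R)"] assms R(1) by (simp add: gauge_le_iff mem_sdil)
  from R(2)[OF this] show False using assms R(1) by simp
qed

lemma gauge_le_norm: assumes "r > 0" "cball 0 r \<subseteq> A" shows "mgauge A x \<le> norm x / r"
proof (rule gauge_leI)
  fix t :: real assume t: "t > 0" "norm x / r \<le> t"
  have "norm x \<le> r * t" using t assms(1) by (simp add: pos_divide_le_eq mult.commute)
  then have "norm ((1 / t) *\<^sub>R x) \<le> r" using t(1) by (simp add: pos_divide_le_eq)
  then show "x \<in> sdil t A" using t assms(2) by (auto simp: mem_sdil)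
qed (use assms in auto)

lemma convex_gauge: "convex_on UNIV (mgauge A)"
proof (rule convex_onI)
  fix t x y assume t: "(0::real) < t" "t < 1"
  have "mgauge A ((1 - t) *\<^sub>R x + t *\<^sub>R y) \<le> mgauge A ((1 - t) *\<^sub>R x) + mgauge A (t *\<^sub>R y)" by (rule gauge_add)
  then show "mgauge A ((1 - t) *\<^sub>R x + t *\<^sub>R y) \<le> (1 - t) * mgauge A x + t * mgauge A y"
    using t by (simp add: gauge_scaleR)
qed auto

lemma continuous_gauge: "continuous_on UNIV (mgauge A)"
  using convex_on_continuous[OF open_UNIV convex_gauge] .

lemma gauge_measurable [measurable]: "mgauge A \<in> borel_measurable borel"
  using continuous_gauge by (rule borel_measurable_continuous_onI)

text \<open>The normal of a supporting hyperplane at the boundary point \<open>x0\<close>, scaled to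
  take the value 1 there. A positive multiple of the normal lies in the ball around the origin
  inside \<open>A\<close>, which makes that value positive before scaling.\<close>

lemma subgradient_exists:
  assumes "x \<noteq> 0" obtains \<xi> where "\<And>z. \<xi> \<bullet> z \<le> mgauge A z" "\<xi> \<bullet> x = mgauge A x"
proof -
  define x0 where "x0 = (1 / mgauge A x) *\<^sub>R x"
  have gp: "mgauge A x > 0" by (rule gauge_pos[OF assms])
  have g1: "mgauge A x0 = 1" using gp by (simp add: x0_def gauge_scaleR)
  have nin: "x0 \<notin> interior A"
  proof
    assume "x0 \<in> interior A"
    then obtain e where e: "e > 0" "cball x0 e \<subseteq> A" using mem_interior_cball by blast
    have x00: "x0 \<noteq> 0" using g1 gauge_zero by auto
    define s where "s = 1 + e / norm x0"
    have "dist x0 (s *\<^sub>R x0) = e" using x00 e by (simp add: s_def dist_norm scaleR_add_left)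
    then have "s *\<^sub>R x0 \<in> A" using e by auto
    then have "s \<le> 1" using g1 e x00 by (simp add: mem_iff_gauge gauge_scaleR s_def add_pos_pos)
    moreover have "e / norm x0 > 0" using e x00 by simp
    ultimately show False by (simp add: s_def)
  qed
  obtain a where a: "a \<noteq> 0" "\<And>y. y \<in> A \<Longrightarrow> a \<bullet> y \<le> a \<bullet> x0"
  proof -
    have "interior A \<inter> {x0} = {}" using nin by auto
    then obtain a b where ab: "a \<noteq> 0" "\<forall>x\<in>interior A. a \<bullet> x \<le> b" "\<forall>x\<in>{x0}. b \<le> a \<bullet> x"
      using separating_hyperplane_sets[of "interior A" "{x0}"] convex_interior[OF convex_A] zero_interior by blast
    have "A \<subseteq> closure (interior A)"
      using convex_closure_interior[OF convex_A] zero_interior closure_subset by blast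
    moreover have "closure (interior A) \<subseteq> {x. a \<bullet> x \<le> b}"
      using ab(2) by (intro closure_minimal closed_halfspace_le) auto
    ultimately have "a \<bullet> y \<le> a \<bullet> x0" if "y \<in> A" for y using that ab(3) by fastforce
    with ab(1) that show ?thesis by blast
  qed
  obtain r where r: "r > 0" "cball 0 r \<subseteq> A" by (rule inner_ball)
  have "(r / norm a) *\<^sub>R a \<in> A" using r a(1) by (intro subsetD[OF r(2)]) auto
  from a(2)[OF this] have m: "a \<bullet> x0 > 0"
  proof -
    have "0 < (r / norm a) * (a \<bullet> a)" using r a(1) by (intro mult_pos_pos divide_pos_pos) auto
    then show ?thesis using a(2)[OF \<open>(r / norm a) *\<^sub>R a \<in> A\<close>] by simp
  qed
  define \<xi> where "\<xi> = (1 / (a \<bullet> x0)) *\<^sub>R a"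
  show ?thesis
  proof (rule that[of \<xi>])
    show "\<xi> \<bullet> z \<le> mgauge A z" for z
    proof (cases "z = 0")
      case False
      then have zp: "mgauge A z > 0" by (rule gauge_pos)
      have "(1 / mgauge A z) *\<^sub>R z \<in> A" using zp by (simp add: mem_iff_gauge gauge_scaleR)
      from a(2)[OF this] show ?thesis using zp m by (simp add: \<xi>_def field_simps)
    qed (simp add: gauge_zero)
    have "x = mgauge A x *\<^sub>R x0" using gp by (simp add: x0_def)
    then have "\<xi> \<bullet> x = mgauge A x * (\<xi> \<bullet> x0)" by (metis inner_scaleR_right)
    also have "\<xi> \<bullet> x0 = 1" using m by (simp add: \<xi>_def)
    finally show "\<xi> \<bullet> x = mgauge A x" by simp
  qed
qed

end

section \<open>The almost everywhere gradient of the gauge\<close>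

text \<open>By translation invariance the measure is an average over the shifts by multiples
  \<open>t\<close> of \<open>v\<close>, with \<open>t\<close> in [0, 1]; Fubini then puts the
  countable sets on the lines innermost. Coordinates adapted to \<open>v\<close> are thereby
  avoided.\<close>

lemma null_sets_if_countable_on_lines:
  fixes N :: "'a::euclidean_space set"
  assumes [measurable]: "N \<in> sets borel" and cnt: "\<And>x. countable {s::real. x + s *\<^sub>R v \<in> N}"
  shows "N \<in> null_sets lborel"
proof -
  have "emeasure lborel N = (\<integral>\<^sup>+t. (\<integral>\<^sup>+x. indicator N x \<partial>lborel) * indicator {0..1::real} t \<partial>lborel)"
    by (simp add: nn_integral_cmult)
  also have "\<dots> = (\<integral>\<^sup>+t. \<integral>\<^sup>+x. indicator N (t *\<^sub>R v + x) * indicator {0..1::real} t \<partial>lborel \<partial>lborel)"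
  proof (intro nn_integral_cong)
    fix t :: real
    show "(\<integral>\<^sup>+x. indicator N x \<partial>lborel) * indicator {0..1} t = (\<integral>\<^sup>+x. indicator N (t *\<^sub>R v + x) * indicator {0..1} t \<partial>lborel)"
      using nn_integral_lborel_shift[of "indicator N" "t *\<^sub>R v"] by (simp add: nn_integral_multc)
  qed
  also have "\<dots> = (\<integral>\<^sup>+x. \<integral>\<^sup>+t. indicator N (t *\<^sub>R v + x) * indicator {0..1::real} t \<partial>lborel \<partial>lborel)"
    by (rule lborel_pair.Fubini') measurable
  also have "\<dots> = (\<integral>\<^sup>+(x::'a). 0 \<partial>lborel)"
  proof (intro nn_integral_cong)
    fix x
    have "AE t in lborel. t \<notin> {s::real. x + s *\<^sub>R v \<in> N}"
      using countable_imp_null_set_lborel[OF cnt] by (rule AE_not_in)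
    then have "AE t in lborel. indicator N (t *\<^sub>R v + x) * indicator {0..1::real} t = (0::ennreal)"
      by eventually_elim (simp add: add.commute)
    then show "(\<integral>\<^sup>+t. indicator N (t *\<^sub>R v + x) * indicator {0..1::real} t \<partial>lborel) = 0"
      by (subst nn_integral_0_iff_AE) measurable
  qed
  finally show ?thesis by (simp add: null_sets_def)
qed

context convex_body_origin
begin

text \<open>By convexity its limit in \<open>k\<close> is the jump between the one-sided derivatives
  at \<open>x\<close> along \<open>v\<close>. As an explicit sequence of measurable functions it
  yields both a Borel exceptional set and an error term for the estimates.\<close>

definition second_diff :: "'a \<Rightarrow> nat \<Rightarrow> 'a \<Rightarrow> real" where
  "second_diff v k x = real (Suc k) * (mgauge A (x + (1 / real (Suc k)) *\<^sub>R v) + mgauge A (x - (1 / real (Suc k)) *\<^sub>R v) - 2 * mgauge A x)"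

lemma second_diff_measurable [measurable]: "second_diff v k \<in> borel_measurable borel"
  unfolding second_diff_def[abs_def] by measurable

lemma second_diff_nonneg: "0 \<le> second_diff v k x"
proof -
  have "2 * mgauge A x = mgauge A ((x + (1 / real (Suc k)) *\<^sub>R v) + (x - (1 / real (Suc k)) *\<^sub>R v))"
    using gauge_scaleR[of 2 x] by (simp add: scaleR_2)
  also have "\<dots> \<le> mgauge A (x + (1 / real (Suc k)) *\<^sub>R v) + mgauge A (x - (1 / real (Suc k)) *\<^sub>R v)"
    by (rule gauge_add)
  finally show ?thesis by (simp add: second_diff_def)
qed

lemma convex_gauge_line: "convex_on UNIV (\<lambda>s. mgauge A (x + s *\<^sub>R v))"
proof (rule convex_onI)
  fix t a b :: real assume t: "0 < t" "t < 1"
  have "x + ((1 - t) *\<^sub>R a + t *\<^sub>R b) *\<^sub>R v = (1 - t) *\<^sub>R (x + a *\<^sub>R v) + t *\<^sub>R (x + b *\<^sub>R v)"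
    by (simp add: algebra_simps)
  then show "mgauge A (x + ((1 - t) *\<^sub>R a + t *\<^sub>R b) *\<^sub>R v) \<le> (1 - t) * mgauge A (x + a *\<^sub>R v) + t * mgauge A (x + b *\<^sub>R v)"
    using convex_onD[OF convex_gauge, of t "x + a *\<^sub>R v" "x + b *\<^sub>R v"] t by simp
qed auto

lemma second_diff_tendsto_zero_if_differentiable:
  assumes "((\<lambda>s. mgauge A (x + s *\<^sub>R v)) has_real_derivative D) (at s)"
  shows "(\<lambda>k. second_diff v k (x + s *\<^sub>R v)) \<longlonglongrightarrow> 0"
proof -
  let ?c = "\<lambda>s. mgauge A (x + s *\<^sub>R v)"
  let ?h = "\<lambda>k. 1 / real (Suc k)"
  have h: "?h \<longlonglongrightarrow> 0" using LIMSEQ_inverse_real_of_nat by (simp add: inverse_eq_divide)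
  have lim: "((\<lambda>h. (?c (s + h) - ?c s) / h) \<longlongrightarrow> D) (at 0)"
    using assms by (simp add: DERIV_def)
  have "filterlim ?h (at 0) sequentially" using h by (simp add: filterlim_at)
  from filterlim_compose[OF lim this] have 1: "(\<lambda>k. (?c (s + ?h k) - ?c s) / ?h k) \<longlonglongrightarrow> D" .
  have "filterlim (\<lambda>k. - ?h k) (at 0) sequentially"
    using tendsto_minus[OF h] by (simp add: filterlim_at)
  from filterlim_compose[OF lim this] have 2: "(\<lambda>k. (?c (s + - ?h k) - ?c s) / - ?h k) \<longlonglongrightarrow> D" .
  have "second_diff v k (x + s *\<^sub>R v) = (?c (s + ?h k) - ?c s) / ?h k - (?c (s + - ?h k) - ?c s) / - ?h k" for k
    unfolding second_diff_def by (simp add: scaleR_add_left scaleR_diff_left add.assoc algebra_simps)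
  then show ?thesis using tendsto_diff[OF 1 2] by simp
qed

text \<open>The exceptional set is given by a limsup, hence is Borel, and convexity leaves only
  countably many exceptions on each line parallel to \<open>v\<close>.\<close>

lemma AE_second_diff: "AE x in lborel. (\<lambda>k. second_diff v k x) \<longlonglongrightarrow> 0"
proof -
  define N where "N = {x. limsup (\<lambda>k. ennreal (second_diff v k x)) \<noteq> 0}"
  have iff: "x \<notin> N \<longleftrightarrow> (\<lambda>k. second_diff v k x) \<longlonglongrightarrow> 0" for x
  proof
    assume "x \<notin> N"
    then have "limsup (\<lambda>k. ennreal (second_diff v k x)) = 0" by (simp add: N_def)
    moreover then have "liminf (\<lambda>k. ennreal (second_diff v k x)) = 0"
      using Liminf_le_Limsup[of sequentially "\<lambda>k. ennreal (second_diff v k x)"] by simp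
    ultimately have "(\<lambda>k. ennreal (second_diff v k x)) \<longlonglongrightarrow> 0"
      by (simp add: tendsto_iff_Liminf_eq_Limsup)
    then show "(\<lambda>k. second_diff v k x) \<longlonglongrightarrow> 0"
      using ennreal_tendsto_0_iff[of "\<lambda>k. second_diff v k x"] second_diff_nonneg by simp
  next
    assume "(\<lambda>k. second_diff v k x) \<longlonglongrightarrow> 0"
    then have "(\<lambda>k. ennreal (second_diff v k x)) \<longlonglongrightarrow> 0"
      using ennreal_tendsto_0_iff[of "\<lambda>k. second_diff v k x"] second_diff_nonneg by simp
    then show "x \<notin> N" by (simp add: N_def lim_imp_Limsup)
  qed
  have "N \<in> null_sets lborel"
  proof (rule null_sets_if_countable_on_lines)
    show "N \<in> sets borel" unfolding N_def by measurable
    fix x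
    have "{s. x + s *\<^sub>R v \<in> N} \<subseteq> {s. \<not> (\<exists>D. ((\<lambda>s. mgauge A (x + s *\<^sub>R v)) has_real_derivative D) (at s))}"
      using second_diff_tendsto_zero_if_differentiable iff by blast
    then show "countable {s. x + s *\<^sub>R v \<in> N}"
      using convex_real_differentiable_countable[OF convex_gauge_line] by (rule countable_subset)
  qed
  then have "AE x in lborel. x \<notin> N" by (rule AE_not_in)
  then show ?thesis by (simp add: iff)
qed

text \<open>For a gauge this pair of conditions is equivalent, by homogeneity, to the usual
  subgradient inequality at \<open>x\<close>.\<close>

definition subgradient :: "'a \<Rightarrow> 'a \<Rightarrow> bool" where
  "subgradient x \<xi> \<longleftrightarrow> (\<forall>z. \<xi> \<bullet> z \<le> mgauge A z) \<and> \<xi> \<bullet> x = mgauge A x"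

lemma subgradient_ineq: "subgradient x \<xi> \<Longrightarrow> mgauge A x + \<xi> \<bullet> z \<le> mgauge A (x + z)"
  unfolding subgradient_def by (metis inner_add_right)

text \<open>Testing the gauge bound on \<open>\<xi>\<close> itself bounds the squared norm of
  \<open>\<xi>\<close> by \<open>norm \<xi> / r\<close>.\<close>

lemma subgradient_norm_le:
  assumes "subgradient x \<xi>" "r > 0" "cball 0 r \<subseteq> A"
  shows "norm \<xi> \<le> 1 / r"
proof (cases "\<xi> = 0")
  case False
  have "norm \<xi> * norm \<xi> \<le> norm \<xi> * (1 / r)"
    unfolding times_divide_eq_right mult_1_right using assms(1) gauge_le_norm[OF assms(2,3), of \<xi>] unfolding subgradient_def
    by (metis dot_square_norm order_trans power2_eq_square)
  then show ?thesis using False by (simp only: mult_le_cancel_left_pos zero_less_norm_iff not_False_eq_True)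
qed (use assms in auto)

text \<open>Convexity bounds the increment by \<open>h\<close> times the forward slope over the
  fixed step \<open>1 / real (Suc k)\<close>. The subgradient bounds the backward slope by
  \<open>\<xi> \<bullet> v\<close>, and \<open>second_diff\<close> is the difference of the two
  slopes. The relative error therefore depends on \<open>k\<close> but not on
  \<open>h\<close>.\<close>

lemma gauge_directional_le:
  assumes "subgradient x \<xi>" "0 < h" "h \<le> 1 / real (Suc k)"
  shows "mgauge A (x + h *\<^sub>R v) - mgauge A x \<le> h * (\<xi> \<bullet> v + second_diff v k x)"
proof -
  define n where "n = real (Suc k)"
  have n: "n > 0" by (simp add: n_def)
  have hn: "h * n \<le> 1" using assms(3)[folded n_def] n by (simp add: le_divide_eq)
  have "x + h *\<^sub>R v = (1 - h * n) *\<^sub>R x + (h * n) *\<^sub>R (x + (1 / n) *\<^sub>R v)"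
    using n by (simp add: algebra_simps)
  then have "mgauge A (x + h *\<^sub>R v) \<le> (1 - h * n) * mgauge A x + h * n * mgauge A (x + (1 / n) *\<^sub>R v)"
    using convex_onD[OF convex_gauge, of "h * n" x "x + (1 / n) *\<^sub>R v"] hn assms(2) n by simp
  then have 1: "mgauge A (x + h *\<^sub>R v) - mgauge A x \<le> h * (n * (mgauge A (x + (1 / n) *\<^sub>R v) - mgauge A x))"
    by (simp add: algebra_simps)
  have "mgauge A x + \<xi> \<bullet> (- ((1 / n) *\<^sub>R v)) \<le> mgauge A (x + (- ((1 / n) *\<^sub>R v)))"
    by (rule subgradient_ineq[OF assms(1)])
  then have "n * (mgauge A x - mgauge A (x - (1 / n) *\<^sub>R v)) \<le> n * ((\<xi> \<bullet> v) / n)"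
    using n by (intro mult_left_mono) auto
  then have "n * (mgauge A x - mgauge A (x - (1 / n) *\<^sub>R v)) \<le> \<xi> \<bullet> v" using n by simp
  then have "n * (mgauge A (x + (1 / n) *\<^sub>R v) - mgauge A x) \<le> \<xi> \<bullet> v + second_diff v k x"
    unfolding second_diff_def n_def[symmetric] by (simp add: algebra_simps)
  then have "h * (n * (mgauge A (x + (1 / n) *\<^sub>R v) - mgauge A x)) \<le> h * (\<xi> \<bullet> v + second_diff v k x)"
    using assms(2) by (intro mult_left_mono) auto
  with 1 show ?thesis by linarith
qed

text \<open>Limits of coordinate difference quotients instead of a choice of subgradients, which
  makes measurability immediate. Where a limit fails to exist, \<open>lim\<close> is an unspecified
  value; this happens on a null set only.\<close>

definition grad :: "'a \<Rightarrow> 'a" where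
  "grad x = (\<Sum>i\<in>Basis. lim (\<lambda>k. real (Suc k) * (mgauge A (x + (1 / real (Suc k)) *\<^sub>R i) - mgauge A x)) *\<^sub>R i)"

lemma grad_measurable [measurable]: "grad \<in> borel_measurable borel"
  unfolding grad_def[abs_def]
  by (intro borel_measurable_sum borel_measurable_scaleR borel_measurable_lim_metric) measurable

text \<open>In each coordinate direction the difference quotients are squeezed between
  \<open>\<xi> \<bullet> i\<close> and \<open>\<xi> \<bullet> i + second_diff i k x\<close> for any
  subgradient \<open>\<xi>\<close>, so that \<open>grad x\<close> must coincide with it.\<close>

lemma AE_grad: "AE x in lborel. subgradient x (grad x)"
proof -
  have "AE x in lborel. \<forall>i\<in>Basis. (\<lambda>k. second_diff i k x) \<longlonglongrightarrow> 0"
    by (intro AE_finite_allI AE_second_diff) auto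
  with AE_lborel_singleton[of "0::'a"] show ?thesis
  proof eventually_elim
    case (elim x)
    obtain \<xi> where \<xi>: "subgradient x \<xi>"
      using subgradient_exists[OF elim(1)] unfolding subgradient_def by metis
    have "lim (\<lambda>k. real (Suc k) * (mgauge A (x + (1 / real (Suc k)) *\<^sub>R i) - mgauge A x)) = \<xi> \<bullet> i" if i: "i \<in> Basis" for i
    proof (rule limI, rule tendsto_sandwich)
      let ?q = "\<lambda>k. real (Suc k) * (mgauge A (x + (1 / real (Suc k)) *\<^sub>R i) - mgauge A x)"
      have "\<xi> \<bullet> i \<le> ?q k" for k
      proof -
        have "real (Suc k) * (\<xi> \<bullet> ((1 / real (Suc k)) *\<^sub>R i)) \<le> ?q k"
          using subgradient_ineq[OF \<xi>, of "(1 / real (Suc k)) *\<^sub>R i"] by (intro mult_left_mono) (auto simp del: of_nat_Suc)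
        then show ?thesis by (simp del: of_nat_Suc)
      qed
      then show "\<forall>\<^sub>F k in sequentially. \<xi> \<bullet> i \<le> ?q k" by simp
      have "?q k \<le> \<xi> \<bullet> i + second_diff i k x" for k
      proof -
        have "?q k \<le> real (Suc k) * (1 / real (Suc k) * (\<xi> \<bullet> i + second_diff i k x))"
          using gauge_directional_le[OF \<xi>, of "1 / real (Suc k)" k i] by (intro mult_left_mono) (auto simp del: of_nat_Suc)
        then show ?thesis by (simp del: of_nat_Suc)
      qed
      then show "\<forall>\<^sub>F k in sequentially. ?q k \<le> \<xi> \<bullet> i + second_diff i k x" by simp
      show "(\<lambda>k. \<xi> \<bullet> i + second_diff i k x) \<longlonglongrightarrow> \<xi> \<bullet> i"
        using tendsto_add[OF tendsto_const, of _ 0] elim(2) i by force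
    qed auto
    then have "grad x = \<xi>" unfolding grad_def by (simp add: euclidean_representation)
    then show ?case using \<xi> by simp
  qed
qed

end

section \<open>Lower bounds for mixed measures\<close>

lemma ennreal_add_le_imp:
  assumes "ennreal a + c \<le> ennreal b" "a \<ge> 0" "b \<ge> 0"
  shows "c \<le> ennreal (b - a)"
proof -
  have "c < top" using le_less_trans[OF assms(1) ennreal_less_top] by (simp add: less_top[symmetric])
  then obtain r where "c = ennreal r" "r \<ge> 0" by (cases c) auto
  then show ?thesis using assms by (simp flip: ennreal_plus)
qed

lemma zero_in_symmetric_segment: "0 \<in> closed_segment (- \<theta>) (\<theta> :: 'a::real_vector)"
  by (auto simp: closed_segment_def intro!: exI[of _ "1/2"])

lemma convex_body_origin_msum:
  fixes K :: "'a::euclidean_space set"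
  assumes K: "convex_body_origin K" and C: "compact C" "convex C" "0 \<in> C"
  shows "convex_body_origin (msum K (sdil h C))"
proof -
  interpret convex_body_origin K by fact
  have "K \<subseteq> msum K (sdil h C)" using C(3) by (force simp: msum_def sdil_def)
  then have "0 \<in> interior (msum K (sdil h C))" using zero_interior interior_mono by blast
  moreover have "convex (msum K (sdil h C))"
  proof -
    have "msum K (sdil h C) = (\<Union>x\<in>K. \<Union>y\<in>sdil h C. {x + y})" by (auto simp: msum_def)
    then show ?thesis using convex_sums[OF convex_A, of "sdil h C"] convex_scaling[OF C(2), of h] by (simp add: sdil_def)
  qed
  ultimately show ?thesis
    using compact_msum[OF compact_A compact_sdil[OF C(1)]] by unfold_locales
qed

context convex_body_origin
begin

lemma gauge_msum_le:
  assumes "convex_body_origin (msum A (sdil h C))" "0 \<in> C"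
  shows "mgauge (msum A (sdil h C)) x \<le> mgauge A x"
proof -
  interpret S: convex_body_origin "msum A (sdil h C)" by fact
  have "A \<subseteq> msum A (sdil h C)" using assms(2) by (force simp: msum_def sdil_def)
  then have "sdil t A \<subseteq> sdil t (msum A (sdil h C))" for t by (auto simp: sdil_def)
  then show ?thesis by (intro S.gauge_leI gauge_nonneg) (auto simp: gauge_le_iff)
qed

text \<open>A subgradient is at most 1 on \<open>A\<close> and at most its norm on the unit ball,
  hence at most \<open>1 + \<eta> * norm \<xi>\<close> on the sum body.\<close>

lemma gauge_le_gauge_msum_ball:
  assumes sub: "subgradient x \<xi>" and \<eta>: "\<eta> > 0"
  shows "mgauge A x \<le> mgauge (msum A (sdil \<eta> (cball 0 1))) x * (1 + \<eta> * norm \<xi>)"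
proof -
  interpret S: convex_body_origin "msum A (sdil \<eta> (cball 0 1))"
    by (intro convex_body_origin_msum) (unfold_locales, auto)
  show ?thesis
  proof (cases "x = 0")
    case False
    define t where "t = mgauge (msum A (sdil \<eta> (cball 0 1))) x"
    have t: "t > 0" unfolding t_def by (rule S.gauge_pos[OF False])
    then have "x \<in> sdil t (msum A (sdil \<eta> (cball 0 1)))" using S.gauge_le_iff[of t x] by (simp add: t_def)
    then obtain k b where kb: "k \<in> A" "norm b \<le> 1" "x = t *\<^sub>R (k + \<eta> *\<^sub>R b)"
      by (auto simp: sdil_def msum_def)
    have "mgauge A x = \<xi> \<bullet> x" using sub by (simp add: subgradient_def)
    also have "\<dots> = t * (\<xi> \<bullet> k + \<eta> * (\<xi> \<bullet> b))" by (simp add: kb(3) inner_simps)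
    also have "\<dots> \<le> t * (1 + \<eta> * norm \<xi>)"
    proof (intro mult_left_mono add_mono)
      show "\<xi> \<bullet> k \<le> 1" using sub kb(1) unfolding subgradient_def mem_iff_gauge by (meson order_trans)
      have "\<xi> \<bullet> b \<le> norm \<xi> * norm b" by (rule norm_cauchy_schwarz)
      also have "\<dots> \<le> norm \<xi> * 1" using kb by (intro mult_left_mono) auto
      finally show "\<xi> \<bullet> b \<le> norm \<xi>" by simp
    qed (use t \<eta> in auto)
    finally show ?thesis by (simp add: t_def)
  qed (simp add: gauge_zero S.gauge_zero)
qed

lemma msum_ball_subset:
  assumes "r > 0" "cball 0 r \<subseteq> A" "\<eta> > 0"
  shows "msum A (sdil \<eta> (cball 0 1)) \<subseteq> sdil (1 + \<eta> / r) A"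
proof
  fix x assume "x \<in> msum A (sdil \<eta> (cball 0 1))"
  then obtain k b where kb: "k \<in> A" "norm b \<le> 1" "x = k + \<eta> *\<^sub>R b" by (auto simp: sdil_def msum_def)
  have "mgauge A x \<le> mgauge A k + mgauge A (\<eta> *\<^sub>R b)" unfolding kb(3) by (rule gauge_add)
  also have "\<dots> \<le> 1 + norm (\<eta> *\<^sub>R b) / r"
    using kb(1) by (intro add_mono gauge_le_norm[OF assms(1,2)]) (simp add: mem_iff_gauge)
  also have "\<dots> \<le> 1 + \<eta> / r" using kb(2) assms by (simp add: divide_right_mono mult_left_le)
  finally show "x \<in> sdil (1 + \<eta> / r) A" using assms by (subst gauge_le_iff[symmetric]) (auto intro: add_pos_pos)
qed

lemma second_diff_minus: "second_diff (- v) k x = second_diff v k x"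
  by (simp add: second_diff_def)

text \<open>Moving \<open>x\<close> by \<open>l \<phi>(x) h\<close> along \<open>\<plusminus>\<theta>\<close> with \<open>l < 1\<close> lowers \<open>\<phi>\<close>, and the sum body absorbs the step as
  long as \<open>\<phi>\<close> stays above \<open>l \<phi>(x)\<close>.\<close>

lemma eventually_gauge_msum_segment:
  assumes sub: "subgradient x \<xi>" and x: "x \<noteq> 0" and sd: "(\<lambda>k. second_diff \<theta> k x) \<longlonglongrightarrow> 0"
    and y: "y < mgauge A x * \<bar>\<xi> \<bullet> \<theta>\<bar>"
  shows "\<forall>\<^sub>F h in at_right 0. y < (mgauge A x - mgauge (msum A (sdil h (closed_segment (- \<theta>) \<theta>))) x) / h"
proof -
  define b where "b = \<bar>\<xi> \<bullet> \<theta>\<bar>"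
  \<comment> \<open>The sign is chosen so that \<open>v\<close> is a direction of descent, with
    slope \<open>- b\<close>.\<close>
  define v where "v = (if \<xi> \<bullet> \<theta> \<ge> 0 then - \<theta> else \<theta>)"
  have v: "\<xi> \<bullet> v = - b" "\<And>k. second_diff v k x = second_diff \<theta> k x"
    by (auto simp: v_def b_def second_diff_minus)
  let ?\<phi> = "mgauge A x"
  have \<phi>: "?\<phi> > 0" by (rule gauge_pos[OF x])
  have "((\<lambda>l. l * (?\<phi> * b)) \<longlongrightarrow> 1 * (?\<phi> * b)) (at_left 1)" by (intro tendsto_intros)
  then have "\<forall>\<^sub>F l in at_left 1. y < l * (?\<phi> * b)" using y by (intro order_tendstoD) (auto simp: b_def)
  moreover have "\<forall>\<^sub>F l in at_left (1::real). l \<in> {0<..<1}" by (intro eventually_at_leftI[of 0]) auto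
  ultimately have "\<forall>\<^sub>F l in at_left 1. y < l * (?\<phi> * b) \<and> l \<in> {0<..<1}" by eventually_elim simp
  then obtain l where l: "y < l * (?\<phi> * b)" "0 < l" "l < 1"
    using eventually_happens'[OF trivial_limit_at_left_real] by fastforce
  have "(\<lambda>k. l * (?\<phi> * (b - second_diff \<theta> k x))) \<longlonglongrightarrow> l * (?\<phi> * (b - 0))" by (intro tendsto_intros sd)
  then have "\<forall>\<^sub>F k in sequentially. y < l * (?\<phi> * (b - second_diff \<theta> k x))" using l by (intro order_tendstoD) auto
  then obtain k where k: "y < l * (?\<phi> * (b - second_diff \<theta> k x))"
    using eventually_happens'[OF sequentially_bot] by auto
  have "((\<lambda>h. l * ?\<phi> * h) \<longlongrightarrow> l * ?\<phi> * 0) (at_right 0)" by (intro tendsto_intros)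
  then have ev1: "\<forall>\<^sub>F h in at_right 0. l * ?\<phi> * h < 1 / real (Suc k)" by (intro order_tendstoD) auto
  have "((\<lambda>h. y * h) \<longlongrightarrow> y * 0) (at_right 0)" by (intro tendsto_intros)
  then have ev2: "\<forall>\<^sub>F h in at_right 0. y * h < (1 - l) * ?\<phi>" using l \<phi> by (intro order_tendstoD) auto
  have ev3: "\<forall>\<^sub>F h in at_right (0::real). 0 < h" by (rule eventually_at_right_less)
  show ?thesis using ev1 ev2 ev3
  proof eventually_elim
    case (elim h)
    let ?S = "msum A (sdil h (closed_segment (- \<theta>) \<theta>))"
    interpret S: convex_body_origin ?S
      by (intro convex_body_origin_msum zero_in_symmetric_segment) (unfold_locales, auto)
    define \<tau> where "\<tau> = l * ?\<phi> * h"
    have \<tau>: "\<tau> > 0" using l \<phi> elim by (simp add: \<tau>_def)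
    have dir: "mgauge A (x + \<tau> *\<^sub>R v) - ?\<phi> \<le> \<tau> * (- b + second_diff \<theta> k x)"
      using gauge_directional_le[OF sub \<tau>, of k v] elim(1) v by (simp add: \<tau>_def)
    \<comment> \<open>If the second term is the maximum, the drop of the gauge is
      \<open>(1 - l) * ?\<phi>\<close>, which \<open>ev2\<close> keeps above \<open>y * h\<close>;
      this is the room that \<open>l < 1\<close> provides.\<close>
    define t where "t = max (mgauge A (x + \<tau> *\<^sub>R v)) (l * ?\<phi>)"
    have t: "t > 0" "l * ?\<phi> \<le> t" "mgauge A (x + \<tau> *\<^sub>R v) \<le> t"
      using l \<phi> by (auto simp: t_def less_max_iff_disj)
    have "x \<in> sdil t ?S"
    proof -
      have 1: "(1 / t) *\<^sub>R (x + \<tau> *\<^sub>R v) \<in> A" using t by (simp add: gauge_le_iff mem_sdil)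
      \<comment> \<open>After division by \<open>t\<close>, the way back to \<open>x\<close> is
        \<open>\<tau> / t = h * (l * ?\<phi> / t)\<close> times \<open>- v\<close>. As
        \<open>t\<close> is at least \<open>l * ?\<phi>\<close>, it stays within \<open>h\<close>
        times the segment.\<close>
      define c where "c = (if \<xi> \<bullet> \<theta> \<ge> 0 then 1 else -1) * (l * ?\<phi> / t)"
      have c: "-1 \<le> c" "c \<le> 1" "(l * ?\<phi> / t) *\<^sub>R (- v) = c *\<^sub>R \<theta>"
      proof -
        have "0 \<le> l * ?\<phi> / t" "l * ?\<phi> / t \<le> 1" using t l \<phi> by auto
        then show "-1 \<le> c" "c \<le> 1" by (auto simp: c_def)
        show "(l * ?\<phi> / t) *\<^sub>R (- v) = c *\<^sub>R \<theta>" by (simp add: c_def v_def)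
      qed
      have "c *\<^sub>R \<theta> = (1 - (1 + c) / 2) *\<^sub>R (- \<theta>) + ((1 + c) / 2) *\<^sub>R \<theta>"
      proof -
        have "(1 - (1 + c) / 2) *\<^sub>R (- \<theta>) + ((1 + c) / 2) *\<^sub>R \<theta> = (- (1 - (1 + c) / 2) + (1 + c) / 2) *\<^sub>R \<theta>"
          by (simp only: scaleR_minus_right scaleR_minus_left scaleR_add_left)
        also have "- (1 - (1 + c) / 2) + (1 + c) / 2 = c" by (simp add: field_simps)
        finally show ?thesis by simp
      qed
      then have 2: "c *\<^sub>R \<theta> \<in> closed_segment (- \<theta>) \<theta>"
        unfolding closed_segment_def using c(1,2) by (intro CollectI exI[of _ "(1 + c) / 2"]) auto
      have "(1 / t) *\<^sub>R x = (1 / t) *\<^sub>R (x + \<tau> *\<^sub>R v) + h *\<^sub>R (c *\<^sub>R \<theta>)"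
        unfolding c(3)[symmetric] by (simp add: scaleR_add_right \<tau>_def mult.commute)
      then have "(1 / t) *\<^sub>R x \<in> ?S" using 1 2 unfolding msum_def sdil_def by blast
      then show ?thesis using t by (simp add: S.mem_sdil)
    qed
    then have "mgauge ?S x \<le> t" using t by (simp add: S.gauge_le_iff)
    moreover have "y * h < ?\<phi> - t"
    proof -
      have "y * h < \<tau> * (b - second_diff \<theta> k x)"
        using mult_strict_right_mono[OF k elim(3)] by (simp add: \<tau>_def mult_ac)
      also have "\<dots> \<le> ?\<phi> - mgauge A (x + \<tau> *\<^sub>R v)" using dir by (simp add: algebra_simps)
      finally show ?thesis using elim(2) by (auto simp: t_def max_def algebra_simps)
    qed
    ultimately have "y * h < ?\<phi> - mgauge ?S x" by linarith
    then show ?case using elim(3) by (simp add: less_divide_eq)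
  qed
qed

end

section \<open>Volume integrals of the gradient and their bounds\<close>

locale measure_and_body = homogeneous_density g p + convex_body_origin K
  for g :: "'a::euclidean_space \<Rightarrow> real" and p :: real and K :: "'a set"
begin

lemma ennreal_mu_gauge:
  assumes "convex_body_origin A"
  shows "ennreal (mu g A) = ennreal (d + 1) * (\<integral>\<^sup>+x. ennreal (g x) * ennreal (1 - mgauge A x) \<partial>lborel)"
proof -
  interpret A: convex_body_origin A by fact
  have "A \<in> sets borel" "bounded A" using A.compact_A by (auto simp: borel_compact compact_imp_bounded)
  then have "ennreal (mu g A) = (\<integral>\<^sup>+x. ennreal (g x) * indicator A x \<partial>lborel)" by (rule ennreal_mu)
  also have "\<dots> = ennreal (d + 1) * (\<integral>\<^sup>+x. ennreal (g x) * ennreal (1 - mgauge A x) \<partial>lborel)"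
    unfolding d_def using \<open>A \<in> sets borel\<close> A.sdil_eq_gauge A.gauge_nonneg p
    by (intro nn_integral_homogeneous_gauge) (auto simp: ennreal_g_scaleR intro!: add_pos_pos)
  finally show ?thesis .
qed

lemma K_borel [measurable]: "K \<in> sets borel" using compact_A by (rule borel_compact)

lemma K_bounded: "bounded K" using compact_A by (rule compact_imp_bounded)

text \<open>By the coarea formula \<open>grad_mass K\<close> is 1/(d + 1) times the integral of
  \<open>g\<close> over the boundary of \<open>K\<close>. The domain is a parameter because the
  lower bound is first obtained on slightly larger dilates of \<open>K\<close>.\<close>

definition grad_mass :: "'a set \<Rightarrow> ennreal" where
  "grad_mass S = (\<integral>\<^sup>+x. ennreal (g x * (mgauge K x * norm (grad x))) * indicator S x \<partial>lborel)"

text \<open>The gauges of \<open>K\<close> and of the sum body differ by at most \<eta> \<phi>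
  |\<xi>| wherever the latter is below 1, so the increment in Minkowski's inequality bounds the
  gradient mass. Such points may lie outside \<open>K\<close>, whence the dilate on the
  right.\<close>

lemma grad_mass_dilate_lower:
  assumes \<eta>: "\<eta> > 0" and r: "r > 0" "cball 0 r \<subseteq> K" and B: "mu g (cball 0 1) > 0" and muK: "mu g K > 0"
  shows "ennreal (d / (d + 1) * (mu g K powr (1 - 1 / d) * mu g (cball 0 1) powr (1 / d))) \<le> grad_mass (sdil (1 + \<eta> / r) K)"
proof -
  define s where "s = 1 + \<eta> / r"
  have s: "s > 1" using \<eta> r by (simp add: s_def)
  have [measurable]: "sdil s K \<in> sets borel" using s by (intro sets_sdil) auto
  let ?A = "msum K (sdil \<eta> (cball 0 1))"
  let ?c = "mu g K powr (1 - 1 / d) * mu g (cball 0 1) powr (1 / d)"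
  have A: "convex_body_origin ?A" by (intro convex_body_origin_msum) (unfold_locales, auto)
  interpret A: convex_body_origin ?A by (rule A)
  have "(\<integral>\<^sup>+x. ennreal (g x) * ennreal (1 - mgauge ?A x) \<partial>lborel)
     \<le> (\<integral>\<^sup>+x. ennreal (g x) * ennreal (1 - mgauge K x) + ennreal \<eta> * (ennreal (g x * (mgauge K x * norm (grad x))) * indicator (sdil s K) x) \<partial>lborel)"
  proof (intro nn_integral_mono_AE, use AE_grad in eventually_elim)
    case (elim x)
    show ?case
    proof (cases "mgauge ?A x < 1")
      case True
      then have "x \<in> sdil s K" using msum_ball_subset[OF r \<eta>] A.mem_iff_gauge[of x] by (auto simp: s_def)
      have le: "mgauge ?A x \<le> mgauge K x" by (rule gauge_msum_le[OF A]) simp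
      have "mgauge K x \<le> mgauge ?A x * (1 + \<eta> * norm (grad x))" by (rule gauge_le_gauge_msum_ball[OF elim \<eta>])
      then have "mgauge K x - mgauge ?A x \<le> mgauge ?A x * (\<eta> * norm (grad x))" by (simp add: algebra_simps)
      also have "\<dots> \<le> mgauge K x * (\<eta> * norm (grad x))" using le \<eta> by (intro mult_right_mono) auto
      \<comment> \<open>Outside \<open>K\<close> the term \<open>1 - mgauge K x\<close> is negative;
        its positive part is what \<open>ennreal\<close> keeps.\<close>
      finally have "1 - mgauge ?A x \<le> max 0 (1 - mgauge K x) + \<eta> * (mgauge K x * norm (grad x))" by (simp add: mult_ac max_def)
      then have "g x * (1 - mgauge ?A x) \<le> g x * (max 0 (1 - mgauge K x) + \<eta> * (mgauge K x * norm (grad x)))"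
        by (intro mult_left_mono g_nonneg)
      then have "ennreal (g x * (1 - mgauge ?A x)) \<le> ennreal (g x * max 0 (1 - mgauge K x) + \<eta> * (g x * (mgauge K x * norm (grad x))))"
        by (intro ennreal_leI) (simp add: algebra_simps)
      also have "\<dots> = ennreal (g x) * ennreal (1 - mgauge K x) + ennreal \<eta> * ennreal (g x * (mgauge K x * norm (grad x)))"
      proof -
        have "ennreal (max 0 z) = ennreal z" for z by (simp add: max_def ennreal_neg)
        then have "ennreal (g x * max 0 (1 - mgauge K x)) = ennreal (g x) * ennreal (1 - mgauge K x)"
          by (simp add: ennreal_mult' g_nonneg)
        moreover have "ennreal (\<eta> * (g x * (mgauge K x * norm (grad x)))) = ennreal \<eta> * ennreal (g x * (mgauge K x * norm (grad x)))"
          using \<eta> by (intro ennreal_mult') simp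
        ultimately show ?thesis using \<eta> g_nonneg gauge_nonneg by (subst ennreal_plus) auto
      qed
      finally show ?thesis using \<open>x \<in> sdil s K\<close> by (simp add: ennreal_mult' g_nonneg)
    qed (simp add: ennreal_neg)
  qed
  also have "\<dots> = (\<integral>\<^sup>+x. ennreal (g x) * ennreal (1 - mgauge K x) \<partial>lborel) + ennreal \<eta> * grad_mass (sdil s K)"
    unfolding grad_mass_def by (subst nn_integral_add) (auto simp: nn_integral_cmult)
  finally have "ennreal (d + 1) * (\<integral>\<^sup>+x. ennreal (g x) * ennreal (1 - mgauge ?A x) \<partial>lborel)
     \<le> ennreal (d + 1) * ((\<integral>\<^sup>+x. ennreal (g x) * ennreal (1 - mgauge K x) \<partial>lborel) + ennreal \<eta> * grad_mass (sdil s K))"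
    by (intro mult_left_mono) auto
  then have le: "ennreal (mu g ?A) \<le> ennreal (mu g K) + ennreal (d + 1) * (ennreal \<eta> * grad_mass (sdil s K))"
    using ennreal_mu_gauge[OF A] ennreal_mu_gauge[of K] convex_body_origin_axioms by (simp add: distrib_left)
  show ?thesis
  proof (cases "grad_mass (sdil s K)")
    case (real m)
    have "ennreal ((d + 1) * (\<eta> * m)) = ennreal (d + 1) * (ennreal \<eta> * ennreal m)"
      using \<eta> d_gt_1 by (simp add: ennreal_mult')
    then have "ennreal (mu g ?A) \<le> ennreal (mu g K + (d + 1) * (\<eta> * m))"
      using le real \<eta> d_gt_1 mu_nonneg by (subst ennreal_plus) auto
    then have "mu g ?A \<le> mu g K + (d + 1) * (\<eta> * m)"
      using real \<eta> d_gt_1 mu_nonneg[of K] by (subst (asm) ennreal_le_iff) auto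
    moreover have "\<eta> * d * ?c \<le> mu g ?A - mu g K"
      by (rule mu_minkowski_first[OF compact_A muK B \<eta>])
    ultimately have "\<eta> * (d * ?c) \<le> \<eta> * ((d + 1) * m)" by (simp add: algebra_simps)
    then have "d * ?c \<le> (d + 1) * m" using \<eta> by (simp only: mult_le_cancel_left_pos)
    then have "d / (d + 1) * ?c \<le> m" using d_gt_1 by (simp add: divide_le_eq mult_ac)
    then show ?thesis using real by (simp add: s_def[symmetric] ennreal_leI)
  qed (simp add: s_def)
qed

text \<open>On the shell between \<open>K\<close> and its dilate the gradient has norm at most
  \<open>1 / r\<close> and the gauge is at most \<open>s\<close>; by homogeneity the shell has
  measure \<open>(s powr d - 1) * mu g K\<close>.\<close>

lemma grad_mass_dilate_upper:
  assumes s: "s > 1" and r: "r > 0" "cball 0 r \<subseteq> K"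
  shows "grad_mass (sdil s K) \<le> grad_mass K + ennreal (s / r * (s powr d - 1) * mu g K)"
proof -
  have [measurable]: "sdil s K \<in> sets borel" using s by (intro sets_sdil) auto
  have KS: "K \<subseteq> sdil s K" using sdil_mono[of 1 s] s by (simp add: sdil_def)
  have bS: "bounded (sdil s K)" using compact_sdil[OF compact_A] by (rule compact_imp_bounded)
  have "grad_mass (sdil s K) \<le> (\<integral>\<^sup>+x. ennreal (g x * (mgauge K x * norm (grad x))) * indicator K x
      + ennreal (s / r) * (ennreal (g x) * indicator (sdil s K - K) x) \<partial>lborel)"
    unfolding grad_mass_def
  proof (intro nn_integral_mono_AE, use AE_grad in eventually_elim)
    case (elim x)
    have n: "norm (grad x) \<le> 1 / r" by (rule subgradient_norm_le[OF elim r])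
    show ?case
    proof (cases "x \<in> sdil s K - K")
      case True
      then have "mgauge K x \<le> s" using s by (simp add: gauge_le_iff)
      then have "mgauge K x * norm (grad x) \<le> s * (1 / r)" using n s gauge_nonneg by (intro mult_mono) auto
      then have "g x * (mgauge K x * norm (grad x)) \<le> g x * (s / r)" by (intro mult_left_mono g_nonneg) simp
      then have "ennreal (g x * (mgauge K x * norm (grad x))) \<le> ennreal (s / r) * ennreal (g x)"
        using s r g_nonneg by (simp add: mult.commute flip: ennreal_mult')
      then show ?thesis using True by simp
    next
      case False
      then show ?thesis using KS by (auto simp: indicator_def)
    qed
  qed
  also have "\<dots> = grad_mass K + ennreal (s / r) * (\<integral>\<^sup>+x. ennreal (g x) * indicator (sdil s K - K) x \<partial>lborel)"
    unfolding grad_mass_def by (subst nn_integral_add) (auto simp: nn_integral_cmult)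
  also have "(\<integral>\<^sup>+x. ennreal (g x) * indicator (sdil s K - K) x \<partial>lborel) \<le> ennreal ((s powr d - 1) * mu g K)"
  proof -
    have "ennreal (mu g K) + (\<integral>\<^sup>+x. ennreal (g x) * indicator (sdil s K - K) x \<partial>lborel)
       = (\<integral>\<^sup>+x. ennreal (g x) * indicator K x + ennreal (g x) * indicator (sdil s K - K) x \<partial>lborel)"
      using K_bounded by (subst nn_integral_add) (auto simp: ennreal_mu)
    also have "\<dots> = (\<integral>\<^sup>+x. ennreal (g x) * indicator (sdil s K) x \<partial>lborel)"
      using KS by (intro nn_integral_cong) (auto simp: indicator_def)
    also have "\<dots> = ennreal (mu g (sdil s K))" using bS by (intro ennreal_mu[symmetric]) auto
    finally have "(\<integral>\<^sup>+x. ennreal (g x) * indicator (sdil s K - K) x \<partial>lborel) \<le> ennreal (mu g (sdil s K) - mu g K)"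
      by (intro ennreal_add_le_imp) (auto simp: mu_nonneg)
    then show ?thesis using s K_bounded by (simp add: mu_sdil algebra_simps)
  qed
  also have "ennreal (s / r) * ennreal ((s powr d - 1) * mu g K) = ennreal (s / r * (s powr d - 1) * mu g K)"
    using s r unfolding mult.assoc by (intro ennreal_mult'[symmetric]) simp
  finally show ?thesis by (simp add: add_left_mono mult_left_mono)
qed

lemma grad_mass_lower:
  assumes B: "mu g (cball 0 1) > 0" and muK: "mu g K > 0"
  shows "ennreal (d / (d + 1) * (mu g K powr (1 - 1 / d) * mu g (cball 0 1) powr (1 / d))) \<le> grad_mass K"
proof (rule ennreal_le_epsilon)
  obtain r where r: "r > 0" "cball 0 r \<subseteq> K" by (rule inner_ball)
  fix e :: real assume e: "e > 0"
  have "((\<lambda>s. s / r * (s powr d - 1) * mu g K) \<longlongrightarrow> 1 / r * (1 powr d - 1) * mu g K) (at_right 1)"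
    using r by (intro tendsto_intros) auto
  then have "\<forall>\<^sub>F s in at_right 1. s / r * (s powr d - 1) * mu g K < e" using e by (intro order_tendstoD) auto
  moreover have "\<forall>\<^sub>F s in at_right (1::real). 1 < s" by (rule eventually_at_right_less)
  ultimately have "\<forall>\<^sub>F s in at_right 1. s / r * (s powr d - 1) * mu g K < e \<and> 1 < s" by eventually_elim simp
  then obtain s where s: "s / r * (s powr d - 1) * mu g K < e" "1 < s"
    using eventually_happens'[OF trivial_limit_at_right_real] by fastforce
  \<comment> \<open>With \<open>\<eta> = (s - 1) * r\<close> the dilation factor in the lower bound
    becomes \<open>s\<close>.\<close>
  have "1 + ((s - 1) * r) / r = s" using r by simp
  then have "ennreal (d / (d + 1) * (mu g K powr (1 - 1 / d) * mu g (cball 0 1) powr (1 / d))) \<le> grad_mass (sdil s K)"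
    using grad_mass_dilate_lower[of "(s - 1) * r" r] s r B muK by simp
  also have "\<dots> \<le> grad_mass K + ennreal (s / r * (s powr d - 1) * mu g K)"
    by (rule grad_mass_dilate_upper[OF s(2) r])
  also have "\<dots> \<le> grad_mass K + ennreal e" using s(1) by (intro add_left_mono ennreal_leI) auto
  finally show "ennreal (d / (d + 1) * (mu g K powr (1 - 1 / d) * mu g (cball 0 1) powr (1 / d))) \<le> grad_mass K + ennreal e" .
qed

text \<open>By the coarea formula this is 1/(d + 1) times the integral of g |\<nu> \<bullet>
  \<theta>| over the boundary of \<open>K\<close>, with \<nu> the unit normal.\<close>

definition dir_mass :: "'a \<Rightarrow> ennreal" where
  "dir_mass \<theta> = (\<integral>\<^sup>+x. ennreal (g x * (mgauge K x * \<bar>grad x \<bullet> \<theta>\<bar>)) * indicator K x \<partial>lborel)"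

text \<open>What is gained outside \<open>K\<close> is dropped. Inside \<open>K\<close> both gauges
  are at most 1, so the truncations by \<open>ennreal\<close> are inactive and the difference of the
  two layer formulas is exact.\<close>

lemma mu_segment_increment:
  assumes h: "h > 0" and A: "A = msum K (sdil h (closed_segment (- \<theta>) \<theta>))"
  shows "ennreal (d + 1) * (\<integral>\<^sup>+x. ennreal (g x * ((mgauge K x - mgauge A x) / h)) * indicator K x \<partial>lborel)
      \<le> ennreal ((mu g A - mu g K) / h)"
proof -
  note seg0 = zero_in_symmetric_segment[of \<theta>]
  have cA: "convex_body_origin A" unfolding A
    by (intro convex_body_origin_msum seg0) (unfold_locales, auto)
  interpret A: convex_body_origin A by (rule cA)
  let ?Z = "\<integral>\<^sup>+x. ennreal (g x * ((mgauge K x - mgauge A x) / h)) * indicator K x \<partial>lborel"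
  have le: "mgauge A x \<le> mgauge K x" for x unfolding A by (rule gauge_msum_le[OF cA[unfolded A] seg0])
  have "(\<integral>\<^sup>+x. ennreal (g x) * ennreal (1 - mgauge K x) \<partial>lborel) + ennreal h * ?Z
     = (\<integral>\<^sup>+x. ennreal (g x) * ennreal (1 - mgauge K x) + ennreal h * (ennreal (g x * ((mgauge K x - mgauge A x) / h)) * indicator K x) \<partial>lborel)"
    by (subst nn_integral_add) (auto simp: nn_integral_cmult)
  also have "\<dots> \<le> (\<integral>\<^sup>+x. ennreal (g x) * ennreal (1 - mgauge A x) \<partial>lborel)"
  proof (rule nn_integral_mono)
    fix x
    show "ennreal (g x) * ennreal (1 - mgauge K x) + ennreal h * (ennreal (g x * ((mgauge K x - mgauge A x) / h)) * indicator K x)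
        \<le> ennreal (g x) * ennreal (1 - mgauge A x)"
    proof (cases "x \<in> K")
      case True
      then have 1: "mgauge K x \<le> 1" by (simp add: mem_iff_gauge)
      have "ennreal (g x) * ennreal (1 - mgauge K x) + ennreal h * ennreal (g x * ((mgauge K x - mgauge A x) / h))
         = ennreal (g x * (1 - mgauge K x) + h * (g x * ((mgauge K x - mgauge A x) / h)))"
      proof -
        have "ennreal h * ennreal (g x * ((mgauge K x - mgauge A x) / h)) = ennreal (h * (g x * ((mgauge K x - mgauge A x) / h)))"
          using h by (intro ennreal_mult'[symmetric]) simp
        moreover have "ennreal (g x) * ennreal (1 - mgauge K x) = ennreal (g x * (1 - mgauge K x))"
          by (intro ennreal_mult'[symmetric] g_nonneg)
        ultimately show ?thesis using 1 le[of x] h g_nonneg by (subst ennreal_plus) auto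
      qed
      also have "g x * (1 - mgauge K x) + h * (g x * ((mgauge K x - mgauge A x) / h)) = g x * (1 - mgauge A x)"
      proof -
        have "h * (g x * ((mgauge K x - mgauge A x) / h)) = g x * (mgauge K x - mgauge A x)" using h by simp
        then show ?thesis by (simp only:) (simp add: algebra_simps)
      qed
      finally show ?thesis using True by (simp add: ennreal_mult' g_nonneg)
    next
      case False
      then show ?thesis by (simp add: mem_iff_gauge ennreal_neg)
    qed
  qed
  finally have "ennreal (d + 1) * ((\<integral>\<^sup>+x. ennreal (g x) * ennreal (1 - mgauge K x) \<partial>lborel) + ennreal h * ?Z)
     \<le> ennreal (d + 1) * (\<integral>\<^sup>+x. ennreal (g x) * ennreal (1 - mgauge A x) \<partial>lborel)"
    by (intro mult_left_mono) auto
  then have "ennreal (mu g K) + ennreal (d + 1) * (ennreal h * ?Z) \<le> ennreal (mu g A)"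
    using ennreal_mu_gauge[OF cA] ennreal_mu_gauge[of K] convex_body_origin_axioms by (simp add: distrib_left)
  then have "ennreal (d + 1) * (ennreal h * ?Z) \<le> ennreal (mu g A - mu g K)"
    by (intro ennreal_add_le_imp) (auto simp: mu_nonneg)
  then have "ennreal (1 / h) * (ennreal (d + 1) * (ennreal h * ?Z)) \<le> ennreal (1 / h) * ennreal (mu g A - mu g K)"
    by (intro mult_left_mono) auto
  moreover have "ennreal (1 / h) * (ennreal (d + 1) * (ennreal h * ?Z)) = ennreal (d + 1) * ?Z"
  proof -
    have "ennreal (1 / h) * ennreal h = 1" using h by (simp flip: ennreal_mult')
    moreover have "ennreal (1 / h) * (ennreal (d + 1) * (ennreal h * ?Z)) = (ennreal (1 / h) * ennreal h) * (ennreal (d + 1) * ?Z)"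
      by (simp only: mult_ac)
    ultimately show ?thesis by simp
  qed
  ultimately show ?thesis using h by (simp flip: ennreal_mult')
qed

text \<open>Dilation reduces the sum of \<open>t K\<close> and \<open>e S\<close> to the
  \<open>t\<close>-fold of the sum of \<open>K\<close> and \<open>(e / t) S\<close>, which accounts
  for the power of \<open>t\<close>; Fatou's lemma then carries the pointwise lower bound for the
  gauge quotients over to the measures.\<close>

lemma mixed_mu_lower:
  assumes t: "t > 0"
  shows "ennreal (t powr (d - 1) * (d + 1)) * dir_mass \<theta> \<le> mixed_mu g (sdil t K) (closed_segment (- \<theta>) \<theta>)"
  unfolding mixed_mu_def le_Liminf_iff
proof (intro allI impI)
  let ?S = "closed_segment (- \<theta>) \<theta>"
  let ?F = "\<lambda>e. ennreal ((mu g (msum (sdil t K) (sdil e ?S)) - mu g (sdil t K)) / e)"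
  let ?X = "ennreal (t powr (d - 1) * (d + 1)) * dir_mass \<theta>"
  let ?\<psi> = "\<lambda>h. mgauge (msum K (sdil h ?S))"
  note seg0 = zero_in_symmetric_segment[of \<theta>]
  fix y assume y: "y < ?X"
  show "\<forall>\<^sub>F e in at_right 0. y < ?F e"
  \<comment> \<open>Fatou's lemma is about sequences, so the one-sided liminf is tested along
    positive sequences tending to zero.\<close>
  proof (rule sequentially_imp_eventually_at_right[of 0 1])
    fix e :: "nat \<Rightarrow> real" assume e: "\<And>n. 0 < e n" "e \<longlonglongrightarrow> 0"
    define h where "h n = e n / t" for n
    have h: "h n > 0" for n using e t by (simp add: h_def)
    have h0: "h \<longlonglongrightarrow> 0" unfolding h_def using tendsto_divide[OF e(2) tendsto_const, of t] t by simp
    have body: "convex_body_origin (msum K (sdil (h n) ?S))" for n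
      by (intro convex_body_origin_msum seg0) (unfold_locales, auto)
    define u where "u n x = ennreal (t powr (d - 1) * (d + 1)) * (ennreal (g x * ((mgauge K x - ?\<psi> (h n) x) / h n)) * indicator K x)" for n x
    have [measurable]: "?\<psi> (h n) \<in> borel_measurable borel" for n
      using body by (rule convex_body_origin.gauge_measurable)
    have [measurable]: "u n \<in> borel_measurable borel" for n unfolding u_def by measurable
    have F: "(\<integral>\<^sup>+x. u n x \<partial>lborel) \<le> ?F (e n)" for n
    proof -
      let ?A = "msum K (sdil (h n) ?S)"
      interpret A: convex_body_origin ?A by (rule body)
      have "msum (sdil t K) (sdil (e n) ?S) = sdil t ?A"
        using t by (simp add: sdil_msum sdil_sdil h_def)
      then have "mu g (msum (sdil t K) (sdil (e n) ?S)) = t powr d * mu g ?A"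
        using t A.compact_A by (simp add: mu_sdil borel_compact compact_imp_bounded)
      moreover have "mu g (sdil t K) = t powr d * mu g K" using t K_bounded by (simp add: mu_sdil)
      ultimately have "(mu g (msum (sdil t K) (sdil (e n) ?S)) - mu g (sdil t K)) / e n = t powr (d - 1) * ((mu g ?A - mu g K) / h n)"
        using t e(1)[of n] by (simp add: h_def powr_diff field_simps)
      then have "?F (e n) = ennreal (t powr (d - 1)) * ennreal ((mu g ?A - mu g K) / h n)"
        by (simp only:) (rule ennreal_mult', simp)
      moreover have "(\<integral>\<^sup>+x. u n x \<partial>lborel) = ennreal (t powr (d - 1)) * (ennreal (d + 1) * (\<integral>\<^sup>+x. ennreal (g x * ((mgauge K x - ?\<psi> (h n) x) / h n)) * indicator K x \<partial>lborel))"
        unfolding u_def by (simp add: nn_integral_cmult ennreal_mult' mult.assoc)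
      ultimately show ?thesis
        using mu_segment_increment[OF h refl, of n \<theta>] by (simp add: mult_left_mono)
    qed
    have "?X = (\<integral>\<^sup>+x. ennreal (t powr (d - 1) * (d + 1)) * (ennreal (g x * (mgauge K x * \<bar>grad x \<bullet> \<theta>\<bar>)) * indicator K x) \<partial>lborel)"
      unfolding dir_mass_def by (simp add: nn_integral_cmult)
    also have "\<dots> \<le> (\<integral>\<^sup>+x. liminf (\<lambda>n. u n x) \<partial>lborel)"
    proof (intro nn_integral_mono_AE, use AE_grad AE_second_diff[of \<theta>] AE_lborel_singleton[of "0::'a"] in eventually_elim)
      case (elim x)
      show ?case unfolding le_Liminf_iff
      proof (intro allI impI)
        define b where "b = \<bar>grad x \<bullet> \<theta>\<bar>"
        define C where "C = t powr (d - 1) * (d + 1) * g x * indicator K x"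
        have C: "C \<ge> 0" using d_gt_1 g_nonneg by (simp add: C_def)
        have lhs: "ennreal (t powr (d - 1) * (d + 1)) * (ennreal (g x * (mgauge K x * \<bar>grad x \<bullet> \<theta>\<bar>)) * indicator K x) = ennreal (C * (mgauge K x * b))"
          using d_gt_1 by (auto simp: C_def b_def indicator_def mult.assoc simp flip: ennreal_mult')
        have rhs: "u n x = ennreal (C * ((mgauge K x - ?\<psi> (h n) x) / h n))" for n
          unfolding u_def using d_gt_1 by (auto simp: C_def indicator_def mult.assoc simp flip: ennreal_mult')
        fix z assume z: "z < ennreal (t powr (d - 1) * (d + 1)) * (ennreal (g x * (mgauge K x * \<bar>grad x \<bullet> \<theta>\<bar>)) * indicator K x)"
        then obtain w where w: "z = ennreal w" "w \<ge> 0" unfolding lhs by (cases z) auto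
        then have wC: "w < C * (mgauge K x * b)" using z unfolding lhs by (simp add: ennreal_less_iff)
        then have "C > 0" using C w(2) by (cases "C = 0") auto
        then have "w / C < mgauge K x * b" using wC by (simp add: divide_less_eq mult.commute)
        then have "\<forall>\<^sub>F h in at_right 0. w / C < (mgauge K x - ?\<psi> h x) / h"
          unfolding b_def by (intro eventually_gauge_msum_segment[OF elim(1,3,2)])
        moreover have "filterlim h (at_right 0) sequentially" using h0 h by (intro filterlim_at_withinI) auto
        ultimately have "\<forall>\<^sub>F n in sequentially. w / C < (mgauge K x - ?\<psi> (h n) x) / h n"
          by (rule eventually_compose_filterlim)
        then show "\<forall>\<^sub>F n in sequentially. z < u n x"
        proof eventually_elim
          case (elim n)
          then have "w < C * ((mgauge K x - ?\<psi> (h n) x) / h n)" using \<open>C > 0\<close> by (simp add: divide_less_eq mult.commute)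
          then show ?case using w unfolding rhs by (simp add: ennreal_less_iff)
        qed
      qed
    qed
    also have "\<dots> \<le> liminf (\<lambda>n. \<integral>\<^sup>+x. u n x \<partial>lborel)" by (intro nn_integral_liminf) measurable
    also have "\<dots> \<le> liminf (\<lambda>n. ?F (e n))" by (intro Liminf_mono always_eventually allI F)
    finally have "?X \<le> liminf (\<lambda>n. ?F (e n))" .
    then show "\<forall>\<^sub>F n in sequentially. y < ?F (e n)" using y unfolding le_Liminf_iff by blast
  qed simp
qed

end

section \<open>Rearrangement of the section integral\<close>

lemma liminf_ennreal_cmult:
  fixes c :: ennreal assumes "c < top"
  shows "liminf (\<lambda>n. c * u n) = c * liminf u"
  using assms by (intro Liminf_compose_continuous_mono ennreal_continuous_on_cmult continuous_on_id)
    (auto simp: mono_def mult_left_mono)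

context homogeneous_density
begin

lemma nn_integral_over_norm_ball:
  assumes r: "r > 0"
  shows "(\<integral>\<^sup>+x. ennreal (g x) * ennreal (1 / norm x) * indicator (cball 0 r) x \<partial>lborel)
    = ennreal (d / (d - 1) * (r powr (d - 1) * mu g (cball 0 1)))"
proof -
  let ?f = "\<lambda>x. ennreal (g x) * ennreal (1 / norm x)"
  have hf: "?f (c *\<^sub>R x) = ennreal (c powr (1 / p - 1)) * ?f x" if "c > 0" for c x
  proof -
    have "?f (c *\<^sub>R x) = ennreal (c powr (1 / p) * g x * (1 / (c * norm x)))"
      using that g_nonneg by (simp add: g_scaleR flip: ennreal_mult')
    also have "c powr (1 / p) * g x * (1 / (c * norm x)) = c powr (1 / p - 1) * (g x * (1 / norm x))"
      using that by (simp add: powr_diff)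
    also have "ennreal \<dots> = ennreal (c powr (1 / p - 1)) * ?f x"
      by (simp only: ennreal_mult'[OF powr_ge_zero] ennreal_mult'[OF g_nonneg])
    finally show ?thesis .
  qed
  have "(\<integral>\<^sup>+x. ?f x * indicator (cball 0 r) x \<partial>lborel) = (\<integral>\<^sup>+x. ?f x * indicator (sdil r (cball 0 1)) x \<partial>lborel)"
    using r by (simp add: sdil_cball)
  also have "\<dots> = ennreal (r powr (DIM('a) + (1 / p - 1))) * (\<integral>\<^sup>+x. ?f x * indicator (cball 0 1) x \<partial>lborel)"
    using r hf by (intro nn_integral_sdil_homogeneous) auto
  also have "(\<integral>\<^sup>+x. ?f x * indicator (cball 0 1) x \<partial>lborel) = ennreal (d / (d - 1)) * (\<integral>\<^sup>+x. ennreal (g x) * indicator (cball 0 1) x \<partial>lborel)"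
    unfolding d_def using d_gt_1 by (intro nn_integral_homogeneous_over_norm) (auto simp: ennreal_g_scaleR d_def)
  also have "(\<integral>\<^sup>+x. ennreal (g x) * indicator (cball 0 1) x \<partial>lborel) = ennreal (mu g (cball 0 1))"
    by (rule ennreal_mu[symmetric]) auto
  also have "real DIM('a) + (1 / p - 1) = d - 1" by (simp add: d_def)
  also have "ennreal (r powr (d - 1)) * (ennreal (d / (d - 1)) * ennreal (mu g (cball 0 1)))
     = ennreal (r powr (d - 1) * (d / (d - 1) * mu g (cball 0 1)))"
    using d_gt_1 by (intro ennreal_mult3) auto
  finally show ?thesis by (simp add: mult_ac)
qed

text \<open>The bathtub principle: \<open>1 / norm x\<close> is at least \<open>1 / r\<close> in the
  ball of radius \<open>r\<close> and at most \<open>1 / r\<close> outside, and \<open>r\<close> is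
  chosen to give the ball the measure of \<open>L\<close>.\<close>

lemma nn_integral_over_norm_le:
  assumes L: "compact L" and B: "mu g (cball 0 1) > 0"
  shows "(\<integral>\<^sup>+x. ennreal (g x) * ennreal (1 / norm x) * indicator L x \<partial>lborel)
    \<le> ennreal (d / (d - 1) * (mu g L powr (1 - 1 / d) * mu g (cball 0 1) powr (1 / d)))"
proof (cases "mu g L = 0")
  case True
  have Lb[measurable]: "L \<in> sets borel" using L by (rule borel_compact)
  have "(\<integral>\<^sup>+x. ennreal (g x) * indicator L x \<partial>lborel) = 0"
    using True ennreal_mu[OF Lb compact_imp_bounded[OF L]] by simp
  then have "AE x in lborel. ennreal (g x) * indicator L x = 0" by (subst (asm) nn_integral_0_iff_AE) auto
  then have "AE x in lborel. ennreal (g x) * ennreal (1 / norm x) * indicator L x = 0"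
    by eventually_elim (auto simp: indicator_def split: if_splits)
  then have "(\<integral>\<^sup>+x. ennreal (g x) * ennreal (1 / norm x) * indicator L x \<partial>lborel) = 0"
    by (subst nn_integral_0_iff_AE) auto
  then show ?thesis by simp
next
  case False
  then have mL: "mu g L > 0" using mu_nonneg[of L] by linarith
  have Lb[measurable]: "L \<in> sets borel" using L by (rule borel_compact)
  define r where "r = (mu g L / mu g (cball 0 1)) powr (1 / d)"
  have r: "r > 0" using mL B by (simp add: r_def)
  have rB: "mu g (cball 0 r) = mu g L"
  proof -
    have "mu g (cball 0 r) = mu g (sdil r (cball 0 1))" using r by (simp add: sdil_cball)
    also have "\<dots> = r powr d * mu g (cball 0 1)" using r by (intro mu_sdil) auto
    also have "r powr d = mu g L / mu g (cball 0 1)" using mL B d_gt_1 by (simp add: r_def powr_powr)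
    finally show ?thesis using B by simp
  qed
  let ?Q = "\<lambda>S. \<integral>\<^sup>+x. ennreal (g x) * ennreal (1 / norm x) * indicator S x \<partial>lborel"
  let ?m = "\<lambda>S. \<integral>\<^sup>+x. ennreal (1 / r) * (ennreal (g x) * indicator S x) \<partial>lborel"
  have m: "?m S = ennreal (1 / r * mu g L)" if "S \<in> sets borel" "bounded S" "mu g S = mu g L" for S
    using that r by (simp add: nn_integral_cmult ennreal_mu[symmetric] flip: ennreal_mult')
  \<comment> \<open>The measures times \<open>1 / r\<close> are added crosswise, so that the
    comparison involves no difference of extended reals.\<close>
  have "?Q L + ?m (cball 0 r) = (\<integral>\<^sup>+x. ennreal (g x) * ennreal (1 / norm x) * indicator L x + ennreal (1 / r) * (ennreal (g x) * indicator (cball 0 r) x) \<partial>lborel)"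
    by (rule nn_integral_add[symmetric]) auto
  also have "\<dots> \<le> (\<integral>\<^sup>+x. ennreal (g x) * ennreal (1 / norm x) * indicator (cball 0 r) x + ennreal (1 / r) * (ennreal (g x) * indicator L x) \<partial>lborel)"
  proof (rule nn_integral_mono)
    fix x
    show "ennreal (g x) * ennreal (1 / norm x) * indicator L x + ennreal (1 / r) * (ennreal (g x) * indicator (cball 0 r) x)
       \<le> ennreal (g x) * ennreal (1 / norm x) * indicator (cball 0 r) x + ennreal (1 / r) * (ennreal (g x) * indicator L x)"
    \<comment> \<open>At the origin \<open>1 / norm x\<close> is 0 by convention, which spoils the
      comparison with \<open>1 / r\<close>; but \<open>g\<close> vanishes there.\<close>
    proof (cases "x = 0")
      case False
      have "norm x \<le> r \<Longrightarrow> ennreal (1 / r) * ennreal (g x) \<le> ennreal (g x) * ennreal (1 / norm x)"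
        using False r by (subst mult.commute) (auto intro!: mult_left_mono ennreal_leI divide_left_mono)
      moreover have "\<not> norm x \<le> r \<Longrightarrow> ennreal (g x) * ennreal (1 / norm x) \<le> ennreal (1 / r) * ennreal (g x)"
        using False r by (subst (2) mult.commute) (auto intro!: mult_left_mono ennreal_leI divide_left_mono)
      ultimately show ?thesis by (auto simp: indicator_def add.commute)
    qed (simp add: g_zero)
  qed
  also have "\<dots> = ?Q (cball 0 r) + ?m L" by (rule nn_integral_add) auto
  finally have "?Q L + ennreal (1 / r * mu g L) \<le> ?Q (cball 0 r) + ennreal (1 / r * mu g L)"
    using m[of L] m[of "cball 0 r"] rB L by (simp add: compact_imp_bounded)
  then have "?Q L \<le> ?Q (cball 0 r)" by (simp add: ennreal_add_left_cancel_le add.commute)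
  also have "\<dots> = ennreal (d / (d - 1) * (r powr (d - 1) * mu g (cball 0 1)))" by (rule nn_integral_over_norm_ball[OF r])
  also have "r powr (d - 1) * mu g (cball 0 1) = mu g L powr (1 - 1 / d) * mu g (cball 0 1) powr (1 / d)"
  proof -
    have e: "1 / d * (d - 1) = 1 - 1 / d" using d_gt_1 by (simp add: field_simps)
    have "r powr (d - 1) = mu g L powr (1 - 1 / d) / mu g (cball 0 1) powr (1 - 1 / d)"
      unfolding r_def powr_powr e by (rule powr_divide)
    moreover have "mu g (cball 0 1) powr (1 - 1 / d) * mu g (cball 0 1) powr (1 / d) = mu g (cball 0 1)"
      using B by (simp flip: powr_add)
    ultimately have "r powr (d - 1) * mu g (cball 0 1) = mu g L powr (1 - 1 / d) / mu g (cball 0 1) powr (1 - 1 / d)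
        * (mu g (cball 0 1) powr (1 - 1 / d) * mu g (cball 0 1) powr (1 / d))" by (simp only: )
    then show ?thesis using B by simp
  qed
  finally show ?thesis .
qed

end

text \<open>The origin is the midpoint of an interior point and its negative. The theory of the
  gauge starts from this fact.\<close>

lemma origin_interior_if_symmetric:
  fixes K :: "'a::euclidean_space set"
  assumes "convex K" "interior K \<noteq> {}" "origin_symmetric K"
  shows "0 \<in> interior K"
proof -
  obtain x where x: "x \<in> interior K" using assms by auto
  have "uminus ` K = K" using assms(3) by (force simp: origin_symmetric_def image_iff)
  then have "- x \<in> interior K" using x interior_negations[of K] by (metis image_eqI)
  then have "(1/2) *\<^sub>R x + (1/2) *\<^sub>R (- x) \<in> interior K"
    using x by (intro convexD[OF convex_interior[OF assms(1)]]) auto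
  then show ?thesis by simp
qed

lemma nn_integral_ball_abs_inner_over_norm_square_vec:
  fixes w :: "real^'n" and M :: "'m::euclidean_space itself"
  assumes "DIM('m) + 1 = CARD('n)"
  shows "(\<integral>\<^sup>+v. ennreal (\<bar>w \<bullet> v\<bar> / (norm v)\<^sup>2) * indicator (cball 0 1) v \<partial>lborel)
     = ennreal (2 / DIM('m) * unit_ball_vol (DIM('m))) * ennreal (norm w)"
proof (cases "w = 0")
  case False
  define u where "u = (1 / norm w) *\<^sub>R w"
  have u: "norm u = 1" "w = norm w *\<^sub>R u" using False by (auto simp: u_def)
  interpret hyperplane_frame u "hyp_iso M u" by (rule hyp_iso_frame[OF u(1) assms])
  have "\<bar>w \<bullet> v\<bar> / (norm v)\<^sup>2 = norm w * (\<bar>v \<bullet> u\<bar> / (norm v)\<^sup>2)" for v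
    by (subst u(2)) (simp add: abs_mult inner_commute)
  then have "(\<integral>\<^sup>+v. ennreal (\<bar>w \<bullet> v\<bar> / (norm v)\<^sup>2) * indicator (cball 0 1) v \<partial>lborel)
     = (\<integral>\<^sup>+v. ennreal (norm w) * (ennreal (\<bar>v \<bullet> u\<bar> / (norm v)\<^sup>2) * indicator (cball 0 1) v) \<partial>lborel)"
    by (intro nn_integral_cong) (simp only: ennreal_mult' norm_ge_zero mult.assoc)
  also have "\<dots> = ennreal (norm w) * (\<integral>\<^sup>+v. ennreal (\<bar>v \<bullet> u\<bar> / (norm v)\<^sup>2) * indicator (cball 0 1) v \<partial>lborel)"
    by (rule nn_integral_cmult) measurable
  finally show ?thesis unfolding nn_integral_ball_abs_inner_over_norm_square by (simp only: mult.commute)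
qed simp

lemma emeasure_slab_le_vec:
  fixes x :: "real^'n" and M :: "'m::euclidean_space itself"
  assumes dim: "DIM('m) + 1 = CARD('n)" and "x \<noteq> 0" "s > 0"
  shows "(\<integral>\<^sup>+v. indicator {v. \<bar>x \<bullet> v\<bar> < s} v * indicator (cball 0 1) v \<partial>lborel)
     \<le> ennreal (2 * s * unit_ball_vol (DIM('m))) * ennreal (1 / norm x)"
proof -
  define u where "u = (1 / norm x) *\<^sub>R x"
  have u: "norm u = 1" "x = norm x *\<^sub>R u" using assms by (auto simp: u_def)
  interpret hyperplane_frame u "hyp_iso M u" by (rule hyp_iso_frame[OF u(1) dim])
  have "\<bar>x \<bullet> v\<bar> < s \<longleftrightarrow> \<bar>v \<bullet> u\<bar> < s / norm x" for v
    using assms(2) by (subst u(2)) (simp add: abs_mult inner_commute less_divide_eq mult.commute)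
  then have "(\<integral>\<^sup>+v. indicator {v. \<bar>x \<bullet> v\<bar> < s} v * indicator (cball 0 1) v \<partial>lborel) \<le> ennreal (2 * (s / norm x) * unit_ball_vol (DIM('m)))"
    using emeasure_slab_le[of "s / norm x"] assms by simp
  also have "\<dots> = ennreal (2 * s * unit_ball_vol (DIM('m))) * ennreal (1 / norm x)"
    using assms by (subst ennreal_mult''[symmetric]) (auto simp: mult_ac)
  finally show ?thesis .
qed

lemma (in measure_and_body) dir_mass_scaleR: "c > 0 \<Longrightarrow> dir_mass (c *\<^sub>R v) = ennreal c * dir_mass v"
  unfolding dir_mass_def
  by (subst nn_integral_cmult[symmetric])
     (auto intro!: nn_integral_cong simp: abs_mult indicator_def mult_ac simp flip: ennreal_mult')

section \<open>Averaging over directions\<close>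

text \<open>The factor \<open>(d + 1) / d\<close> combines \<open>d + 1\<close> from
  \<open>mixed_mu_lower\<close> with \<open>1 / d\<close>, the integral of
  \<open>t powr (d - 1)\<close>. Monotonicity of the integral asks for no measurability of the mixed
  measure in \<open>t\<close>.\<close>

lemma mu_proj_lower:
  fixes g :: "real^'n \<Rightarrow> real" and d :: real
  assumes mb: "measure_and_body g p K" and d: "d = real CARD('n) + 1 / p"
  shows "ennreal (real CARD('n) / 2 * ((d + 1) / d)) * measure_and_body.dir_mass g K \<theta> \<le> mu_proj g K \<theta>"
proof -
  interpret mb: measure_and_body g p K by fact
  have d': "mb.d = d" by (simp add: mb.d_def d)
  have d1: "d > 1" using mb.d_gt_1 d' by simp
  let ?D = "mb.dir_mass \<theta>"
  have "ennreal (real CARD('n) / 2 * ((d + 1) / d)) * ?D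
     = ennreal (real CARD('n) / 2) * (\<integral>\<^sup>+t. ennreal (t powr (d - 1)) * indicator {0<..1} t * (ennreal (d + 1) * ?D) \<partial>lborel)"
  proof -
    have "(\<integral>\<^sup>+t. ennreal (t powr (d - 1)) * indicator {0<..1} t * (ennreal (d + 1) * ?D) \<partial>lborel)
       = (\<integral>\<^sup>+t. ennreal (t powr (d - 1)) * indicator {0<..1} t \<partial>lborel) * (ennreal (d + 1) * ?D)"
      by (rule nn_integral_multc) measurable
    also have "(\<integral>\<^sup>+t. ennreal (t powr (d - 1)) * indicator {0<..1} t \<partial>lborel) = ennreal (1 / d)"
      using nn_integral_powr_unit_interval[of "d - 1"] d1 by simp
    also have "ennreal (1 / d) * (ennreal (d + 1) * ?D) = ennreal ((d + 1) / d) * ?D"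
    proof -
      have "ennreal (1 / d) * ennreal (d + 1) = ennreal ((d + 1) / d)"
        using d1 by (subst ennreal_mult'[symmetric]) auto
      then show ?thesis by (simp only: mult.assoc[symmetric])
    qed
    finally show ?thesis using d1 by (simp only: ennreal_mult' divide_nonneg_nonneg of_nat_0_le_iff zero_le_numeral mult.assoc)
  qed
  also have "\<dots> \<le> mu_proj g K \<theta>"
    unfolding mu_proj_def
  proof (intro mult_left_mono nn_integral_mono)
    fix t :: real
    show "ennreal (t powr (d - 1)) * indicator {0<..1} t * (ennreal (d + 1) * ?D)
      \<le> mixed_mu g (sdil t K) (closed_segment (- \<theta>) \<theta>) * indicator {0..1} t"
    \<comment> \<open>The value \<open>t = 0\<close>, where the body degenerates to a point, is left
      out of the lower bound.\<close>
    proof (cases "0 < t \<and> t \<le> 1")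
      case True
      have "ennreal (t powr (d - 1)) * (ennreal (d + 1) * ?D) = ennreal (t powr (d - 1) * (d + 1)) * ?D"
        by (simp only: ennreal_mult' powr_ge_zero mult.assoc)
      then show ?thesis using mb.mixed_mu_lower[of t \<theta>] True by (simp add: d')
    qed auto
  qed auto
  finally show ?thesis .
qed

text \<open>Each nonzero \<open>v\<close> in the unit ball stands for the direction v/|v|, and the
  hypothesis is multiplied by 1/|v| before it is integrated over the ball. Fubini then reduces both
  sides to integrals over \<open>v\<close> with \<open>x\<close> held fixed.\<close>

lemma average_projection_section:
  fixes g :: "real^'n \<Rightarrow> real" and M :: "'m::euclidean_space itself" and d \<epsilon> :: real
  assumes dim: "DIM('m) + 1 = CARD('n)" and mb: "measure_and_body g p K" and d: "d = real CARD('n) + 1 / p"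
    and L: "star_body L" and eps: "\<epsilon> \<ge> 0" and B: "mu g (cball 0 1) > 0" and muK: "mu g K > 0"
    and hyp: "\<And>\<theta>. norm \<theta> = 1 \<Longrightarrow> mu_proj g K \<theta> \<le> mu_hyp M g \<theta> (L \<inter> {x. x \<bullet> \<theta> = 0}) + ennreal \<epsilon>"
  shows "real CARD('n) * unit_ball_vol (DIM('m)) / DIM('m) * (mu g K powr (1 - 1 / d) * mu g (cball 0 1) powr (1 / d))
     \<le> unit_ball_vol (DIM('m)) * (d / (d - 1) * (mu g L powr (1 - 1 / d) * mu g (cball 0 1) powr (1 / d)))
       + \<epsilon> * (real CARD('n) / DIM('m) * unit_ball_vol (real CARD('n)))"
proof -
  interpret mb: measure_and_body g p K by fact
  have d': "mb.d = d" by (simp add: mb.d_def d)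
  have d1: "d > 1" using mb.d_gt_1 d' by simp
  define n m where "n = real CARD('n)" and "m = real DIM('m)"
  have nm: "n = m + 1" using dim by (simp add: n_def m_def flip: of_nat_Suc)
  have m1: "m \<ge> 1" using DIM_positive[where 'a='m] unfolding m_def by linarith
  define \<omega> where "\<omega> = unit_ball_vol (real DIM('m))"
  have \<omega>: "\<omega> > 0" by (simp add: \<omega>_def)
  define c1 where "c1 = n / 2 * ((d + 1) / d)"
  have c1: "c1 > 0" using nm m1 d1 by (simp add: c1_def)
  let ?B = "cball 0 1 :: (real^'n) set"
  let ?G = "\<lambda>x. ennreal (g x) * indicator (interior L) x"
  have [measurable]: "interior L \<in> sets borel" by simp
  let ?k = "\<lambda>x v. \<bar>mb.grad x \<bullet> v\<bar> / (norm v)\<^sup>2"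
  let ?cK = "mu g K powr (1 - 1 / d) * mu g ?B powr (1 / d)" and ?cL = "mu g L powr (1 - 1 / d) * mu g ?B powr (1 / d)"
  let ?Z = "\<lambda>k. {z :: (real^'n) \<times> (real^'n). \<bar>fst z \<bullet> snd z\<bar> < 1 / real (Suc k)}"
  \<comment> \<open>This is \<open>mb.dir_mass\<close> in the direction of \<open>v\<close>, divided
    by |v|; its homogeneity in the direction produces the square in \<open>?k\<close>.\<close>
  define D where "D v = (\<integral>\<^sup>+x. ennreal (g x * (mgauge K x * ?k x v)) * indicator K x \<partial>lborel)" for v
  \<comment> \<open>The slab approximation of the section measure orthogonal to \<open>v\<close>,
    divided by |v|. Its slab condition \<open>?Z k\<close> is symmetric in \<open>x\<close> and
    \<open>v\<close>.\<close>
  define H where "H k v = ennreal (real (Suc k) / 2) * (\<integral>\<^sup>+x. ?G x * indicator (?Z k) (x, v) \<partial>lborel)" for k and v :: "real^'n"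
  have setm[measurable]: "?Z k \<in> sets (borel \<Otimes>\<^sub>M (borel :: (real^'n) measure))" for k
  proof -
    have "{z \<in> space (borel \<Otimes>\<^sub>M (borel :: (real^'n) measure)). \<bar>fst z \<bullet> snd z\<bar> < 1 / real (Suc k)} \<in> sets (borel \<Otimes>\<^sub>M borel)"
      by measurable
    then show ?thesis by (simp add: space_pair_measure)
  qed
  have Dm[measurable]: "D \<in> borel_measurable borel" unfolding D_def[abs_def] by measurable
  have Hm[measurable]: "H k \<in> borel_measurable borel" for k unfolding H_def[abs_def] by measurable
  have pointwise: "ennreal c1 * D v \<le> liminf (\<lambda>k. H k v) + ennreal \<epsilon> * ennreal (1 / norm v)" if v: "v \<noteq> 0" for v
  proof -
    define \<theta> where "\<theta> = (1 / norm v) *\<^sub>R v"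
    have \<theta>: "norm \<theta> = 1" using v by (simp add: \<theta>_def)
    have nv: "norm v > 0" using v by simp
    have "D v = ennreal (1 / norm v) * mb.dir_mass \<theta>"
    proof -
      have "ennreal (1 / norm v) * mb.dir_mass \<theta> = ennreal (1 / norm v) * (ennreal (1 / norm v) * mb.dir_mass v)"
        using nv unfolding \<theta>_def by (subst mb.dir_mass_scaleR) auto
      also have "\<dots> = ennreal (1 / (norm v)\<^sup>2) * mb.dir_mass v"
        using nv by (simp add: mult.assoc[symmetric] power2_eq_square flip: ennreal_mult')
      also have "\<dots> = D v"
        unfolding D_def mb.dir_mass_def
        by (subst nn_integral_cmult[symmetric])
           (auto intro!: nn_integral_cong simp: indicator_def mult_ac simp flip: ennreal_mult')
      finally show ?thesis by simp
    qed
    then have "ennreal c1 * D v = ennreal (1 / norm v) * (ennreal c1 * mb.dir_mass \<theta>)" by (simp only: mult_ac)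
    also have "\<dots> \<le> ennreal (1 / norm v) * (mu_hyp M g \<theta> (L \<inter> {x. x \<bullet> \<theta> = 0}) + ennreal \<epsilon>)"
      using order_trans[OF mu_proj_lower[OF mb d, of \<theta>] hyp[OF \<theta>]] unfolding c1_def n_def by (intro mult_left_mono) auto
    also have "\<dots> = ennreal (1 / norm v) * mu_hyp M g \<theta> (L \<inter> {x. x \<bullet> \<theta> = 0}) + ennreal \<epsilon> * ennreal (1 / norm v)"
      by (simp add: distrib_left mult.commute)
    also have "ennreal (1 / norm v) * mu_hyp M g \<theta> (L \<inter> {x. x \<bullet> \<theta> = 0}) \<le> liminf (\<lambda>k. H k v)"
    proof -
      \<comment> \<open>This width turns the slab around the hyperplane orthogonal to
        \<open>\<theta>\<close> into the slab of \<open>?Z k\<close>, and the product of 1/|v| and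
        \<open>1 / (2 * \<eta> k)\<close> into the factor \<open>real (Suc k) / 2\<close> of
        \<open>H\<close>.\<close>
      define \<eta> where "\<eta> k = 1 / (real (Suc k) * norm v)" for k
      have \<eta>: "\<eta> k > 0" for k using nv by (simp add: \<eta>_def del: of_nat_Suc)
      have "(\<lambda>k. 1 / norm v * inverse (real (Suc k))) \<longlonglongrightarrow> 1 / norm v * 0"
        by (intro tendsto_intros LIMSEQ_inverse_real_of_nat)
      then have \<eta>0: "\<eta> \<longlonglongrightarrow> 0" by (simp add: \<eta>_def[abs_def] divide_inverse mult.commute del: of_nat_Suc)
      have "ennreal (1 / norm v) * mu_hyp M g \<theta> (L \<inter> {x. x \<bullet> \<theta> = 0})
         \<le> ennreal (1 / norm v) * liminf (\<lambda>k. ennreal (1 / (2 * \<eta> k)) * (\<integral>\<^sup>+x. ?G x * indicator {x. \<bar>x \<bullet> \<theta>\<bar> < \<eta> k} x \<partial>lborel))"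
        by (intro mult_left_mono mu_hyp_le_liminf_slab \<theta> dim mb.cont mb.g_nonneg L \<eta> \<eta>0) auto
      also have "\<dots> = liminf (\<lambda>k. ennreal (1 / norm v) * (ennreal (1 / (2 * \<eta> k)) * (\<integral>\<^sup>+x. ?G x * indicator {x. \<bar>x \<bullet> \<theta>\<bar> < \<eta> k} x \<partial>lborel)))"
        by (rule liminf_ennreal_cmult[symmetric]) simp
      also have "\<dots> = liminf (\<lambda>k. H k v)"
      proof -
        have "ennreal (1 / norm v) * (ennreal (1 / (2 * \<eta> k)) * (\<integral>\<^sup>+x. ?G x * indicator {x. \<bar>x \<bullet> \<theta>\<bar> < \<eta> k} x \<partial>lborel)) = H k v" for k
        proof -
          have "1 / norm v * (1 / (2 * \<eta> k)) = real (Suc k) / 2" using nv by (simp add: \<eta>_def del: of_nat_Suc)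
          moreover have "ennreal (1 / norm v) * ennreal (1 / (2 * \<eta> k)) = ennreal (1 / norm v * (1 / (2 * \<eta> k)))"
            by (rule ennreal_mult'[symmetric]) simp
          ultimately have "ennreal (1 / norm v) * ennreal (1 / (2 * \<eta> k)) = ennreal (real (Suc k) / 2)"
            by (simp only:)
          moreover have "\<bar>x \<bullet> \<theta>\<bar> < \<eta> k \<longleftrightarrow> \<bar>x \<bullet> v\<bar> < 1 / real (Suc k)" for x
          proof -
            have "\<bar>x \<bullet> \<theta>\<bar> = \<bar>x \<bullet> v\<bar> / norm v" using nv by (simp add: \<theta>_def abs_mult)
            moreover have "\<eta> k = (1 / real (Suc k)) / norm v" by (simp add: \<eta>_def)
            ultimately show ?thesis using nv by (simp only: divide_less_cancel) auto
          qed
          ultimately show ?thesis unfolding H_def by (simp add: mult.assoc[symmetric] indicator_def)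
        qed
        then show ?thesis by simp
      qed
      finally show ?thesis .
    qed
    finally show ?thesis by (simp add: add_right_mono)
  qed
  have lhs: "(\<integral>\<^sup>+v. D v * indicator ?B v \<partial>lborel) = ennreal (2 / m * \<omega>) * mb.grad_mass K"
  proof -
    have "(\<integral>\<^sup>+v. D v * indicator ?B v \<partial>lborel)
      = (\<integral>\<^sup>+v. \<integral>\<^sup>+x. ennreal (g x * (mgauge K x * ?k x v)) * indicator K x * indicator ?B v \<partial>lborel \<partial>lborel)"
      unfolding D_def by (intro nn_integral_cong nn_integral_multc[symmetric]) measurable
    also have "\<dots> = (\<integral>\<^sup>+x. \<integral>\<^sup>+v. ennreal (g x * (mgauge K x * ?k x v)) * indicator K x * indicator ?B v \<partial>lborel \<partial>lborel)"
      by (rule lborel_pair.Fubini') measurable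
    also have "\<dots> = (\<integral>\<^sup>+x. ennreal (2 / m * \<omega>) * (ennreal (g x * (mgauge K x * norm (mb.grad x))) * indicator K x) \<partial>lborel)"
    proof (intro nn_integral_cong)
      fix x
      let ?c = "ennreal (g x * mgauge K x) * indicator K x"
      have nn: "0 \<le> g x * mgauge K x" using mb.g_nonneg mb.gauge_nonneg by simp
      have "(\<integral>\<^sup>+v. ennreal (g x * (mgauge K x * ?k x v)) * indicator K x * indicator ?B v \<partial>lborel)
         = (\<integral>\<^sup>+v. ?c * (ennreal (?k x v) * indicator ?B v) \<partial>lborel)"
      proof (intro nn_integral_cong)
        fix v
        have "ennreal (g x * (mgauge K x * ?k x v)) = ennreal (g x * mgauge K x) * ennreal (?k x v)"
          unfolding mult.assoc[symmetric, of "g x"] using nn by (rule ennreal_mult')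
        then show "ennreal (g x * (mgauge K x * ?k x v)) * indicator K x * indicator ?B v
          = ?c * (ennreal (?k x v) * indicator ?B v)" by (simp only: mult_ac)
      qed
      also have "\<dots> = ?c * (\<integral>\<^sup>+v. ennreal (?k x v) * indicator ?B v \<partial>lborel)"
        by (rule nn_integral_cmult) measurable
      also have "\<dots> = ?c * (ennreal (2 / m * \<omega>) * ennreal (norm (mb.grad x)))"
        by (simp only: nn_integral_ball_abs_inner_over_norm_square_vec[OF dim] m_def \<omega>_def)
      also have "\<dots> = ennreal (2 / m * \<omega>) * ((ennreal (g x * mgauge K x) * ennreal (norm (mb.grad x))) * indicator K x)"
        by (simp only: mult_ac)
      also have "ennreal (g x * mgauge K x) * ennreal (norm (mb.grad x)) = ennreal (g x * (mgauge K x * norm (mb.grad x)))"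
        unfolding mult.assoc[symmetric, of "g x"] using nn by (rule ennreal_mult'[symmetric])
      finally show "(\<integral>\<^sup>+v. ennreal (g x * (mgauge K x * ?k x v)) * indicator K x * indicator ?B v \<partial>lborel)
         = ennreal (2 / m * \<omega>) * (ennreal (g x * (mgauge K x * norm (mb.grad x))) * indicator K x)" .
    qed
    also have "\<dots> = ennreal (2 / m * \<omega>) * mb.grad_mass K"
      unfolding mb.grad_mass_def by (rule nn_integral_cmult) measurable
    finally show ?thesis .
  qed
  \<comment> \<open>For fixed \<open>x\<close> the admissible \<open>v\<close> form a slab
    themselves, of volume at most 2 s \<omega> / |x| in the unit ball; the prefactor of
    \<open>H\<close> cancels 2 s, so the bound is uniform in \<open>k\<close>.\<close>
  have Hk: "(\<integral>\<^sup>+v. H k v * indicator ?B v \<partial>lborel) \<le> ennreal \<omega> * (\<integral>\<^sup>+x. ennreal (g x) * ennreal (1 / norm x) * indicator L x \<partial>lborel)" for k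
  proof -
    define s where "s = 1 / real (Suc k)"
    have s: "s > 0" by (simp add: s_def)
    have "(\<integral>\<^sup>+v. H k v * indicator ?B v \<partial>lborel)
      = (\<integral>\<^sup>+v. \<integral>\<^sup>+x. ennreal (real (Suc k) / 2) * (?G x * indicator (?Z k) (x, v)) * indicator ?B v \<partial>lborel \<partial>lborel)"
      unfolding H_def
      by (intro nn_integral_cong, subst nn_integral_multc, measurable, subst nn_integral_cmult, measurable)
    also have "\<dots> = (\<integral>\<^sup>+x. \<integral>\<^sup>+v. ennreal (real (Suc k) / 2) * (?G x * indicator (?Z k) (x, v)) * indicator ?B v \<partial>lborel \<partial>lborel)"
      by (rule lborel_pair.Fubini') measurable
    also have "\<dots> \<le> (\<integral>\<^sup>+x. ennreal \<omega> * (ennreal (g x) * ennreal (1 / norm x) * indicator L x) \<partial>lborel)"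
    proof (intro nn_integral_mono_AE, use AE_lborel_singleton[of "0::real^'n"] in eventually_elim)
      case (elim x)
      let ?c = "ennreal (real (Suc k) / 2) * ?G x"
      have [measurable]: "{v. \<bar>x \<bullet> v\<bar> < s} \<in> sets borel" by measurable
      have "(\<integral>\<^sup>+v. ennreal (real (Suc k) / 2) * (?G x * indicator (?Z k) (x, v)) * indicator ?B v \<partial>lborel)
         = (\<integral>\<^sup>+v. ?c * (indicator {v. \<bar>x \<bullet> v\<bar> < s} v * indicator ?B v) \<partial>lborel)"
        by (intro nn_integral_cong) (auto simp: indicator_def s_def)
      also have "\<dots> = ?c * (\<integral>\<^sup>+v. indicator {v. \<bar>x \<bullet> v\<bar> < s} v * indicator ?B v \<partial>lborel)"
        by (rule nn_integral_cmult) measurable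
      also have "\<dots> \<le> ?c * (ennreal (2 * s * \<omega>) * ennreal (1 / norm x))"
        unfolding \<omega>_def by (intro mult_left_mono emeasure_slab_le_vec[OF dim elim s]) auto
      also have "\<dots> = (ennreal (real (Suc k) / 2) * ennreal (2 * s * \<omega>)) * (?G x * ennreal (1 / norm x))"
        by (simp only: mult_ac)
      also have "ennreal (real (Suc k) / 2) * ennreal (2 * s * \<omega>) = ennreal \<omega>"
        by (subst ennreal_mult'[symmetric]) (auto simp: s_def simp del: of_nat_Suc)
      also have "ennreal \<omega> * (?G x * ennreal (1 / norm x)) \<le> ennreal \<omega> * (ennreal (g x) * ennreal (1 / norm x) * indicator L x)"
        using interior_subset[of L] by (intro mult_left_mono) (auto simp: indicator_def)
      finally show ?case .
    qed
    also have "\<dots> = ennreal \<omega> * (\<integral>\<^sup>+x. ennreal (g x) * ennreal (1 / norm x) * indicator L x \<partial>lborel)"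
    proof (rule nn_integral_cmult)
      have [measurable]: "L \<in> sets borel" using L by (auto simp: star_body_def borel_compact)
      show "(\<lambda>x. ennreal (g x) * ennreal (1 / norm x) * indicator L x) \<in> borel_measurable lborel" by measurable
    qed
    finally show ?thesis .
  qed
  have Q: "(\<integral>\<^sup>+x. ennreal (g x) * ennreal (1 / norm x) * indicator L x \<partial>lborel)
      \<le> ennreal (d / (d - 1) * (mu g L powr (1 - 1 / d) * mu g (cball 0 1) powr (1 / d)))"
    using mb.nn_integral_over_norm_le[OF _ B, of L] L by (simp add: d' star_body_def)
  have T2: "(\<integral>\<^sup>+v. ennreal (1 / norm v) * indicator ?B v \<partial>lborel) = ennreal (n / m * unit_ball_vol n)"
  proof -
    have "(\<integral>\<^sup>+v. 1 * ennreal (1 / norm v) * indicator ?B v \<partial>lborel)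
        = ennreal ((real DIM(real^'n) + 0) / (real DIM(real^'n) + 0 - 1)) * (\<integral>\<^sup>+v. 1 * indicator ?B v \<partial>lborel)"
      using nm m1 by (intro nn_integral_homogeneous_over_norm) (auto simp: n_def)
    also have "(\<integral>\<^sup>+v. 1 * indicator ?B v \<partial>lborel) = ennreal (unit_ball_vol n)"
      using emeasure_unit_cball[where 'a="real^'n"] by (simp add: n_def)
    finally have "(\<integral>\<^sup>+v. ennreal (1 / norm v) * indicator ?B v \<partial>lborel) = ennreal (n / m) * ennreal (unit_ball_vol n)"
      using nm by (simp add: n_def)
    then show ?thesis using nm m1 by (simp only: ennreal_mult' divide_nonneg_nonneg)
  qed
  have "ennreal c1 * (ennreal (2 / m * \<omega>) * ennreal (d / (d + 1) * ?cK))
      \<le> ennreal c1 * (\<integral>\<^sup>+v. D v * indicator ?B v \<partial>lborel)"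
    unfolding lhs using mb.grad_mass_lower[OF B muK] by (intro mult_left_mono) (auto simp: d')
  also have "\<dots> = (\<integral>\<^sup>+v. ennreal c1 * D v * indicator ?B v \<partial>lborel)"
    by (subst nn_integral_cmult[symmetric]) (auto simp: mult.assoc)
  also have "\<dots> \<le> (\<integral>\<^sup>+v. liminf (\<lambda>k. H k v * indicator ?B v) + ennreal \<epsilon> * (ennreal (1 / norm v) * indicator ?B v) \<partial>lborel)"
  proof (intro nn_integral_mono_AE, use AE_lborel_singleton[of "0::real^'n"] in eventually_elim)
    case (elim v)
    then show ?case using pointwise[of v] by (auto simp: indicator_def)
  qed
  also have "\<dots> = (\<integral>\<^sup>+v. liminf (\<lambda>k. H k v * indicator ?B v) \<partial>lborel) + ennreal \<epsilon> * ennreal (n / m * unit_ball_vol n)"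
    by (subst nn_integral_add) (auto simp: nn_integral_cmult T2)
  also have "(\<integral>\<^sup>+v. liminf (\<lambda>k. H k v * indicator ?B v) \<partial>lborel) \<le> liminf (\<lambda>k. \<integral>\<^sup>+v. H k v * indicator ?B v \<partial>lborel)"
    by (rule nn_integral_liminf) measurable
  also have "\<dots> \<le> liminf (\<lambda>k::nat. ennreal \<omega> * ennreal (d / (d - 1) * ?cL))"
    by (intro Liminf_mono always_eventually allI order_trans[OF Hk] mult_left_mono Q) auto
  also have "\<dots> = ennreal \<omega> * ennreal (d / (d - 1) * ?cL)"
    by (simp add: Liminf_const)
  finally have "ennreal c1 * (ennreal (2 / m * \<omega>) * ennreal (d / (d + 1) * ?cK))
      \<le> ennreal \<omega> * ennreal (d / (d - 1) * ?cL) + ennreal \<epsilon> * ennreal (n / m * unit_ball_vol n)"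
    by (simp add: add_right_mono)
  moreover have "ennreal c1 * (ennreal (2 / m * \<omega>) * ennreal (d / (d + 1) * ?cK))
     = ennreal (c1 * (2 / m * \<omega> * (d / (d + 1) * ?cK)))"
    using c1 m1 \<omega> by (intro ennreal_mult3) auto
  moreover have "ennreal \<omega> * ennreal (d / (d - 1) * ?cL) + ennreal \<epsilon> * ennreal (n / m * unit_ball_vol n)
     = ennreal (\<omega> * (d / (d - 1) * ?cL) + \<epsilon> * (n / m * unit_ball_vol n))"
  proof -
    have "n \<ge> 0" by (simp add: n_def)
    then show ?thesis
      using \<omega> eps d1 m1 by (subst ennreal_plus) (auto simp del: times_divide_eq_left times_divide_eq_right intro!: arg_cong2[where f="(+)"] ennreal_mult'[symmetric] mult_nonneg_nonneg)
  qed
  ultimately have "ennreal (c1 * (2 / m * \<omega> * (d / (d + 1) * ?cK)))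
     \<le> ennreal (\<omega> * (d / (d - 1) * ?cL) + \<epsilon> * (n / m * unit_ball_vol n))"
    by simp
  moreover have "0 \<le> \<omega> * (d / (d - 1) * ?cL) + \<epsilon> * (n / m * unit_ball_vol n)"
    using \<omega> eps d1 m1 by (simp add: n_def)
  ultimately have "c1 * (2 / m * \<omega> * (d / (d + 1) * ?cK))
     \<le> \<omega> * (d / (d - 1) * ?cL) + \<epsilon> * (n / m * unit_ball_vol n)"
    by simp
  \<comment> \<open>The factors \<open>(d + 1) / d\<close> from the projection and
    \<open>d / (d + 1)\<close> from the gradient mass cancel.\<close>
  moreover have "c1 * (2 / m * \<omega> * (d / (d + 1) * x)) = n * \<omega> / m * x" for x
    using d1 m1 by (simp add: c1_def)
  ultimately show ?thesis by (simp add: n_def m_def \<omega>_def)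
qed

theorem theorem1p4:
  fixes g :: "real^'n \<Rightarrow> real" and p \<epsilon> :: real
    and K L :: "(real^'n) set"
    and M :: "'m::euclidean_space itself"
  assumes n2: "CARD('n) \<ge> 2"
    and dimM: "DIM('m) + 1 = CARD('n)"
    and p: "p > 0"
    and g_cont: "continuous_on UNIV g"
    and g_conc: "p_concave p g"
    and g_hom: "homogeneous (1 / p) g"
    and K: "convex_body K" "origin_symmetric K"
    and L: "star_body L"
    and eps: "\<epsilon> \<ge> 0"
    and hyp: "\<And>\<theta>. norm \<theta> = 1 \<Longrightarrow>
               mu_proj g K \<theta> \<le> mu_hyp M g \<theta> (L \<inter> {x. x \<bullet> \<theta> = 0}) + ennreal \<epsilon>"
  shows "let q = 1 / (real CARD('n) + 1 / p) in
         mu g K powr (1 - q)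
           \<le> ((1 - 1 / real CARD('n)) / (1 - q)) * mu g L powr (1 - q)
             + unit_ball_vol (real CARD('n))
               / (mu g (cball 0 1) powr q * unit_ball_vol (real CARD('n) - 1)) * \<epsilon>"
proof -
  have "convex_body_origin K"
    using K origin_interior_if_symmetric[of K] by (auto simp: convex_body_def convex_body_origin_def)
  moreover have "homogeneous_density g p"
    using p g_cont g_conc g_hom by unfold_locales
  ultimately have mb: "measure_and_body g p K" by (simp add: measure_and_body_def)
  interpret measure_and_body g p K by (rule mb)
  define n \<delta> where "n = real CARD('n)" and "\<delta> = real CARD('n) + 1 / p"
  have d: "d = \<delta>" by (simp add: d_def \<delta>_def)
  have \<delta>1: "\<delta> > 1" using d_gt_1 d by simp
  have n: "n \<ge> 2" using n2 by (simp add: n_def)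
  have m: "real DIM('m) = n - 1" using dimM by (simp add: n_def flip: of_nat_Suc)
  let ?B = "mu g (cball 0 1)"
  have rhs: "0 \<le> (1 - 1 / n) / (1 - 1 / \<delta>) * mu g L powr (1 - 1 / \<delta>) + unit_ball_vol n / (?B powr (1 / \<delta>) * unit_ball_vol (n - 1)) * \<epsilon>"
    using n \<delta>1 eps by simp
  have "mu g K powr (1 - 1 / \<delta>)
      \<le> (1 - 1 / n) / (1 - 1 / \<delta>) * mu g L powr (1 - 1 / \<delta>) + unit_ball_vol n / (?B powr (1 / \<delta>) * unit_ball_vol (n - 1)) * \<epsilon>"
  \<comment> \<open>With \<open>mu g K = 0\<close> the left side is zero. Otherwise the unit ball
    has positive measure, so division by a vanishing measure of the ball can occur only in the
    trivial case.\<close>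
  proof (cases "mu g K = 0")
    case True
    then show ?thesis using rhs by simp
  next
    case False
    then have muK: "mu g K > 0" using mu_nonneg[of K] by linarith
    \<comment> \<open>A null unit ball would, by homogeneity, make every centred ball null,
      including one that contains \<open>K\<close>.\<close>
    have B: "?B > 0"
    proof (rule ccontr)
      assume "\<not> ?B > 0"
      then have B0: "?B = 0" using mu_nonneg[of "cball 0 1"] by linarith
      obtain R where R: "R > 0" "K \<subseteq> cball 0 R" using K_bounded by (auto simp: bounded_pos subset_iff)
      have "mu g K \<le> mu g (cball 0 R)" using R by (intro mu_mono) auto
      also have "\<dots> = mu g (sdil R (cball 0 1))" using R by (simp add: sdil_cball)
      also have "\<dots> = 0" using R B0 by (subst mu_sdil) auto
      finally show False using muK by simp
    qed
    define x y b where "x = mu g K powr (1 - 1 / \<delta>)" and "y = mu g L powr (1 - 1 / \<delta>)" and "b = ?B powr (1 / \<delta>)"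
    define \<omega> where "\<omega> = unit_ball_vol (n - 1)"
    have \<omega>: "\<omega> > 0" using n by (simp add: \<omega>_def)
    have b: "b > 0" using B by (simp add: b_def)
    have "n * \<omega> / (n - 1) * (x * b) \<le> \<omega> * (\<delta> / (\<delta> - 1) * (y * b)) + \<epsilon> * (n / (n - 1) * unit_ball_vol n)"
      using average_projection_section[OF dimM mb \<delta>_def L eps B muK hyp] unfolding m x_def y_def b_def \<omega>_def n_def[symmetric] by simp
    then have "(n - 1) / (n * \<omega> * b) * (n * \<omega> / (n - 1) * (x * b))
       \<le> (n - 1) / (n * \<omega> * b) * (\<omega> * (\<delta> / (\<delta> - 1) * (y * b)) + \<epsilon> * (n / (n - 1) * unit_ball_vol n))"
      using n \<omega> b by (intro mult_left_mono) auto
    moreover have "(n - 1) / (n * \<omega> * b) * (n * \<omega> / (n - 1) * (x * b)) = x" using n \<omega> b by simp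
    moreover have "(n - 1) / (n * \<omega> * b) * (\<omega> * (\<delta> / (\<delta> - 1) * (y * b)) + \<epsilon> * (n / (n - 1) * unit_ball_vol n))
       = (1 - 1 / n) / (1 - 1 / \<delta>) * y + unit_ball_vol n / (b * \<omega>) * \<epsilon>"
    proof -
      have "(n - 1) / (n * \<omega> * b) * (\<omega> * (\<delta> / (\<delta> - 1) * (y * b))) = (n - 1) / n * (\<delta> / (\<delta> - 1)) * y" using n \<omega> b by simp
      moreover have "(n - 1) / n = 1 - 1 / n" "\<delta> / (\<delta> - 1) = 1 / (1 - 1 / \<delta>)" using n \<delta>1 by (auto simp: field_simps)
      moreover have "(n - 1) / (n * \<omega> * b) * (\<epsilon> * (n / (n - 1) * unit_ball_vol n)) = unit_ball_vol n / (b * \<omega>) * \<epsilon>"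
        using n \<omega> b by (simp add: mult.commute)
      ultimately show ?thesis by (simp add: distrib_left)
    qed
    ultimately show ?thesis unfolding x_def y_def b_def \<omega>_def by simp
  qed
  then show ?thesis by (simp add: Let_def n_def \<delta>_def)
qed

end
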